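(* Let $k,N$ be positive integers, $\chi$ a Dirichlet character modulo $N$, and $f(z)=\sum_{n\geq 0}a(n)q^n\in M_k(N,\chi)$ a normalized Hecke eigenform. Let $w\ge 0$ be an integer, $r$ a positive integer, $t$ a square-free positive integer with $t\mid N$ and $\gcd(t,r)=1$, and $M$ a positive integer with $4Nr\mid M$. Then the $t$-Shimura lift of the cusp form $\left[f(4rz),\theta(tz)\right]_w\in S_{k+2w+1/2}(M,\chi\chi_t\chi_{-4}^{k})$ is \[ \binom{2w}{w}\binom{k+2w-1}{k+w-1}^{-1}a(t)\,t^w\sum_{d\mid r}[f(rz/d),f_{\chi_{0,r/d}}(dz)]_{2w}\bigg|\prod_{p\mid M_d}\left(I-\chi(p)p^{k+2w-1}B(p)\right), \] where $M_d:=2\operatorname{rad}(M)/\operatorname{rad}(r/d)$ and the product is over primes $p$ dividing $M_d$.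
   Context: $q=e^{2\pi i z}$. $M_k(N,\chi)$, $S_k(N,\chi)$ denote modular forms and cusp forms of weight $k$ on $\Gamma_0(N)$ with character $\chi$ (Shimura's spaces in half-integral weight). A normalized Hecke eigenform $f=\sum a(n)q^n\in M_k(N,\chi)$ satisfies $a(1)=1$ and $a(m)a(n)=\sum_{d\mid\gcd(m,n)}\chi(d)d^{k-1}a(mn/d^2)$ for all $m,n\ge1$. $\chi_t$ is the primitive character attached to $\mathbb{Q}(\sqrt t)/\mathbb{Q}$, $\chi_{-4}$ that of $\mathbb{Q}(i)$, and $\chi_{0,d}$ is the trivial character modulo $d$. $\theta(tz)=\sum_{n\in\mathbb{Z}}q^{tn^2}$ (weight $1/2$). For a character $\psi$ and $g=\sum c(n)q^n$, $g_\psi=\sum\psi(n)c(n)q^n$. $\operatorname{rad}(n)$ is the product of the distinct primes dividing $n$. For $a,b\in\mathbb{R}$, $l\in\mathbb{N}$: $F(z)|(aI+bB(l))=aF(z)+bF(lz)$, and products of such operators act by composition. Rankin–Cohen bracket: for $F,G$ of weights $k_1,k_2$, $[F,G]_w=(2\pi i)^{-w}\sum_{j=0}^w(-1)^j\binom{k_1+w-1}{w-j}\binom{k_2+w-1}{j}F^{(j)}G^{(w-j)}$ (generalized binomials, derivatives in $z$); $f(4rz),f(rz/d),f_{\chi_{0,r/d}}(dz)$ have weight $k$, $\theta(tz)$ weight $1/2$. Shimura lift: for $h=\sum_{n\ge1}b(n)q^n$ of weight $K+1/2$ on $\Gamma_0(M)$ ($4\mid M$) with character $\chi'$ and square-free $t>0$,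 define $A_t(n)$ by $\sum A_t(n)n^{-s}=L(s-K+1,\chi'\chi_{-4}^K\chi_t)\sum b(tn^2)n^{-s}$ with $\chi'\chi_{-4}^K\chi_t$ regarded as a character modulo $M$; the $t$-Shimura lift is $\sum A_t(n)q^n$.
   Formalization: The printed M_d is proved only for N even or r odd (it fails for f=Δ, r=2, M=8); for all r the formula is proved with M_d=rad(M)/rad(r/d). The bracket is shown to be a cusp form if w>0 or f is cuspidal (false for w=0, f non-cuspidal); the lift formula assumes it is one. *)

theory Defs
  imports
    "HOL-Complex_Analysis.Complex_Analysis"
    "HOL-Number_Theory.Number_Theory"
    "HOL-Computational_Algebra.Squarefree"
begin

definition dirichlet_character :: "nat \<Rightarrow> (int \<Rightarrow> complex) \<Rightarrow> bool" where
  "dirichlet_character N chi \<longleftrightarrow>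
     (\<forall>a b. chi (a * b) = chi a * chi b) \<and>
     (\<forall>a b. [a = b] (mod int N) \<longrightarrow> chi a = chi b) \<and>
     (\<forall>a. chi a \<noteq> 0 \<longleftrightarrow> coprime a (int N))"

definition trivial_character :: "nat \<Rightarrow> int \<Rightarrow> complex" where
  "trivial_character m n = (if coprime n (int m) then 1 else 0)"

definition kronecker_prime :: "int \<Rightarrow> nat \<Rightarrow> int" where
  "kronecker_prime a p =
     (if p = 2 then (if even a then 0 else if a mod 8 \<in> {1, 7} then 1 else - 1)
      else Legendre a (int p))"

text \<open>
  The Kronecker symbol. For odd \<open>n\<close> it coincides with the extended quadratic residue symbol
  of Shimura's half-integral weight theory; in particular it is \<open>1\<close> at \<open>a = 0\<close>, \<open>n = \<plusminus>1\<close>, and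
  the sign is \<open>-1\<close> exactly if both arguments are negative.
\<close>

definition kronecker :: "int \<Rightarrow> int \<Rightarrow> int" where
  "kronecker a n =
     (if n = 0 then (if \<bar>a\<bar> = 1 then 1 else 0)
      else (if a < 0 \<and> n < 0 then - 1 else 1) *
           (\<Prod>p\<in>prime_factors (nat \<bar>n\<bar>). kronecker_prime a p ^ multiplicity p (nat \<bar>n\<bar>)))"

text \<open>
  For square-free \<open>t\<close>, the primitive character attached to \<open>\<rat>(\<surd>t)\<close>: the Kronecker symbol of
  the field discriminant. The case \<open>t = -1\<close> is the character of \<open>\<rat>(i)\<close>.
\<close>

definition quadratic_character :: "int \<Rightarrow> int \<Rightarrow> complex" where
  "quadratic_character t n = of_int (kronecker (if t mod 4 = 1 then t else 4 * t) n)"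

abbreviation chi_minus4 :: "int \<Rightarrow> complex" where
  "chi_minus4 \<equiv> quadratic_character (- 1)"

definition rad :: "nat \<Rightarrow> nat" where
  "rad n = \<Prod>(prime_factors n)"

definition qexp :: "complex \<Rightarrow> complex" where
  "qexp z = exp (2 * of_real pi * \<i> * z)"

definition has_q_expansion :: "(complex \<Rightarrow> complex) \<Rightarrow> (nat \<Rightarrow> complex) \<Rightarrow> bool" where
  "has_q_expansion F c \<longleftrightarrow> (\<forall>z. Im z > 0 \<longrightarrow> (\<lambda>n. c n * qexp z ^ n) sums F z)"

definition q_coeffs :: "(complex \<Rightarrow> complex) \<Rightarrow> nat \<Rightarrow> complex" where
  "q_coeffs F = (THE c. has_q_expansion F c)"

definition q_series :: "(nat \<Rightarrow> complex) \<Rightarrow> complex \<Rightarrow> complex" where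
  "q_series c z = (\<Sum>n. c n * qexp z ^ n)"

definition twist :: "(int \<Rightarrow> complex) \<Rightarrow> (complex \<Rightarrow> complex) \<Rightarrow> complex \<Rightarrow> complex" where
  "twist \<psi> g = q_series (\<lambda>n. \<psi> (int n) * q_coeffs g n)"

definition theta :: "complex \<Rightarrow> complex" where
  "theta z = (\<Sum>\<^sub>\<infinity>n::int. qexp (of_int (n\<^sup>2) * z))"

abbreviation int_moebius :: "int \<Rightarrow> int \<Rightarrow> int \<Rightarrow> int \<Rightarrow> complex \<Rightarrow> complex" where
  "int_moebius a b c d \<equiv> moebius (of_int a) (of_int b) (of_int c) (of_int d)"

definition modular_form :: "nat \<Rightarrow> nat \<Rightarrow> (int \<Rightarrow> complex) \<Rightarrow> (complex \<Rightarrow> complex) \<Rightarrow> bool" where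
  "modular_form k N chi f \<longleftrightarrow>
     f holomorphic_on {z. Im z > 0} \<and>
     (\<forall>a b c d z. a * d - b * c = 1 \<longrightarrow> int N dvd c \<longrightarrow> Im z > 0 \<longrightarrow>
        f (int_moebius a b c d z) = chi d * (of_int c * z + of_int d) ^ k * f z) \<and>
     (\<forall>a b c d. a * d - b * c = 1 \<longrightarrow>
        Bfun (\<lambda>z. f (int_moebius a b c d z) / (of_int c * z + of_int d) ^ k)
          (filtercomap Im at_top))"

definition cusp_form :: "nat \<Rightarrow> nat \<Rightarrow> (int \<Rightarrow> complex) \<Rightarrow> (complex \<Rightarrow> complex) \<Rightarrow> bool" where
  "cusp_form k N chi f \<longleftrightarrow>
     modular_form k N chi f \<and>
     (\<forall>a b c d. a * d - b * c = 1 \<longrightarrow>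
        ((\<lambda>z. f (int_moebius a b c d z) / (of_int c * z + of_int d) ^ k) \<longlongrightarrow> 0)
          (filtercomap Im at_top))"

text \<open>
  Shimura's automorphy factor \<open>j(\<gamma>, z) = \<theta>(\<gamma>z) / \<theta>(z)\<close> on \<open>\<Gamma>\<^sub>0(4)\<close> in its explicit form
  \<open>\<epsilon>\<^sub>d\<^sup>-\<^sup>1 (c/d) (cz + d)\<^sup>1\<^sup>/\<^sup>2\<close>; \<open>csqrt\<close> is the branch with argument in \<open>(-\<pi>/2, \<pi>/2]\<close>.
\<close>

definition theta_factor :: "int \<Rightarrow> int \<Rightarrow> complex \<Rightarrow> complex" where
  "theta_factor c d z =
     inverse (if d mod 4 = 1 then 1 else \<i>) * of_int (kronecker c d) *
     csqrt (of_int c * z + of_int d)"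

text \<open>
  Cusp forms of weight \<open>K + 1/2\<close> on \<open>\<Gamma>\<^sub>0(M)\<close>, \<open>4\<close> dividing \<open>M\<close>. Vanishing at a cusp does not
  depend on the choice of the square root of \<open>cz + d\<close>.
\<close>

definition half_integral_cusp_form ::
  "nat \<Rightarrow> nat \<Rightarrow> (int \<Rightarrow> complex) \<Rightarrow> (complex \<Rightarrow> complex) \<Rightarrow> bool" where
  "half_integral_cusp_form K M chi h \<longleftrightarrow>
     h holomorphic_on {z. Im z > 0} \<and>
     (\<forall>a b c d z. a * d - b * c = 1 \<longrightarrow> int M dvd c \<longrightarrow> Im z > 0 \<longrightarrow>
        h (int_moebius a b c d z) = chi d * theta_factor c d z ^ (2 * K + 1) * h z) \<and>
     (\<forall>a b c d. a * d - b * c = 1 \<longrightarrow>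
        ((\<lambda>z. h (int_moebius a b c d z) / csqrt (of_int c * z + of_int d) ^ (2 * K + 1)) \<longlongrightarrow> 0)
          (filtercomap Im at_top))"

definition normalized_hecke_eigenform ::
  "nat \<Rightarrow> nat \<Rightarrow> (int \<Rightarrow> complex) \<Rightarrow> (complex \<Rightarrow> complex) \<Rightarrow> (nat \<Rightarrow> complex) \<Rightarrow> bool" where
  "normalized_hecke_eigenform k N chi f a \<longleftrightarrow>
     modular_form k N chi f \<and> has_q_expansion f a \<and> a 1 = 1 \<and>
     (\<forall>m\<ge>1. \<forall>n\<ge>1. a m * a n =
        (\<Sum>d | d dvd gcd m n. chi (int d) * of_nat d ^ (k - 1) * a (m * n div d\<^sup>2)))"

definition rankin_cohen ::
  "real \<Rightarrow> real \<Rightarrow> nat \<Rightarrow> (complex \<Rightarrow> complex) \<Rightarrow> (complex \<Rightarrow> complex) \<Rightarrow> complex \<Rightarrow> complex" where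
  "rankin_cohen k\<^sub>1 k\<^sub>2 w F G z =
     inverse ((2 * of_real pi * \<i>) ^ w) *
     (\<Sum>j\<le>w. (- 1) ^ j * of_real ((k\<^sub>1 + real w - 1) gchoose (w - j)) *
        of_real ((k\<^sub>2 + real w - 1) gchoose j) *
        (deriv ^^ j) F z * (deriv ^^ (w - j)) G z)"

definition op_IB ::
  "complex \<Rightarrow> complex \<Rightarrow> nat \<Rightarrow> (complex \<Rightarrow> complex) \<Rightarrow> complex \<Rightarrow> complex" where
  "op_IB a b l F z = a * F z + b * F (of_nat l * z)"

text \<open>
  The operator \<open>\<Prod>\<^bsub>p | m\<^esub> (I - \<chi>(p) p\<^sup>e B(p))\<close>; the factors commute, so fixing an order is harmless.
\<close>

definition euler_op ::
  "(int \<Rightarrow> complex) \<Rightarrow> nat \<Rightarrow> nat \<Rightarrow> (complex \<Rightarrow> complex) \<Rightarrow> complex \<Rightarrow> complex" where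
  "euler_op chi e m =
     fold (\<lambda>p. op_IB 1 (- (chi (int p) * of_nat p ^ e)) p) (sorted_list_of_set (prime_factors m))"

text \<open>
  Comparing coefficients in
  \<open>\<Sum> A\<^sub>t(n) n\<^sup>-\<^sup>s = L(s - K + 1, \<psi>) \<Sum> b(tn\<^sup>2) n\<^sup>-\<^sup>s\<close> with \<open>\<psi> = \<chi> \<chi>\<^sub>-\<^sub>4\<^sup>K \<chi>\<^sub>t\<close> as a character
  modulo \<open>M\<close>, that is, the Dirichlet convolution of \<open>\<psi>(d) d\<^sup>K\<^sup>-\<^sup>1\<close> and \<open>b(tn\<^sup>2)\<close>.
\<close>

definition shimura_coeff ::
  "nat \<Rightarrow> nat \<Rightarrow> (int \<Rightarrow> complex) \<Rightarrow> nat \<Rightarrow> (nat \<Rightarrow> complex) \<Rightarrow> nat \<Rightarrow> complex" where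
  "shimura_coeff K M chi t b n =
     (if n = 0 then 0 else
      (\<Sum>d | d dvd n.
         trivial_character M (int d) * chi (int d) * chi_minus4 (int d) ^ K *
         quadratic_character (int t) (int d) *
         of_nat d ^ (K - 1) * b (t * (n div d)\<^sup>2)))"

definition shimura_lift ::
  "nat \<Rightarrow> nat \<Rightarrow> (int \<Rightarrow> complex) \<Rightarrow> nat \<Rightarrow> (complex \<Rightarrow> complex) \<Rightarrow> complex \<Rightarrow> complex" where
  "shimura_lift K M chi t h = q_series (shimura_coeff K M chi t (q_coeffs h))"

definition theta_bracket ::
  "nat \<Rightarrow> (complex \<Rightarrow> complex) \<Rightarrow> nat \<Rightarrow> nat \<Rightarrow> nat \<Rightarrow> complex \<Rightarrow> complex" where
  "theta_bracket k f w r t =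
     rankin_cohen (real k) (1 / 2) w (\<lambda>z. f (of_nat (4 * r) * z)) (\<lambda>z. theta (of_nat t * z))"

definition divisor_bracket ::
  "nat \<Rightarrow> (complex \<Rightarrow> complex) \<Rightarrow> nat \<Rightarrow> nat \<Rightarrow> nat \<Rightarrow> complex \<Rightarrow> complex" where
  "divisor_bracket k f w r d =
     rankin_cohen (real k) (real k) w (\<lambda>z. f (of_nat r * z / of_nat d))
       (\<lambda>z. twist (trivial_character (r div d)) f (of_nat d * z))"

text \<open>
  On the level \<open>M\<^sub>d\<close> of the Euler operator: for \<open>M\<^sub>d = 2 rad(M) / rad(r/d)\<close> the prime \<open>2\<close> always
  divides \<open>M\<^sub>d\<close>, and the formula for the lift is then wrong if \<open>r\<close> is even and \<open>\<chi>(2) \<noteq> 0\<close>. For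
  \<open>f = \<Delta>\<close>, \<open>r = 2\<close>, \<open>t = 1\<close>, \<open>w = 0\<close>, \<open>M = 8\<close> the coefficient of \<open>q\<^sup>6\<close> is \<open>-2944\<close> in the lift
  but \<open>-4992\<close> in the formula. With \<open>M\<^sub>d = rad(M) / rad(r/d)\<close>, which has the same odd prime
  divisors, it holds for every \<open>r\<close>; the two agree if \<open>r\<close> is odd or \<open>N\<close> is even.
\<close>

end

theory Submission
  imports Defs "HOL-Probability.Probability" "HOL-Real_Asymp.Real_Asymp"
begin

text \<open>
  Comparing coefficients, the lift formula comes from three facts. The representations
  \<open>n\<^sup>2 = 4uv + (v - u)\<^sup>2\<close> with \<open>u + v = n\<close> turn the coefficient of the theta bracket at \<open>tn\<^sup>2\<close> into a
  sum of \<open>a(uv/r)\<close> over \<open>u + v = n\<close>, \<open>r | uv\<close>; the polynomial of the bracket \<open>[f, \<theta>]\<^sub>w\<close> at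
  \<open>(4uv, (u - v)\<^sup>2)\<close> is a multiple of the polynomial of \<open>[f, f]\<^sub>2\<^sub>w\<close> at \<open>(u, v)\<close>; and the Hecke relations
  write \<open>a(x) a(y)\<close> as a convolution with \<open>\<chi>(g) g\<^sup>k\<^sup>-\<^sup>1\<close>. Sorting the pairs by \<open>d = gcd(v, r)\<close> gives the
  summands, and the Euler operators remove from the convolution the \<open>g\<close> not coprime to \<open>M\<close>.

  That the theta bracket is a cusp form follows from the covariance of the Rankin--Cohen bracket
  under the slash action and the transformation law of \<open>\<theta>\<close>. The latter is reduced, by descent on
  \<open>|c| + |d|\<close>, to the generators \<open>z + 1\<close> and \<open>z / (4z + 1)\<close>, that is, to Poisson summation. For \<open>w > 0\<close>
  the bracket vanishes at the cusps because derivatives of functions bounded near \<open>\<i>\<infinity>\<close> tend to \<open>0\<close>.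
\<close>

text \<open>Two points shape the bookkeeping. First, the sum over \<open>u + v = n\<close> includes
  the ends \<open>u = 0\<close> and \<open>v = 0\<close>, so the Hecke relations are needed for an
  index 0 as well; the definition of an eigenform does not contain them, and they have to be derived
  from modularity. Both indices vanish only in the constant coefficients of the divisor brackets,
  where either the polynomial (\<open>w > 0\<close>) or \<open>a 0\<close> (\<open>w = 0\<close>, by
  cuspidality) is zero. Second, the twist by the trivial character modulo \<open>r / d\<close>
  already excludes the \<open>g\<close> that share a factor with \<open>r / d\<close>, and the Euler
  operators have to exclude the remaining primes of \<open>M\<close>. An operator at a prime that is
  excluded already changes the form in general, but not if \<open>\<chi>\<close> vanishes there;
  hence the doubled level needs \<open>N\<close> even or \<open>r\<close> odd. In the constant, the
  quotient of binomial coefficients compares the two bracket polynomials, \<open>a(t)\<close> comes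
  from multiplicativity at divisors of \<open>N\<close>, and \<open>t ^ w\<close> from
  homogeneity.\<close>

abbreviation uhp :: "complex set" where
  "uhp \<equiv> {z. Im z > 0}"

lemma open_uhp: "open uhp"
  by (rule open_halfspace_Im_gt)

lemma connected_uhp: "connected uhp"
  by (intro convex_connected convex_halfspace_Im_gt)

subsection \<open>Expansions in powers of \<open>q\<close>\<close>

lemma norm_qexp: "norm (qexp z) = exp (- (2 * pi * Im z))"
  by (simp add: qexp_def)

lemma norm_qexp_less_1: "Im z > 0 \<Longrightarrow> norm (qexp z) < 1"
  by (simp add: norm_qexp)

lemma qexp_nonzero [simp]: "qexp z \<noteq> 0"
  by (simp add: qexp_def)

lemma qexp_0 [simp]: "qexp 0 = 1"
  by (simp add: qexp_def)

lemma qexp_add: "qexp (x + y) = qexp x * qexp y"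
  by (simp add: qexp_def distrib_left exp_add)

lemma qexp_power: "qexp z ^ n = qexp (of_nat n * z)"
  by (simp add: qexp_def exp_of_nat_mult [symmetric] algebra_simps)

lemma qexp_of_int [simp]: "qexp (of_int m) = 1"
  by (simp add: qexp_def exp_eq_1 mult.commute)

lemma qexp_holomorphic [holomorphic_intros]:
  "f holomorphic_on A \<Longrightarrow> (\<lambda>z. qexp (f z)) holomorphic_on A"
  unfolding qexp_def by (intro holomorphic_intros)

lemma has_field_derivative_qexp:
  "(qexp has_field_derivative 2 * of_real pi * \<i> * qexp z) (at z)"
  unfolding qexp_def by (auto intro!: derivative_eq_intros)

lemma qexp_surj:
  assumes "x \<noteq> 0" "norm x < 1"
  obtains z where "Im z > 0" "qexp z = x"
proof
  let ?z = "Ln x / (2 * of_real pi * \<i>)"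
  show "qexp ?z = x" using assms by (simp add: qexp_def)
  have "?z = - \<i> * Ln x / of_real (2 * pi)" by (simp add: field_simps)
  hence "Im ?z = - Re (Ln x) / (2 * pi)"
    by (simp only: Im_divide_of_real) simp
  moreover have "- Re (Ln x) / (2 * pi) > 0" using assms by (simp add: field_simps)
  ultimately show "Im ?z > 0" by (simp only:)
qed

lemma has_q_expansion_sums:
  "has_q_expansion F c \<Longrightarrow> Im z > 0 \<Longrightarrow> (\<lambda>n. c n * qexp z ^ n) sums F z"
  by (simp add: has_q_expansion_def)

text \<open>Convergence is given at the values of \<open>qexp\<close>, the nonzero points of the
  unit disc. A point of modulus halfway between \<open>norm x\<close> and 1 is such a value, and
  convergence there implies absolute convergence at \<open>x\<close>.\<close>

lemma has_q_expansion_summable: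
  assumes "has_q_expansion F c" "norm x < 1"
  shows "summable (\<lambda>n. norm (c n * x ^ n))"
proof -
  define y where "y = complex_of_real ((1 + norm x) / 2)"
  have y: "norm y = (1 + norm x) / 2" unfolding y_def by (simp only: norm_of_real) auto
  have "norm y > 0" by (simp add: y add_pos_nonneg)
  moreover have "norm y < 1" using y assms(2) by simp
  ultimately have "y \<noteq> 0" "norm y < 1" by auto
  then obtain z where z: "Im z > 0" "qexp z = y" using qexp_surj by blast
  have "summable (\<lambda>n. c n * y ^ n)"
    using has_q_expansion_sums[OF assms(1) z(1)] z(2) by (simp add: sums_iff)
  moreover have "norm x < norm y" using y assms(2) by simp
  ultimately show ?thesis by (rule powser_insidea)
qed

text \<open>Since \<open>qexp\<close> omits 0, the difference of the power series is known to vanish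
  on the punctured disc only. Continuity gives the constant coefficient, isolation of zeros the
  others. This makes the definite description in \<open>q_coeffs\<close> usable.\<close>

lemma has_q_expansion_unique:
  assumes "has_q_expansion F c" "has_q_expansion F e"
  shows "c = e"
proof (rule ext, rule ccontr)
  fix m assume "c m \<noteq> e m"
  define g where "g n = c n - e n" for n
  define P where "P x = (\<Sum>n. g n * x ^ n)" for x
  have sm: "(\<lambda>n. g n * x ^ n) sums P x" if "norm x < 1" for x
  proof -
    have "summable (\<lambda>n. c n * x ^ n - e n * x ^ n)"
      by (intro summable_diff summable_norm_cancel[OF has_q_expansion_summable[OF assms(1) that]]
            summable_norm_cancel[OF has_q_expansion_summable[OF assms(2) that]])
    thus ?thesis by (simp add: P_def g_def algebra_simps summable_sums_iff)
  qed
  have P0: "P x = 0" if x: "x \<noteq> 0" "norm x < 1" for x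
  proof -
    obtain z where z: "Im z > 0" "qexp z = x" using qexp_surj x by blast
    have "(\<lambda>n. c n * x ^ n - e n * x ^ n) sums (F z - F z)"
      using has_q_expansion_sums[OF assms(1) z(1)] has_q_expansion_sums[OF assms(2) z(1)] z(2)
      by (intro sums_diff) auto
    thus ?thesis by (simp add: P_def g_def algebra_simps sums_iff)
  qed
  have g0: "g 0 = 0"
  proof -
    have "isCont P 0"
      unfolding P_def
      by (rule isCont_powser[where K = "1 / 2"]) (use sm[of "1/2"] in \<open>auto simp: sums_iff\<close>)
    hence "(P \<longlongrightarrow> P 0) (at 0)" by (simp add: isCont_def)
    moreover have "eventually (\<lambda>x. P x = 0) (at 0)"
      unfolding eventually_at by (rule exI[of _ 1]) (auto simp: P0)
    hence "(P \<longlongrightarrow> 0) (at 0)" by (rule tendsto_eventually)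
    ultimately have "P 0 = 0" using tendsto_unique trivial_limit_at by blast
    thus ?thesis by (simp add: P_def)
  qed
  have m: "m > 0" "g m \<noteq> 0" using \<open>c m \<noteq> e m\<close> g0 by (auto simp: g_def intro!: Nat.gr0I)
  obtain s where s: "s > 0" "\<And>z. z \<in> cball 0 s - {0} \<Longrightarrow> P z \<noteq> 0"
    using powser_0_nonzero[of 1 0 g P m] sm m g0 by (auto simp: P_def)
  define x where "x = complex_of_real (min s (1 / 2))"
  have nx: "norm x = min s (1/2)" unfolding x_def by (simp only: norm_of_real) (use s(1) in auto)
  have "x \<in> cball 0 s - {0}" using s(1) nx by (auto simp: x_def min_def)
  moreover have "P x = 0" using P0[of x] nx s(1) by (auto simp: x_def min_def)
  ultimately show False using s(2) by blast
qed

lemma q_coeffs_eq: "has_q_expansion F c \<Longrightarrow> q_coeffs F = c"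
  unfolding q_coeffs_def using has_q_expansion_unique by blast

lemma q_series_eq: "has_q_expansion F c \<Longrightarrow> Im z > 0 \<Longrightarrow> q_series c z = F z"
  using has_q_expansion_sums unfolding q_series_def by (simp add: sums_iff)

lemma has_q_expansion_q_series:
  assumes "has_q_expansion F c" "\<And>n. norm (e n) \<le> norm (c n)"
  shows "has_q_expansion (q_series e) e"
proof -
  have "summable (\<lambda>n. e n * qexp z ^ n)" if "Im z > 0" for z
  proof (rule summable_comparison_test'[of "\<lambda>n. norm (c n * qexp z ^ n)" 0])
    show "summable (\<lambda>n. norm (c n * qexp z ^ n))"
      using has_q_expansion_summable[OF assms(1)] that norm_qexp_less_1 by blast
    show "norm (e n * qexp z ^ n) \<le> norm (c n * qexp z ^ n)" for n
      using assms(2)[of n] by (simp add: norm_mult mult_right_mono)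
  qed
  thus ?thesis by (simp add: has_q_expansion_def q_series_def summable_sums)
qed

lemma has_q_expansion_cong:
  assumes "has_q_expansion F c" "\<And>z. Im z > 0 \<Longrightarrow> F z = G z" "\<And>n. c n = e n"
  shows "has_q_expansion G e"
  using assms unfolding has_q_expansion_def by simp

lemma has_q_expansion_add:
  "has_q_expansion F c \<Longrightarrow> has_q_expansion G e \<Longrightarrow>
   has_q_expansion (\<lambda>z. F z + G z) (\<lambda>n. c n + e n)"
  by (auto simp: has_q_expansion_def distrib_right intro!: sums_add)

lemma has_q_expansion_cmult:
  "has_q_expansion F c \<Longrightarrow> has_q_expansion (\<lambda>z. x * F z) (\<lambda>n. x * c n)"
  by (auto simp: has_q_expansion_def mult.assoc intro!: sums_mult)

lemma has_q_expansion_sum: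
  assumes "\<And>i. i \<in> A \<Longrightarrow> has_q_expansion (F i) (c i)"
  shows "has_q_expansion (\<lambda>z. \<Sum>i\<in>A. F i z) (\<lambda>n. \<Sum>i\<in>A. c i n)"
  using assms by (auto simp: has_q_expansion_def sum_distrib_right intro!: sums_sum)

lemma has_q_expansion_mult:
  assumes "has_q_expansion F c" "has_q_expansion G e"
  shows "has_q_expansion (\<lambda>z. F z * G z) (\<lambda>n. \<Sum>i\<le>n. c i * e (n - i))"
  unfolding has_q_expansion_def
proof (intro allI impI)
  fix z :: complex assume z: "Im z > 0"
  have "(\<lambda>n. \<Sum>i\<le>n. (c i * qexp z ^ i) * (e (n - i) * qexp z ^ (n - i))) sums
        ((\<Sum>n. c n * qexp z ^ n) * (\<Sum>n. e n * qexp z ^ n))"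
    by (intro Cauchy_product_sums has_q_expansion_summable[OF assms(1)]
          has_q_expansion_summable[OF assms(2)] norm_qexp_less_1 z)
  also have "(\<Sum>n. c n * qexp z ^ n) * (\<Sum>n. e n * qexp z ^ n) = F z * G z"
    using has_q_expansion_sums[OF assms(1) z] has_q_expansion_sums[OF assms(2) z]
    by (simp add: sums_iff)
  also have "(\<lambda>n. \<Sum>i\<le>n. (c i * qexp z ^ i) * (e (n - i) * qexp z ^ (n - i))) =
             (\<lambda>n. (\<Sum>i\<le>n. c i * e (n - i)) * qexp z ^ n)"
    unfolding sum_distrib_right
  proof (intro ext sum.cong refl)
    fix n i :: nat assume "i \<in> {..n}"
    hence "qexp z ^ n = qexp z ^ i * qexp z ^ (n - i)" by (simp flip: power_add)
    thus "(c i * qexp z ^ i) * (e (n - i) * qexp z ^ (n - i)) = c i * e (n - i) * qexp z ^ n"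
      by simp
  qed
  finally show "(\<lambda>n. (\<Sum>i\<le>n. c i * e (n - i)) * qexp z ^ n) sums (F z * G z)" .
qed

lemma has_q_expansion_dilate:
  assumes "has_q_expansion F c" "l > 0"
  shows "has_q_expansion (\<lambda>z. F (of_nat l * z)) (\<lambda>n. if l dvd n then c (n div l) else 0)"
  unfolding has_q_expansion_def
proof (intro allI impI)
  fix z :: complex assume z: "Im z > 0"
  have "(\<lambda>n. c n * qexp (of_nat l * z) ^ n) sums F (of_nat l * z)"
    using has_q_expansion_sums[OF assms(1)] z assms(2) by simp
  also have "(\<lambda>n. c n * qexp (of_nat l * z) ^ n) =
    (\<lambda>n. (if l dvd n * l then c ((n * l) div l) else 0) * qexp z ^ (n * l))"
    using assms(2) by (simp add: qexp_power mult_ac fun_eq_iff)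
  finally have *: "(\<lambda>n. (if l dvd n * l then c ((n * l) div l) else 0) * qexp z ^ (n * l)) sums
      F (of_nat l * z)" .
  have "n \<in> range (\<lambda>n. n * l)" if "l dvd n" for n
    using that by (metis dvd_div_mult_self rangeI)
  thus "(\<lambda>n. (if l dvd n then c (n div l) else 0) * qexp z ^ n) sums F (of_nat l * z)"
    using * assms(2)
    by (subst (asm) sums_mono_reindex
          [of "\<lambda>n. n * l" "\<lambda>n. (if l dvd n then c (n div l) else 0) * qexp z ^ n"])
       (auto simp: strict_mono_def)
qed

lemma has_q_expansion_has_field_derivative:
  assumes "has_q_expansion F c" "Im z > 0"
  shows "(F has_field_derivative (\<Sum>n. 2 * of_real pi * \<i> * of_nat n * c n * qexp z ^ n)) (at z)"
    and "summable (\<lambda>n. 2 * of_real pi * \<i> * of_nat n * c n * qexp z ^ n)"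
proof -
  define P where "P x = (\<Sum>n. c n * x ^ n)" for x
  define K where "K = complex_of_real ((1 + norm (qexp z)) / 2)"
  have q: "norm (qexp z) < 1" by (rule norm_qexp_less_1[OF assms(2)])
  have nK: "norm K = (1 + norm (qexp z)) / 2" unfolding K_def by (simp only: norm_of_real) auto
  have K: "norm (qexp z) < norm K" "norm K < 1" using q nK by auto
  have sK: "summable (\<lambda>n. c n * K ^ n)"
    using has_q_expansion_summable[OF assms(1) K(2)] by (rule summable_norm_cancel)
  have D: "(P has_field_derivative (\<Sum>n. diffs c n * qexp z ^ n)) (at (qexp z))"
    unfolding P_def using sK K(1) by (rule termdiffs_strong)
  have "summable (\<lambda>n. diffs c n * qexp z ^ n)"
  proof (rule termdiff_converges[of _ 1])
    show "summable (\<lambda>n. c n * x ^ n)" if "norm x < 1" for x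
      using has_q_expansion_summable[OF assms(1) that] by (rule summable_norm_cancel)
  qed (rule q)
  hence "(\<lambda>n. diffs c n * qexp z ^ n * (2 * of_real pi * \<i> * qexp z)) sums
          ((\<Sum>n. diffs c n * qexp z ^ n) * (2 * of_real pi * \<i> * qexp z))"
    by (intro sums_mult2 summable_sums)
  hence "(\<lambda>n. 2 * of_real pi * \<i> * of_nat (Suc n) * c (Suc n) * qexp z ^ Suc n) sums
          ((\<Sum>n. diffs c n * qexp z ^ n) * (2 * of_real pi * \<i> * qexp z))"
    by (simp add: diffs_def mult_ac del: of_nat_Suc)
  hence S: "(\<lambda>n. 2 * of_real pi * \<i> * of_nat n * c n * qexp z ^ n) sums
          ((\<Sum>n. diffs c n * qexp z ^ n) * (2 * of_real pi * \<i> * qexp z))"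
    by (subst (asm) sums_Suc_iff) (simp del: of_nat_Suc)
  thus "summable (\<lambda>n. 2 * of_real pi * \<i> * of_nat n * c n * qexp z ^ n)"
    by (simp add: sums_iff)
  have "((\<lambda>z. P (qexp z)) has_field_derivative
          ((\<Sum>n. diffs c n * qexp z ^ n) * (2 * of_real pi * \<i> * qexp z))) (at z)"
    by (rule DERIV_chain2[OF D has_field_derivative_qexp])
  hence "(F has_field_derivative
          ((\<Sum>n. diffs c n * qexp z ^ n) * (2 * of_real pi * \<i> * qexp z))) (at z)"
  proof (rule has_field_derivative_transform_within_open[OF _ open_uhp])
    show "P (qexp x) = F x" if "x \<in> uhp" for x
      using has_q_expansion_sums[OF assms(1)] that by (simp add: P_def sums_iff)
  qed (use assms in auto)
  thus "(F has_field_derivative (\<Sum>n. 2 * of_real pi * \<i> * of_nat n * c n * qexp z ^ n)) (at z)"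
    using S by (simp add: sums_iff)
qed

lemma has_q_expansion_holomorphic:
  "has_q_expansion F c \<Longrightarrow> F holomorphic_on uhp"
  unfolding holomorphic_on_def field_differentiable_def
  by (blast intro: has_field_derivative_at_within has_q_expansion_has_field_derivative(1))

lemma has_q_expansion_deriv:
  assumes "has_q_expansion F c"
  shows "has_q_expansion (deriv F) (\<lambda>n. 2 * of_real pi * \<i> * of_nat n * c n)"
  unfolding has_q_expansion_def
proof (intro allI impI)
  fix z :: complex assume z: "Im z > 0"
  note D = has_q_expansion_has_field_derivative[OF assms z]
  show "(\<lambda>n. 2 * of_real pi * \<i> * of_nat n * c n * qexp z ^ n) sums deriv F z"
    using summable_sums[OF D(2)] by (simp only: DERIV_imp_deriv[OF D(1)])
qed

lemma has_q_expansion_higher_deriv: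
  assumes "has_q_expansion F c"
  shows "has_q_expansion ((deriv ^^ j) F) (\<lambda>n. (2 * of_real pi * \<i> * of_nat n) ^ j * c n)"
proof (induction j)
  case (Suc j)
  from has_q_expansion_deriv[OF this] show ?case by (simp add: mult_ac)
qed (use assms in simp)

text \<open>The symbol of the bracket: it sends the pair \<open>q ^ x\<close>, \<open>q ^ y\<close>
  to \<open>rc_poly k\<^sub>1 k\<^sub>2 w x y * q ^ (x + y)\<close>, because the \<open>w\<close>
  differentiations contribute exactly the power of \<open>2 * pi * \<i>\<close> that the
  normalisation removes.\<close>

definition rc_poly :: "real \<Rightarrow> real \<Rightarrow> nat \<Rightarrow> complex \<Rightarrow> complex \<Rightarrow> complex" where
  "rc_poly k\<^sub>1 k\<^sub>2 w x y = (\<Sum>j\<le>w. (- 1) ^ j * of_real ((k\<^sub>1 + real w - 1) gchoose (w - j)) *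
        of_real ((k\<^sub>2 + real w - 1) gchoose j) * x ^ j * y ^ (w - j))"

lemma has_q_expansion_rankin_cohen:
  assumes "has_q_expansion F c" "has_q_expansion G e"
  shows "has_q_expansion (rankin_cohen k\<^sub>1 k\<^sub>2 w F G)
           (\<lambda>n. \<Sum>i\<le>n. c i * e (n - i) * rc_poly k\<^sub>1 k\<^sub>2 w (of_nat i) (of_nat (n - i)))"
proof -
  define C :: "nat \<Rightarrow> complex" where "C j = (- 1) ^ j *
    of_real ((k\<^sub>1 + real w - 1) gchoose (w - j)) * of_real ((k\<^sub>2 + real w - 1) gchoose j)" for j
  have "has_q_expansion (\<lambda>z. inverse ((2 * of_real pi * \<i>) ^ w) *
      (\<Sum>j\<le>w. C j * ((deriv ^^ j) F z * (deriv ^^ (w - j)) G z)))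
     (\<lambda>n. inverse ((2 * of_real pi * \<i>) ^ w) * (\<Sum>j\<le>w. C j *
       (\<Sum>i\<le>n. (2 * of_real pi * \<i> * of_nat i) ^ j * c i *
         ((2 * of_real pi * \<i> * of_nat (n - i)) ^ (w - j) * e (n - i)))))"
    by (intro has_q_expansion_cmult has_q_expansion_sum has_q_expansion_mult
          has_q_expansion_higher_deriv assms)
  thus ?thesis
  proof (rule has_q_expansion_cong)
    fix z :: complex
    show "inverse ((2 * of_real pi * \<i>) ^ w) *
      (\<Sum>j\<le>w. C j * ((deriv ^^ j) F z * (deriv ^^ (w - j)) G z)) = rankin_cohen k\<^sub>1 k\<^sub>2 w F G z"
      by (simp add: rankin_cohen_def C_def mult.assoc)
  next
    fix n
    have "inverse ((2 * of_real pi * \<i>) ^ w) * (C j *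
       (\<Sum>i\<le>n. (2 * of_real pi * \<i> * of_nat i) ^ j * c i *
         ((2 * of_real pi * \<i> * of_nat (n - i)) ^ (w - j) * e (n - i)))) =
       (\<Sum>i\<le>n. c i * e (n - i) * (C j * of_nat i ^ j * of_nat (n - i) ^ (w - j)))"
      if j: "j \<le> w" for j
    proof -
      have p: "(2 * of_real pi * \<i> :: complex) ^ w =
          (2 * of_real pi * \<i>) ^ j * (2 * of_real pi * \<i>) ^ (w - j)"
        using j by (simp flip: power_add)
      define u :: complex where "u = 2 * of_real pi * \<i>"
      have "inverse (u ^ j * u ^ (w - j)) * (C j * ((u * x) ^ j * c1 * ((u * y) ^ (w - j) * e1))) =
          c1 * e1 * (C j * x ^ j * y ^ (w - j))" for c1 e1 x y
        by (simp add: power_mult_distrib field_simps u_def)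
      thus ?thesis unfolding sum_distrib_left p[folded u_def] u_def[symmetric]
        by (intro sum.cong refl) auto
    qed
    hence "inverse ((2 * of_real pi * \<i>) ^ w) * (\<Sum>j\<le>w. C j *
       (\<Sum>i\<le>n. (2 * of_real pi * \<i> * of_nat i) ^ j * c i *
         ((2 * of_real pi * \<i> * of_nat (n - i)) ^ (w - j) * e (n - i)))) =
       (\<Sum>j\<le>w. \<Sum>i\<le>n. c i * e (n - i) * (C j * of_nat i ^ j * of_nat (n - i) ^ (w - j)))"
      by (subst sum_distrib_left) (intro sum.cong refl, simp)
    also have "\<dots> = (\<Sum>i\<le>n. c i * e (n - i) * rc_poly k\<^sub>1 k\<^sub>2 w (of_nat i) (of_nat (n - i)))"
      unfolding rc_poly_def sum_distrib_left C_def by (rule sum.swap)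
    finally show "inverse ((2 * of_real pi * \<i>) ^ w) * (\<Sum>j\<le>w. C j *
       (\<Sum>i\<le>n. (2 * of_real pi * \<i> * of_nat i) ^ j * c i *
         ((2 * of_real pi * \<i> * of_nat (n - i)) ^ (w - j) * e (n - i)))) =
      (\<Sum>i\<le>n. c i * e (n - i) * rc_poly k\<^sub>1 k\<^sub>2 w (of_nat i) (of_nat (n - i)))" .
  qed
qed
subsection \<open>The Kronecker symbol\<close>

text \<open>A product over the multiset of prime factors, in contrast to the exponents in
  \<open>kronecker\<close>: multiplicativity in \<open>n\<close> then comes for free, and the sign
  convention stays outside.\<close>

definition jacobi :: "int \<Rightarrow> nat \<Rightarrow> int" where
  "jacobi a n = prod_mset (image_mset (kronecker_prime a) (prime_factorization n))"

lemma kronecker_eq_jacobi: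
  assumes "n \<noteq> 0"
  shows "kronecker a n = (if a < 0 \<and> n < 0 then - 1 else 1) * jacobi a (nat \<bar>n\<bar>)"
proof -
  have "jacobi a (nat \<bar>n\<bar>) =
    (\<Prod>p\<in>prime_factors (nat \<bar>n\<bar>). kronecker_prime a p ^ multiplicity p (nat \<bar>n\<bar>))"
    unfolding jacobi_def image_prod_mset_multiplicity
    by (intro prod.cong refl) (auto simp: count_prime_factorization in_prime_factors_iff)
  thus ?thesis using assms by (simp add: kronecker_def)
qed

lemma jacobi_1_right [simp]: "jacobi a (Suc 0) = 1"
  by (simp add: jacobi_def)

lemma jacobi_mult_right:
  "m > 0 \<Longrightarrow> n > 0 \<Longrightarrow> jacobi a (m * n) = jacobi a m * jacobi a n"
  by (simp add: jacobi_def prime_factorization_mult)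

lemma jacobi_prime:
  "prime p \<Longrightarrow> odd p \<Longrightarrow> jacobi a p = Legendre a (int p)"
  by (auto simp: jacobi_def prime_factorization_prime kronecker_prime_def)

lemma odd_induct [consumes 1, case_names one mult]:
  fixes n :: nat
  assumes "odd n" "P (Suc 0)"
    "\<And>p n. prime p \<Longrightarrow> odd p \<Longrightarrow> odd n \<Longrightarrow> P n \<Longrightarrow> P (p * n)"
  shows "P n"
  using assms(1)
proof (induction n rule: prime_divisors_induct)
  case (unit x)
  thus ?case using assms(2) by simp
next
  case (factor p x)
  thus ?case using assms(3)[of p x] by auto
qed simp

lemma Legendre_cong: "[a = b] (mod p) \<Longrightarrow> Legendre a p = Legendre b p"
  unfolding Legendre_def QuadRes_def by (auto simp: cong_def)

text \<open>Euler's criterion gives the identity modulo \<open>p\<close>. Both sides lie in {0, 1,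
  -1}, so their difference is at most 2 in absolute value and a multiple of
  \<open>p > 2\<close>.\<close>

lemma Legendre_mult:
  assumes "prime (p :: nat)" "p > 2"
  shows "Legendre (a * b) (int p) = Legendre a (int p) * Legendre b (int p)"
proof -
  let ?e = "(p - 1) div 2"
  have e: "[Legendre x (int p) = x ^ ?e] (mod int p)" for x
    using euler_criterion[of p x] assms by simp
  have "[Legendre a (int p) * Legendre b (int p) = a ^ ?e * b ^ ?e] (mod int p)"
    by (intro cong_mult e)
  also have "a ^ ?e * b ^ ?e = (a * b) ^ ?e" by (simp add: power_mult_distrib)
  also have "[(a * b) ^ ?e = Legendre (a * b) (int p)] (mod int p)" by (rule cong_sym[OF e])
  finally have *: "[Legendre (a * b) (int p) = Legendre a (int p) * Legendre b (int p)] (mod int p)"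
    by (rule cong_sym)
  have L: "Legendre x (int p) \<in> {0, 1, - 1}" for x by (auto simp: Legendre_def)
  have "\<bar>Legendre (a * b) (int p) - Legendre a (int p) * Legendre b (int p)\<bar> \<le> 2"
    using L[of "a * b"] L[of a] L[of b] by auto
  moreover have "int p dvd Legendre (a * b) (int p) - Legendre a (int p) * Legendre b (int p)"
    using * by (simp add: cong_iff_dvd_diff)
  ultimately show ?thesis using assms(2)
    dvd_imp_le_int[of "Legendre (a * b) (int p) - Legendre a (int p) * Legendre b (int p)" "int p"]
    by linarith
qed

lemma odd_prime_gt_2: "prime (p :: nat) \<Longrightarrow> odd p \<Longrightarrow> p > 2"
  using prime_ge_2_nat[of p] by (cases "p = 2") auto

lemma jacobi_mult_left: "odd n \<Longrightarrow> jacobi (a * b) n = jacobi a n * jacobi b n"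
proof (induction n rule: odd_induct)
  case (mult p n)
  thus ?case using Legendre_mult[of p a b] odd_prime_gt_2[of p]
    by (simp add: jacobi_mult_right jacobi_prime odd_pos prime_gt_0_nat)
qed simp

lemma jacobi_cong: "odd n \<Longrightarrow> [a = b] (mod int n) \<Longrightarrow> jacobi a n = jacobi b n"
proof (induction n rule: odd_induct)
  case (mult p n)
  have "[a = b] (mod int p)" "[a = b] (mod int n)"
    using mult.prems by (auto simp: cong_iff_dvd_diff dest: dvd_mult_left dvd_mult_right)
  thus ?case using mult Legendre_cong[of a b p]
    by (simp add: jacobi_mult_right jacobi_prime odd_pos prime_gt_0_nat)
qed simp

lemma jacobi_1_left: "odd n \<Longrightarrow> jacobi 1 n = 1"
proof (induction n rule: odd_induct)
  case (mult p n)
  have "Legendre 1 (int p) = 1"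
    using prime_gt_1_nat[OF mult(1)] by (auto simp: Legendre_def QuadRes_def cong_def intro!: exI[of _ 1])
  thus ?case using mult jacobi_mult_left[of n 1 1]
    by (simp add: jacobi_mult_right jacobi_prime odd_pos prime_gt_0_nat)
qed simp

lemma jacobi_square:
  assumes "odd n" "coprime a (int n)"
  shows "(jacobi a n)\<^sup>2 = 1"
  using assms
proof (induction n rule: odd_induct)
  case (mult p n)
  have "\<not> int p dvd a"
    using mult.prems prime_gt_1_nat[OF mult(1)] coprime_common_divisor[of a "int p * int n" "int p"]
    by auto
  hence "(Legendre a (int p))\<^sup>2 = 1" by (auto simp: Legendre_def cong_0_iff)
  thus ?case using mult
    by (simp add: jacobi_mult_right jacobi_prime odd_pos prime_gt_0_nat power_mult_distrib)
qed simp

text \<open>On odd integers this is the nontrivial character modulo 4; the value -1 at even integers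
  is a default.\<close>

definition chi4 :: "int \<Rightarrow> int" where
  "chi4 d = (if d mod 4 = 1 then 1 else - 1)"

lemma chi4_mult: "odd a \<Longrightarrow> odd b \<Longrightarrow> chi4 (a * b) = chi4 a * chi4 b"
proof -
  assume "odd a" "odd b"
  hence "a mod 4 = 1 \<or> a mod 4 = 3" "b mod 4 = 1 \<or> b mod 4 = 3" by presburger+
  hence "a mod 4 = 1 \<and> b mod 4 = 1 \<and> (a * b) mod 4 = 1 \<or> a mod 4 = 1 \<and> b mod 4 = 3 \<and> (a * b) mod 4 = 3 \<or>
    a mod 4 = 3 \<and> b mod 4 = 1 \<and> (a * b) mod 4 = 3 \<or> a mod 4 = 3 \<and> b mod 4 = 3 \<and> (a * b) mod 4 = 1"
    using mod_mult_eq[of a 4 b] by (elim disjE) simp_all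
  thus ?thesis unfolding chi4_def by (elim disjE conjE) simp_all
qed

lemma chi4_minus: "odd a \<Longrightarrow> chi4 (- a) = - chi4 a"
  unfolding chi4_def zmod_zminus1_eq_if by presburger

lemma neg_one_power_half:
  assumes "odd n"
  shows "(- 1 :: int) ^ ((n - 1) div 2) = chi4 (int n)"
proof -
  have "even ((n - 1) div 2) \<longleftrightarrow> int n mod 4 = 1" using assms by presburger
  thus ?thesis by (simp add: chi4_def)
qed

lemma Legendre_minus_1:
  assumes "prime p" "odd p"
  shows "Legendre (- 1) (int p) = chi4 (int p)"
proof -
  have "[Legendre (- 1) (int p) = (- 1) ^ ((p - 1) div 2)] (mod int p)"
    using euler_criterion[of p "- 1"] assms odd_prime_gt_2 by simp
  hence "int p dvd Legendre (- 1) (int p) - chi4 (int p)"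
    using neg_one_power_half[OF assms(2)] by (simp add: cong_iff_dvd_diff)
  moreover have "\<bar>Legendre (- 1) (int p) - chi4 (int p)\<bar> \<le> 2"
    by (auto simp: Legendre_def chi4_def)
  ultimately show ?thesis using odd_prime_gt_2[OF assms]
    dvd_imp_le_int[of "Legendre (- 1) (int p) - chi4 (int p)" "int p"] by linarith
qed

lemma jacobi_minus_1: "odd n \<Longrightarrow> jacobi (- 1) n = chi4 (int n)"
proof (induction n rule: odd_induct)
  case (mult p n)
  thus ?case using Legendre_minus_1[of p] chi4_mult[of p n]
    by (simp add: jacobi_mult_right jacobi_prime odd_pos prime_gt_0_nat)
qed (simp add: chi4_def)

text \<open>For odd positive arguments the sign of quadratic reciprocity. Stated by residues instead
  of exponents, it makes sense for negative arguments too.\<close>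

definition rec_sign :: "int \<Rightarrow> int \<Rightarrow> int" where
  "rec_sign m n = (if m mod 4 = 3 \<and> n mod 4 = 3 then - 1 else 1)"

lemma rec_sign_mult_left:
  assumes "odd a" "odd b" shows "rec_sign (a * b) n = rec_sign a n * rec_sign b n"
proof -
  have "a mod 4 = 1 \<or> a mod 4 = 3" "b mod 4 = 1 \<or> b mod 4 = 3" using assms by presburger+
  hence "a mod 4 = 1 \<and> b mod 4 = 1 \<and> (a * b) mod 4 = 1 \<or> a mod 4 = 1 \<and> b mod 4 = 3 \<and> (a * b) mod 4 = 3 \<or>
    a mod 4 = 3 \<and> b mod 4 = 1 \<and> (a * b) mod 4 = 3 \<or> a mod 4 = 3 \<and> b mod 4 = 3 \<and> (a * b) mod 4 = 1"
    using mod_mult_eq[of a 4 b] by (elim disjE) simp_all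
  thus ?thesis unfolding rec_sign_def by (elim disjE conjE) (cases "n mod 4 = 3"; simp)+
qed

lemma rec_sign_commute: "rec_sign m n = rec_sign n m"
  by (auto simp: rec_sign_def)

lemma Legendre_reciprocity:
  assumes "prime p" "odd p" "prime q" "odd q" "p \<noteq> q"
  shows "Legendre (int p) (int q) * Legendre (int q) (int p) = rec_sign (int p) (int q)"
proof -
  have "Legendre (int p) (int q) * Legendre (int q) (int p) =
      (- 1) ^ ((p - 1) div 2 * ((q - 1) div 2))"
    using Quadratic_Reciprocity[of p q] assms odd_prime_gt_2 by simp
  also have "\<dots> = rec_sign (int p) (int q)"
  proof -
    have "even ((p - 1) div 2) \<longleftrightarrow> int p mod 4 \<noteq> 3" "even ((q - 1) div 2) \<longleftrightarrow> int q mod 4 \<noteq> 3"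
      using assms(2,4) by presburger+
    thus ?thesis by (simp add: rec_sign_def)
  qed
  finally show ?thesis .
qed

lemma jacobi_reciprocity_prime:
  assumes "odd n" "prime p" "odd p" "coprime p n"
  shows "jacobi (int p) n * Legendre (int n) (int p) = rec_sign (int p) (int n)"
  using assms(1,4)
proof (induction n rule: odd_induct)
  case one
  have "jacobi 1 p = 1" using jacobi_1_left assms by blast
  thus ?case using jacobi_prime[OF assms(2,3), of 1] by (simp add: rec_sign_def)
next
  case (mult q n)
  have "p \<noteq> q" using mult.prems assms(2) by (auto simp: prime_nat_iff)
  hence "Legendre (int p) (int q) * Legendre (int q) (int p) = rec_sign (int p) (int q)"
    using Legendre_reciprocity assms mult by blast
  moreover have "jacobi (int p) n * Legendre (int n) (int p) = rec_sign (int p) (int n)"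
    using mult by auto
  moreover have "rec_sign (int p) (int (q * n)) = rec_sign (int p) (int q) * rec_sign (int p) (int n)"
    using rec_sign_mult_left[of "int q" "int n" "int p"] mult rec_sign_commute by simp
  moreover have "jacobi (int p) (q * n) = Legendre (int p) (int q) * jacobi (int p) n"
    using mult by (simp add: jacobi_mult_right jacobi_prime odd_pos prime_gt_0_nat)
  moreover have "Legendre (int (q * n)) (int p) = Legendre (int q) (int p) * Legendre (int n) (int p)"
    using Legendre_mult[of p q n] odd_prime_gt_2 assms by simp
  ultimately show ?case by (metis mult.assoc mult.left_commute)
qed

lemma jacobi_reciprocity:
  assumes "odd m" "odd n" "coprime m n"
  shows "jacobi (int m) n * jacobi (int n) m = rec_sign (int m) (int n)"
  using assms(1,3)
proof (induction m rule: odd_induct)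
  case one
  thus ?case using jacobi_1_left[OF assms(2)] by (simp add: rec_sign_def)
next
  case (mult p m)
  have "jacobi (int p) n * Legendre (int n) (int p) = rec_sign (int p) (int n)"
    using mult.hyps mult.prems assms(2) coprime_mult_left_iff[of p m n]
    by (intro jacobi_reciprocity_prime) blast+
  moreover have "jacobi (int m) n * jacobi (int n) m = rec_sign (int m) (int n)"
    using mult.IH mult.prems by (simp only: coprime_mult_left_iff)
  moreover have "jacobi (int (p * m)) n = jacobi (int p) n * jacobi (int m) n"
    using jacobi_mult_left[OF assms(2)] by simp
  moreover have "jacobi (int n) (p * m) = Legendre (int n) (int p) * jacobi (int n) m"
    using mult.hyps by (simp add: jacobi_mult_right jacobi_prime odd_pos prime_gt_0_nat)
  moreover have "rec_sign (int (p * m)) (int n) = rec_sign (int p) (int n) * rec_sign (int m) (int n)"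
    using rec_sign_mult_left[of "int p" "int m" "int n"] mult.hyps by simp
  ultimately show ?case by (metis mult.assoc mult.left_commute)
qed

text \<open>Reciprocity between \<open>n\<close> and \<open>n + 2\<close> replaces the usual computation of \<open>(2/n)\<close>.\<close>

lemma jacobi_2_step:
  assumes "odd n" "m = n + 2"
  shows "jacobi 2 m = chi4 (int m) * jacobi 2 n"
proof -
  have o: "odd m" using assms by simp
  have c: "coprime n m"
    using assms by (metis coprime_iff_gcd_eq_1 gcd_add2 coprime_right_2_iff_odd)
  have "jacobi 2 m * jacobi (- 1) m = jacobi (2 * - 1) m"
    by (rule jacobi_mult_left[OF o, symmetric])
  also have "\<dots> = jacobi (int n) m"
  proof (rule jacobi_cong[OF o])
    have "2 * - 1 - int n = int m * - 1" using assms(2) by simp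
    thus "[2 * - 1 = int n] (mod int m)" unfolding cong_iff_dvd_diff by (metis dvd_triv_left)
  qed
  also have "jacobi (int n) m * jacobi (int m) n = 1"
  proof -
    have "rec_sign (int n) (int m) = 1" unfolding rec_sign_def assms(2) by presburger
    thus ?thesis using jacobi_reciprocity[OF assms(1) o c] by simp
  qed
  hence "jacobi (int n) m = jacobi (int m) n"
    using zmult_eq_1_iff by metis
  also have "jacobi (int m) n = jacobi 2 n"
  proof (rule jacobi_cong[OF assms(1)])
    have "int m - 2 = int n * 1" using assms(2) by simp
    thus "[int m = 2] (mod int n)" unfolding cong_iff_dvd_diff by (metis dvd_triv_left)
  qed
  finally have "jacobi 2 m * chi4 (int m) = jacobi 2 n"
    using jacobi_minus_1[OF o] by simp
  moreover have "chi4 (int m) = 1 \<or> chi4 (int m) = - 1" by (simp add: chi4_def)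
  ultimately show ?thesis by auto
qed

lemma jacobi_2: "odd n \<Longrightarrow> jacobi 2 n = (if n mod 8 \<in> {1, 7} then 1 else - 1)"
proof (induction n rule: nat_less_induct)
  case (1 n)
  show ?case
  proof (cases "n = 1")
    case False
    then obtain m where m: "n = m + 2" "odd m"
      using 1(2) that[of "n - 2"] by (cases n; cases "n - 1") auto
    have "jacobi 2 m = (if m mod 8 \<in> {1, 7} then 1 else - 1)" using 1 m by auto
    moreover have "m mod 8 = 1 \<or> m mod 8 = 3 \<or> m mod 8 = 5 \<or> m mod 8 = 7" using m(2) by presburger
    moreover have "chi4 (int (m + 2)) = (if m mod 4 = 3 then 1 else - 1)"
      unfolding chi4_def by presburger
    moreover have "(m + 2) mod 8 = (x + 2) mod 8 \<and> m mod 4 = x mod 4" if "m mod 8 = x" for x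
      using that mod_add_left_eq[of m 8 2] mod_mod_cancel[of 4 8 m] by auto
    from this[of 1] this[of 3] this[of 5] this[of 7]
    have "m mod 8 = 1 \<Longrightarrow> (m + 2) mod 8 = 3 \<and> m mod 4 = 1" "m mod 8 = 3 \<Longrightarrow> (m + 2) mod 8 = 5 \<and> m mod 4 = 3"
      "m mod 8 = 5 \<Longrightarrow> (m + 2) mod 8 = 7 \<and> m mod 4 = 1" "m mod 8 = 7 \<Longrightarrow> (m + 2) mod 8 = 1 \<and> m mod 4 = 3"
      by simp_all
    ultimately show ?thesis using jacobi_2_step[OF m(2) refl] unfolding m(1)
      by (elim disjE) simp_all
  qed simp
qed

section \<open>Reciprocity for signed arguments and periodicity of the Kronecker symbol\<close>

lemma kronecker_eq_chi4:
  assumes "odd d"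
  shows "kronecker (- 1) d = chi4 d"
proof -
  have o: "odd (nat \<bar>d\<bar>)" using assms by (simp add: even_nat_iff)
  have "d \<noteq> 0" using assms by auto
  thus ?thesis
    using jacobi_minus_1[OF o] chi4_minus[OF assms] kronecker_eq_jacobi[of d "- 1"] by simp
qed

text \<open>Reciprocity with \<open>d\<close> of either sign. For negative \<open>d\<close> the
  extra factor \<open>jacobi (- 1) u = chi4 u\<close> is absorbed by \<open>rec_sign\<close>, since
  \<open>d\<close> and \<open>- d\<close> have the two different odd residues modulo 4.\<close>

lemma jacobi_flip:
  assumes "odd u" "odd d" "coprime d (int u)"
  shows "jacobi (int u) (nat \<bar>d\<bar>) = jacobi d u * rec_sign (int u) d"
proof -
  define n where "n = nat \<bar>d\<bar>"
  have o: "odd n" using assms(2) by (simp add: n_def even_nat_iff)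
  have c: "coprime u n" using assms(3)
    by (metis n_def coprime_abs_left_iff coprime_commute coprime_int_iff nat_0_le abs_ge_zero)
  have R: "jacobi (int u) n * jacobi (int n) u = rec_sign (int u) (int n)"
    by (rule jacobi_reciprocity[OF assms(1) o c])
  have sq: "(jacobi (int n) u)\<^sup>2 = 1"
    using jacobi_square[OF assms(1)] c by (simp add: coprime_commute)
  have eq: "jacobi (int u) n = jacobi (int n) u * rec_sign (int u) (int n)"
    using R sq by (metis mult.assoc mult.commute mult.right_neutral power2_eq_square)
  show ?thesis
  proof (cases "d > 0")
    case True
    thus ?thesis using eq unfolding n_def by simp
  next
    case False
    hence n: "int n = - d" by (simp add: n_def)
    have "jacobi (int n) u = chi4 (int u) * jacobi d u"
      using jacobi_mult_left[OF assms(1), of "- 1" d] jacobi_minus_1[OF assms(1)] n by simp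
    moreover have "chi4 (int u) * rec_sign (int u) (- d) = rec_sign (int u) d"
    proof -
      have "int u mod 4 = 1 \<or> int u mod 4 = 3" using assms(1) by presburger
      moreover have "d mod 4 = 1 \<and> (- d) mod 4 = 3 \<or> d mod 4 = 3 \<and> (- d) mod 4 = 1"
        using assms(2) by presburger
      ultimately show ?thesis by (auto simp: chi4_def rec_sign_def)
    qed
    ultimately show ?thesis using eq n unfolding n_def[symmetric] by (simp add: algebra_simps)
  qed
qed

lemma kronecker_mult_left:
  assumes "odd d" "a > 0"
  shows "kronecker (a * b) d = jacobi a (nat \<bar>d\<bar>) * kronecker b d"
proof -
  have "d \<noteq> 0" "odd (nat \<bar>d\<bar>)" using assms by (auto simp: even_nat_iff)
  moreover have "a * b < 0 \<longleftrightarrow> b < 0" using assms(2) by (simp add: mult_less_0_iff)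
  ultimately show ?thesis by (simp add: kronecker_eq_jacobi jacobi_mult_left)
qed

lemma kronecker_1_left: "odd d \<Longrightarrow> kronecker 1 d = 1"
  by (subst kronecker_eq_jacobi) (auto simp: jacobi_1_left even_nat_iff)

lemma nat_abs_mod_8: "nat \<bar>x\<bar> mod 8 \<in> {1, 7} \<longleftrightarrow> x mod 8 \<in> {1, 7}"
proof -
  have n: "int n mod 8 = int (n mod 8)" for n by (simp add: zmod_int)
  show ?thesis
  proof (cases "x \<ge> 0")
    case True
    then obtain n where "x = int n" using nonneg_int_cases by blast
    thus ?thesis using n[of n] by simp
  next
    case False
    then obtain n where "x = - int n" using nonpos_int_cases by (metis linorder_le_cases)
    thus ?thesis using n[of n] by (auto simp: zmod_zminus1_eq_if)
  qed
qed

text \<open>Write \<open>c = 2 ^ s * u * e\<close> with \<open>u\<close> odd and \<open>e\<close>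
  the sign. The factor at \<open>u\<close> is flipped by reciprocity into a symbol of period
  \<open>u\<close>, with a sign depending on \<open>d\<close> modulo 4; the factor at
  \<open>e\<close> also depends on \<open>d\<close> modulo 4. The factor at 2 depends on
  \<open>d\<close> modulo 8, which is controlled for \<open>s \<ge> 3\<close>; the only other case
  is \<open>s = 2\<close>, where a square appears.\<close>

lemma kronecker_periodic:
  assumes "4 dvd c" "c \<noteq> 0" "coprime c d" "[d = d'] (mod c)"
  shows "kronecker c d = kronecker c d'"
proof -
  have "nat \<bar>c\<bar> \<noteq> 0" "\<not> is_unit (2 :: nat)" using assms(2) by auto
  then obtain s u where su: "nat \<bar>c\<bar> = 2 ^ s * u" "odd u"
    using multiplicity_decompose'[of "nat \<bar>c\<bar>" 2] by metis
  have cabs: "\<bar>c\<bar> = 2 ^ s * int u"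
    using su(1) by (metis abs_ge_zero int_nat_eq of_nat_mult of_nat_numeral of_nat_power)
  have u0: "u > 0" using su(2) by (rule odd_pos)
  define e :: int where "e = sgn c"
  have c: "c = 2 ^ s * (int u * e)" using cabs unfolding e_def by (metis abs_mult_sgn mult.assoc)
  have e: "e = 1 \<or> e = - 1" using assms(2) by (auto simp: e_def sgn_if)
  have cop: "coprime c d'" using assms(3,4) by (metis cong_imp_coprime coprime_commute cong_sym)
  have d4: "4 dvd d - d'" using assms(1,4) by (meson cong_iff_dvd_diff dvd_trans)
  have odd1: "odd x" if "coprime c x" for x
    using coprime_common_divisor[OF that, of 2] dvd_trans[OF _ assms(1), of 2] by auto
  have o: "odd d" "odd d'" using odd1 assms(3) cop by auto
  have cu: "coprime x (int u)" if "coprime c x" for x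
    using that unfolding c by (simp add: coprime_commute)
  have ud: "[d = d'] (mod int u)"
    using assms(4) unfolding c by (metis cong_modulus_mult mult.left_commute)
  have "jacobi 2 (nat \<bar>d\<bar>) ^ s = jacobi 2 (nat \<bar>d'\<bar>) ^ s"
  proof (cases "s \<ge> 3")
    case True
    hence "(2 :: int) ^ 3 dvd c" unfolding c by (meson dvd_mult2 le_imp_power_dvd)
    hence "8 dvd d - d'" using assms(4) by (simp add: cong_iff_dvd_diff) (meson dvd_trans)
    hence "d mod 8 = d' mod 8" by (simp only: mod_eq_dvd_iff)
    hence "nat \<bar>d\<bar> mod 8 \<in> {1, 7} \<longleftrightarrow> nat \<bar>d'\<bar> mod 8 \<in> {1, 7}"
      by (simp only: nat_abs_mod_8)
    thus ?thesis using o by (simp add: jacobi_2 even_nat_iff)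
  next
    case False
    have "s = 2"
    proof (rule ccontr)
      assume "s \<noteq> 2"
      hence "s = 0 \<or> s = 1" using False by auto
      moreover have "4 dvd 2 ^ s * u" using assms(1) su(1)
        by (metis dvd_abs_iff nat_dvd_iff nat_numeral abs_ge_zero int_dvd_int_iff int_nat_eq of_nat_numeral)
      ultimately show False using su(2) by auto
    qed
    moreover have "(jacobi 2 (nat \<bar>x\<bar>))\<^sup>2 = 1" if "odd x" for x
      using that by (intro jacobi_square) (auto simp: even_nat_iff)
    ultimately show ?thesis using o by simp
  qed
  moreover have "jacobi (int u) (nat \<bar>d\<bar>) = jacobi (int u) (nat \<bar>d'\<bar>)"
  proof -
    have "d mod 4 = d' mod 4" using d4 by (simp only: mod_eq_dvd_iff)
    hence "rec_sign (int u) d = rec_sign (int u) d'" by (simp add: rec_sign_def)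
    thus ?thesis using jacobi_flip su(2) o cu assms(3) cop jacobi_cong[OF su(2) ud] by metis
  qed
  moreover have "kronecker e d = kronecker e d'"
  proof -
    have "d mod 4 = d' mod 4" using d4 by (simp only: mod_eq_dvd_iff)
    hence "chi4 d = chi4 d'" by (simp add: chi4_def)
    thus ?thesis using e kronecker_1_left kronecker_eq_chi4 o by metis
  qed
  moreover have kc: "kronecker c x = jacobi 2 (nat \<bar>x\<bar>) ^ s * (jacobi (int u) (nat \<bar>x\<bar>) * kronecker e x)"
    if "odd x" for x
  proof -
    have "jacobi (2 ^ s) (nat \<bar>x\<bar>) = jacobi 2 (nat \<bar>x\<bar>) ^ s" for s
      using that by (induction s) (simp_all add: jacobi_1_left jacobi_mult_left even_nat_iff)
    thus ?thesis unfolding c using that u0 by (simp add: kronecker_mult_left)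
  qed
  ultimately show ?thesis by (simp only: kc[OF o(1)] kc[OF o(2)])
qed
subsection \<open>Poisson summation for Gaussians\<close>

definition gaussian :: "real \<Rightarrow> complex \<Rightarrow> complex" where
  "gaussian t z = exp (- (of_real pi * z\<^sup>2 / of_real t))"

lemma norm_gaussian: "norm (gaussian t z) = exp (- (pi * ((Re z)\<^sup>2 - (Im z)\<^sup>2) / t))"
  by (simp add: gaussian_def Re_power2)

lemma gaussian_holomorphic [holomorphic_intros]:
  "f holomorphic_on A \<Longrightarrow> t \<noteq> 0 \<Longrightarrow> (\<lambda>z. gaussian t (f z)) holomorphic_on A"
  unfolding gaussian_def by (intro holomorphic_intros) auto

text \<open>An entire primitive turns each contour integral of the Gaussian into a difference of
  values at end points, so that moving the contour means comparing end points.\<close>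

lemma ex_gaussian_primitive:
  assumes "t > 0"
  obtains \<Psi> where "\<And>z. (\<Psi> has_field_derivative gaussian t z) (at z)"
proof -
  have "gaussian t holomorphic_on UNIV"
    using gaussian_holomorphic[of "\<lambda>z. z" UNIV t] assms by auto
  then obtain \<Psi> where "\<And>z. z \<in> UNIV \<Longrightarrow> (\<Psi> has_field_derivative gaussian t z) (at z within UNIV)"
    using holomorphic_convex_primitive'[of UNIV "gaussian t"] by auto
  thus ?thesis using that by auto
qed

lemma gaussian_primitive_limit_real:
  assumes t: "t > 0" and \<Psi>: "\<And>z. (\<Psi> has_field_derivative gaussian t z) (at z)"
  shows "(\<lambda>N. \<Psi> (of_real (real N + 1/2)) - \<Psi> (of_real (- (real N + 1/2)))) \<longlonglongrightarrow> of_real (sqrt t)"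
proof -
  \<comment> \<open>The standard deviation for which \<open>gaussian t\<close> on the real line is
    \<open>sqrt t\<close> times a normal density; this evaluates the Gaussian integral.\<close>
  define s where "s = sqrt (t / (2 * pi))"
  have s: "s > 0" "2 * pi * s\<^sup>2 = t" "2 * s\<^sup>2 = t / pi" using t by (auto simp: s_def field_simps)
  define f where "f x = sqrt t * normal_density 0 s x" for x
  have f: "f x = exp (- (pi * x\<^sup>2 / t))" for x
    using t by (simp add: f_def normal_density_def s)
  have fi: "integrable lborel f" unfolding f_def using s(1) by (intro integrable_mult_right) simp
  have I: "(\<integral>x. f x \<partial>lborel) = sqrt t" unfolding f_def using s(1) by simp
  have eq: "(\<integral>x. indicator {- (real N + 1/2)..real N + 1/2} x *\<^sub>R complex_of_real (f x) \<partial>lborel) =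
      \<Psi> (of_real (real N + 1/2)) - \<Psi> (of_real (- (real N + 1/2)))" for N
  proof (rule integral_FTC_atLeastAtMost)
    fix x :: real
    have "((\<lambda>x. \<Psi> (of_real x)) has_vector_derivative gaussian t (of_real x)) (at x)"
      by (intro has_vector_derivative_real_field \<Psi>)
    also have "gaussian t (of_real x) = of_real (f x)"
      unfolding gaussian_def f by (simp flip: exp_of_real)
    finally show "((\<lambda>x. \<Psi> (of_real x)) has_vector_derivative complex_of_real (f x))
       (at x within {- (real N + 1/2)..real N + 1/2})"
      by (rule has_vector_derivative_at_within)
  qed (auto simp: f intro!: continuous_intros simp: t[THEN less_imp_neq, symmetric])
  have "(\<lambda>N. \<integral>x. indicator {- (real N + 1/2)..real N + 1/2} x *\<^sub>R complex_of_real (f x) \<partial>lborel)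
      \<longlonglongrightarrow> (\<integral>x. complex_of_real (f x) \<partial>lborel)"
  proof (rule integral_dominated_convergence[where w = f])
    show "AE x in lborel. (\<lambda>N. indicator {- (real N + 1/2)..real N + 1/2} x *\<^sub>R complex_of_real (f x))
        \<longlonglongrightarrow> complex_of_real (f x)"
    proof (intro AE_I2 tendsto_eventually)
      fix x :: real
      obtain n :: nat where n: "\<bar>x\<bar> < real n" using reals_Archimedean2 by blast
      show "eventually (\<lambda>N. indicator {- (real N + 1/2)..real N + 1/2} x *\<^sub>R complex_of_real (f x) =
          complex_of_real (f x)) sequentially"
        using eventually_ge_at_top[of n]
      proof eventually_elim
        case (elim N)
        hence "x \<in> {- (real N + 1/2)..real N + 1/2}" using n by auto
        thus ?case by simp
      qed
    qed
    show "AE x in lborel. norm (indicator {- (real N + 1/2)..real N + 1/2} x *\<^sub>R complex_of_real (f x)) \<le> f x" for N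
      by (intro AE_I2) (auto simp: indicator_def f)
  qed (use fi in auto)
  also have "(\<integral>x. complex_of_real (f x) \<partial>lborel) = of_real (sqrt t)"
    using I by simp
  finally show ?thesis unfolding eq .
qed

text \<open>Shifting the line of integration to height \<open>a\<close> costs the integrals over the
  two vertical sides of a rectangle, and the Gaussian decays on them.\<close>

lemma gaussian_primitive_limit:
  assumes t: "t > 0" and \<Psi>: "\<And>z. (\<Psi> has_field_derivative gaussian t z) (at z)"
  shows "(\<lambda>N. \<Psi> (of_real (real N + 1/2) + \<i> * of_real a) - \<Psi> (of_real (- (real N + 1/2)) + \<i> * of_real a))
           \<longlonglongrightarrow> of_real (sqrt t)"
proof -
  have bound: "norm (\<Psi> (of_real R + \<i> * of_real a) - \<Psi> (of_real R)) \<le> exp (- (pi * (R\<^sup>2 - a\<^sup>2) / t)) * \<bar>a\<bar>" for R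
  proof -
    define S where "S = closed_segment (complex_of_real R) (of_real R + \<i> * of_real a)"
    have "norm (\<Psi> (of_real R + \<i> * of_real a) - \<Psi> (of_real R)) \<le>
        exp (- (pi * (R\<^sup>2 - a\<^sup>2) / t)) * norm (of_real R + \<i> * of_real a - complex_of_real R)"
    proof (rule field_differentiable_bound)
      show "convex S" by (simp add: S_def)
      show "(\<Psi> has_field_derivative gaussian t z) (at z within S)" for z
        using \<Psi> by (rule has_field_derivative_at_within)
      show "norm (gaussian t z) \<le> exp (- (pi * (R\<^sup>2 - a\<^sup>2) / t))" if zS: "z \<in> S" for z
      proof -
        obtain u where u: "0 \<le> u" "u \<le> 1"
            "z = (1 - u) *\<^sub>R complex_of_real R + u *\<^sub>R (of_real R + \<i> * of_real a)"
          using zS unfolding S_def closed_segment_def by auto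
        have re: "Re z = R" and im: "Im z = u * a"
          unfolding u(3) by (simp_all add: algebra_simps)
        have "(u * a)\<^sup>2 \<le> 1 * a\<^sup>2"
          unfolding power_mult_distrib using u by (intro mult_right_mono) (auto simp: power_le_one)
        hence "pi * (R\<^sup>2 - a\<^sup>2) / t \<le> pi * (R\<^sup>2 - (u * a)\<^sup>2) / t"
          using t by (intro divide_right_mono mult_left_mono) auto
        thus ?thesis unfolding norm_gaussian re im by simp
      qed
    qed (auto simp: S_def)
    thus ?thesis by (simp add: norm_mult)
  qed
  have lim0: "(\<lambda>N. exp (- (pi * ((real N + 1/2)\<^sup>2 - a\<^sup>2) / t)) * \<bar>a\<bar>) \<longlonglongrightarrow> 0"
  proof -
    have "filterlim (\<lambda>N. pi * ((real N + 1/2)\<^sup>2 - a\<^sup>2) / t) at_top sequentially"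
      using t by real_asymp
    thus ?thesis
      by (intro tendsto_mult_left_zero filterlim_compose[OF exp_at_bot] filterlim_uminus_at_bot_at_top)
         (auto simp: filterlim_uminus_at_top)
  qed
  have A: "(\<lambda>N. \<Psi> (of_real (real N + 1/2) + \<i> * of_real a) - \<Psi> (of_real (real N + 1/2))) \<longlonglongrightarrow> 0"
    by (rule Lim_null_comparison[OF _ lim0]) (use bound in \<open>auto intro!: always_eventually simp del: of_real_add\<close>)
  have B: "(\<lambda>N. \<Psi> (of_real (- (real N + 1/2)) + \<i> * of_real a) - \<Psi> (of_real (- (real N + 1/2)))) \<longlonglongrightarrow> 0"
    by (rule Lim_null_comparison[OF _ lim0], rule always_eventually, rule allI)
       (use bound[of "- (real _ + 1/2)"] in \<open>simp only: power2_minus\<close>)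
  have "(\<lambda>N. (\<Psi> (of_real (real N + 1/2) + \<i> * of_real a) - \<Psi> (of_real (real N + 1/2))) -
      (\<Psi> (of_real (- (real N + 1/2)) + \<i> * of_real a) - \<Psi> (of_real (- (real N + 1/2)))) +
      (\<Psi> (of_real (real N + 1/2)) - \<Psi> (of_real (- (real N + 1/2))))) \<longlonglongrightarrow> 0 - 0 + of_real (sqrt t)"
    by (intro tendsto_intros A B gaussian_primitive_limit_real[OF t \<Psi>])
  thus ?thesis by (simp add: algebra_simps)
qed

definition gauss_per_partial :: "real \<Rightarrow> nat \<Rightarrow> complex \<Rightarrow> complex" where
  "gauss_per_partial t N z =
     gaussian t z + (\<Sum>n<N. gaussian t (z + of_nat (Suc n)) + gaussian t (z - of_nat (Suc n)))"

definition gauss_per :: "real \<Rightarrow> complex \<Rightarrow> complex" where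
  "gauss_per t z =
     gaussian t z + (\<Sum>n. gaussian t (z + of_nat (Suc n)) + gaussian t (z - of_nat (Suc n)))"

lemma gauss_per_uniform_limit:
  assumes t: "t > 0"
  shows "uniform_limit {z. \<bar>Re z\<bar> < 1 \<and> \<bar>Im z\<bar> < 1} (gauss_per_partial t) (gauss_per t) sequentially"
proof -
  define q where "q = exp (- (pi / t))"
  have q: "0 < q" "q < 1" using t by (auto simp: q_def)
  define C where "C = exp (pi / t)"
  have "uniform_limit {z. \<bar>Re z\<bar> < 1 \<and> \<bar>Im z\<bar> < 1}
      (\<lambda>N z. \<Sum>n<N. gaussian t (z + of_nat (Suc n)) + gaussian t (z - of_nat (Suc n)))
      (\<lambda>z. \<Sum>n. gaussian t (z + of_nat (Suc n)) + gaussian t (z - of_nat (Suc n))) sequentially"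
  proof (rule Weierstrass_m_test)
    show "summable (\<lambda>n. 2 * (C * q ^ n))"
      using q by (intro summable_mult summable_geometric) auto
    fix n z assume z: "z \<in> {z. \<bar>Re z\<bar> < 1 \<and> \<bar>Im z\<bar> < 1}"
    \<comment> \<open>The imaginary part contributes at most the constant \<open>C\<close>, and
      \<open>n \<le> n\<^sup>2\<close> replaces the Gaussian decay by a geometric majorant.\<close>
    have b: "norm (gaussian t v) \<le> C * q ^ n" if v: "\<bar>Re v\<bar> \<ge> real n" "\<bar>Im v\<bar> < 1" for v
    proof -
      have "real n \<le> (real n)\<^sup>2" by (metis le_square of_nat_le_iff of_nat_power power2_eq_square)
      also have "\<dots> \<le> (Re v)\<^sup>2" using v(1) by (metis abs_le_square_iff abs_of_nat)
      finally have "real n \<le> (Re v)\<^sup>2" .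
      moreover have "(Im v)\<^sup>2 \<le> 1" using v(2) by (simp add: abs_square_le_1)
      ultimately have "pi * (real n - 1) / t \<le> pi * ((Re v)\<^sup>2 - (Im v)\<^sup>2) / t"
        using t by (intro divide_right_mono mult_left_mono) auto
      hence "norm (gaussian t v) \<le> exp (- (pi * (real n - 1) / t))" unfolding norm_gaussian by simp
      also have "\<dots> = C * q ^ n"
        by (simp add: C_def q_def exp_of_nat_mult[symmetric] diff_divide_distrib algebra_simps
              flip: exp_add)
      finally show ?thesis .
    qed
    have "norm (gaussian t (z + of_nat (Suc n))) \<le> C * q ^ n"
      "norm (gaussian t (z - of_nat (Suc n))) \<le> C * q ^ n"
      using z by (intro b; auto)+
    thus "norm (gaussian t (z + of_nat (Suc n)) + gaussian t (z - of_nat (Suc n))) \<le> 2 * (C * q ^ n)"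
      using norm_triangle_ineq[of "gaussian t (z + of_nat (Suc n))" "gaussian t (z - of_nat (Suc n))"]
      by linarith
  qed
  thus ?thesis unfolding gauss_per_def gauss_per_partial_def
    by (intro uniform_limit_add uniform_limit_const)
qed

lemma open_box_strip: "open {z. \<bar>Re z\<bar> < 1 \<and> \<bar>Im z\<bar> < 1}"
  by (intro open_Collect_conj open_Collect_less continuous_intros)

lemma gauss_per_partial_holomorphic: "t > 0 \<Longrightarrow> gauss_per_partial t N holomorphic_on A"
  unfolding gauss_per_partial_def by (intro holomorphic_intros) auto

lemma gauss_per_holomorphic:
  assumes "t > 0"
  shows "gauss_per t holomorphic_on {z. \<bar>Re z\<bar> < 1 \<and> \<bar>Im z\<bar> < 1}"
proof (rule holomorphic_uniform_sequence[OF open_box_strip])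
  show "gauss_per_partial t N holomorphic_on {z. \<bar>Re z\<bar> < 1 \<and> \<bar>Im z\<bar> < 1}" for N
    by (rule gauss_per_partial_holomorphic[OF assms])
  fix x :: complex assume "x \<in> {z. \<bar>Re z\<bar> < 1 \<and> \<bar>Im z\<bar> < 1}"
  then obtain d where d: "d > 0" "cball x d \<subseteq> {z. \<bar>Re z\<bar> < 1 \<and> \<bar>Im z\<bar> < 1}"
    using open_box_strip open_contains_cball by blast
  thus "\<exists>d>0. cball x d \<subseteq> {z. \<bar>Re z\<bar> < 1 \<and> \<bar>Im z\<bar> < 1} \<and>
      uniform_limit (cball x d) (gauss_per_partial t) (gauss_per t) sequentially"
    using uniform_limit_on_subset[OF gauss_per_uniform_limit[OF assms]] by blast
qed

section \<open>Fourier coefficients of the periodised Gaussian\<close>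

abbreviation unit_segment :: "real \<Rightarrow> complex" where
  "unit_segment \<equiv> linepath (- 1/2) (1/2)"

lemma unit_segment_subset: "path_image unit_segment \<subseteq> {z. \<bar>Re z\<bar> < 1 \<and> \<bar>Im z\<bar> < 1}"
proof
  fix z assume "z \<in> path_image unit_segment"
  then obtain u where u: "0 \<le> u" "u \<le> 1" "z = (1 - u) *\<^sub>R (- 1/2) + u *\<^sub>R (1/2)"
    by (auto simp: closed_segment_def)
  have "Re z = u - 1/2" "Im z = 0" unfolding u(3) by (simp_all add: field_simps)
  thus "z \<in> {z. \<bar>Re z\<bar> < 1 \<and> \<bar>Im z\<bar> < 1}" using u by auto
qed

text \<open>Completing the square: the factor \<open>qexp (- n z)\<close> shifts the Gaussian by
  \<open>\<i> * n * t\<close> up to the constant \<open>c\<close>, so \<open>\<Phi>\<close> is a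
  primitive of the product. As the factor has period 1, the translates of the unit segment join to
  the segment from \<open>- (N + 1/2)\<close> to \<open>N + 1/2\<close>, which explains the
  half-integral end points above.\<close>

lemma gauss_per_fourier:
  assumes t: "t > 0"
  shows "((\<lambda>z. gauss_per t z * qexp (- of_int n * z)) has_contour_integral
            of_real (sqrt t * exp (- (pi * (real_of_int n)\<^sup>2 * t)))) unit_segment"
proof -
  obtain \<Psi> where \<Psi>: "\<And>z. (\<Psi> has_field_derivative gaussian t z) (at z)"
    using ex_gaussian_primitive[OF t] by blast
  define a where "a = of_int n * t"
  define c where "c = complex_of_real (exp (- (pi * (real_of_int n)\<^sup>2 * t)))"
  define \<Phi> where "\<Phi> z = c * \<Psi> (z + \<i> * of_real a)" for z
  have key: "c * gaussian t (z + \<i> * of_real a) = gaussian t z * qexp (- of_int n * z)" for z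
  proof -
    have "- (of_real pi * (real_of_int n)\<^sup>2 * t) + - (of_real pi * (z + \<i> * of_real a)\<^sup>2 / of_real t) =
        - (of_real pi * z\<^sup>2 / of_real t) + 2 * of_real pi * \<i> * (- of_int n * z)"
      using t by (simp add: a_def power2_eq_square field_simps)
    thus ?thesis
      unfolding c_def gaussian_def qexp_def exp_of_real[symmetric] exp_add[symmetric] by simp
  qed
  have \<Phi>: "(\<Phi> has_field_derivative gaussian t z * qexp (- of_int n * z)) (at z)" for z
  proof -
    have "(\<Phi> has_field_derivative c * (gaussian t (z + \<i> * of_real a) * (1 + 0))) (at z)"
      unfolding \<Phi>_def
      by (intro DERIV_cmult DERIV_chain2[OF \<Psi>] derivative_intros)
    thus ?thesis using key by simp
  qed
  have one: "((\<lambda>z. gaussian t (z + of_int m) * qexp (- of_int n * z)) has_contour_integral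
      (\<Phi> (of_real (real_of_int m + 1/2)) - \<Phi> (of_real (real_of_int m - 1/2)))) unit_segment" for m
  proof -
    have "((\<lambda>z. \<Phi> (z + of_int m)) has_field_derivative
        gaussian t (z + of_int m) * qexp (- of_int n * z)) (at z within UNIV)" for z
    proof -
      have "((\<lambda>z. \<Phi> (z + of_int m)) has_field_derivative
          gaussian t (z + of_int m) * qexp (- of_int n * (z + of_int m)) * (1 + 0)) (at z)"
        by (intro DERIV_chain2[OF \<Phi>] derivative_intros)
      moreover have "qexp (- of_int n * (z + of_int m)) = qexp (- of_int n * z)"
      proof -
        have "- of_int n * (z + of_int m) = - of_int n * z + of_int (- n * m)"
          by (simp add: algebra_simps)
        thus ?thesis by (simp only: qexp_add qexp_of_int) simp
      qed
      ultimately show ?thesis by simp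
    qed
    from contour_integral_primitive[OF this, of unit_segment]
    show ?thesis by (simp add: add.commute)
  qed
  have partial: "((\<lambda>z. gauss_per_partial t N z * qexp (- of_int n * z)) has_contour_integral
      (\<Phi> (of_real (real N + 1/2)) - \<Phi> (of_real (- (real N + 1/2))))) unit_segment" for N
  proof (induction N)
    case 0
    show ?case using one[of 0] by (simp add: gauss_per_partial_def)
  next
    case (Suc N)
    have "((\<lambda>z. gauss_per_partial t N z * qexp (- of_int n * z) +
        (gaussian t (z + of_int (int (Suc N))) * qexp (- of_int n * z) +
         gaussian t (z + of_int (- int (Suc N))) * qexp (- of_int n * z))) has_contour_integral
      ((\<Phi> (of_real (real N + 1/2)) - \<Phi> (of_real (- (real N + 1/2)))) +
       ((\<Phi> (of_real (real_of_int (int (Suc N)) + 1/2)) - \<Phi> (of_real (real_of_int (int (Suc N)) - 1/2))) +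
        (\<Phi> (of_real (real_of_int (- int (Suc N)) + 1/2)) - \<Phi> (of_real (real_of_int (- int (Suc N)) - 1/2))))))
      unit_segment"
      by (intro has_contour_integral_add Suc.IH one)
    also have "(\<lambda>z. gauss_per_partial t N z * qexp (- of_int n * z) +
        (gaussian t (z + of_int (int (Suc N))) * qexp (- of_int n * z) +
         gaussian t (z + of_int (- int (Suc N))) * qexp (- of_int n * z))) =
        (\<lambda>z. gauss_per_partial t (Suc N) z * qexp (- of_int n * z))"
      by (simp add: gauss_per_partial_def algebra_simps)
    also have "real_of_int (int (Suc N)) - 1/2 = real N + 1/2" by simp
    also have "real_of_int (- int (Suc N)) + 1/2 = - (real N + 1/2)" by simp
    also have "real_of_int (- int (Suc N)) - 1/2 = - (real (Suc N) + 1/2)" by simp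
    finally show ?case by simp
  qed
  have ul: "uniform_limit (path_image unit_segment) (\<lambda>N z. gauss_per_partial t N z * qexp (- of_int n * z))
      (\<lambda>z. gauss_per t z * qexp (- of_int n * z)) sequentially"
  proof (rule uniform_lim_mult)
    show "uniform_limit (path_image unit_segment) (gauss_per_partial t) (gauss_per t) sequentially"
      by (rule uniform_limit_on_subset[OF gauss_per_uniform_limit[OF t] unit_segment_subset])
    show "bounded (gauss_per t ` path_image unit_segment)"
      by (intro compact_imp_bounded compact_continuous_image compact_path_image
            holomorphic_on_imp_continuous_on holomorphic_on_subset[OF gauss_per_holomorphic[OF t]]
            unit_segment_subset) auto
    show "bounded ((\<lambda>z. qexp (- of_int n * z)) ` path_image unit_segment)"
      by (intro compact_imp_bounded compact_continuous_image compact_path_image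
            holomorphic_on_imp_continuous_on holomorphic_intros) auto
  qed (rule uniform_limit_const)
  have lim: "gauss_per_int \<longlonglongrightarrow> contour_integral unit_segment (\<lambda>z. gauss_per t z * qexp (- of_int n * z))"
    and int: "(\<lambda>z. gauss_per t z * qexp (- of_int n * z)) contour_integrable_on unit_segment"
    if "gauss_per_int = (\<lambda>N. contour_integral unit_segment (\<lambda>z. gauss_per_partial t N z * qexp (- of_int n * z)))"
    for gauss_per_int
    unfolding that
    using contour_integral_uniform_limit[OF _ ul, of "norm (1/2 - (- 1/2 :: complex))"] partial
    by (auto simp: contour_integrable_on_def intro!: always_eventually)
  have "(\<lambda>N. \<Phi> (of_real (real N + 1/2)) - \<Phi> (of_real (- (real N + 1/2)))) \<longlonglongrightarrow>
      contour_integral unit_segment (\<lambda>z. gauss_per t z * qexp (- of_int n * z))"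
    using lim[OF refl] by (simp only: contour_integral_unique[OF partial])
  moreover have "(\<lambda>N. \<Phi> (of_real (real N + 1/2)) - \<Phi> (of_real (- (real N + 1/2)))) \<longlonglongrightarrow> c * of_real (sqrt t)"
    unfolding \<Phi>_def right_diff_distrib[symmetric]
    by (intro tendsto_mult_left gaussian_primitive_limit[OF t \<Psi>])
  ultimately have "contour_integral unit_segment (\<lambda>z. gauss_per t z * qexp (- of_int n * z)) = c * of_real (sqrt t)"
    using LIMSEQ_unique by blast
  thus ?thesis using has_contour_integral_integral[OF int[OF refl]] by (simp add: c_def mult.commute)
qed

lemma qexp_eq_1_iff: "qexp z = 1 \<longleftrightarrow> (\<exists>n. z = of_int n)"
proof -
  have "qexp z = 1 \<longleftrightarrow> Im z = 0 \<and> (\<exists>n::int. 2 * pi * Re z = of_int (2 * n) * pi)"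
    by (simp add: qexp_def exp_eq_1)
  also have "\<dots> \<longleftrightarrow> (\<exists>n. z = of_int n)"
    by (auto simp: complex_eq_iff)
  finally show ?thesis .
qed

lemma norm_qexp_unit_segment:
  "z \<in> closed_segment (- 1/2) (1/2) \<Longrightarrow> norm (qexp (of_int m * z)) = 1"
proof -
  assume "z \<in> closed_segment (- 1/2) (1/2)"
  then obtain u where "z = (1 - u) *\<^sub>R (- 1/2) + u *\<^sub>R (1/2)" by (auto simp: closed_segment_def)
  hence "Im z = 0" by simp
  thus ?thesis by (simp add: norm_qexp)
qed

lemma has_field_derivative_qexp_cmult:
  "((\<lambda>z. qexp (c * z)) has_field_derivative 2 * of_real pi * \<i> * c * qexp (c * z)) (at z)"
  by (rule DERIV_cong[OF DERIV_chain2[OF has_field_derivative_qexp DERIV_cmult_Id]]) simp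

text \<open>One integration by parts: \<open>C\<close> collects the two boundary values and the
  maximum of the derivative on a segment of length 1, divided by the \<open>2 * pi\<close> from the
  frequency.\<close>

lemma riemann_lebesgue_holomorphic:
  assumes "open S" "g holomorphic_on S" "path_image unit_segment \<subseteq> S"
  obtains C where "\<And>m i. m \<noteq> 0 \<Longrightarrow>
    ((\<lambda>z. g z * qexp (of_int m * z)) has_contour_integral i) unit_segment \<Longrightarrow> norm i \<le> C / \<bar>of_int m\<bar>"
proof -
  have seg: "closed_segment (- 1/2) (1/2) \<subseteq> S" using assms(3) by simp
  have dg: "deriv g holomorphic_on S" by (rule holomorphic_deriv[OF assms(2,1)])
  have "compact (deriv g ` closed_segment (- 1/2) (1/2))"
    by (intro compact_continuous_image holomorphic_on_imp_continuous_on holomorphic_on_subset[OF dg seg]) auto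
  then obtain B where B: "\<And>z. z \<in> closed_segment (- 1/2) (1/2) \<Longrightarrow> norm (deriv g z) \<le> B"
    using compact_imp_bounded bounded_iff by (metis imageI)
  have B0: "B \<ge> 0" using B[of "1/2"] norm_ge_zero order_trans by (metis ends_in_segment(2))
  define C where "C = (norm (g (1/2)) + norm (g (- 1/2)) + B) / (2 * pi)"
  show ?thesis
  proof (rule that[of C])
    fix m :: int and i assume m: "m \<noteq> 0"
      and i: "((\<lambda>z. g z * qexp (of_int m * z)) has_contour_integral i) unit_segment"
    define u where "u = 2 * of_real pi * \<i> * complex_of_int m"
    have u: "u \<noteq> 0" "norm u = 2 * pi * \<bar>of_int m\<bar>" using m by (auto simp: u_def norm_mult)
    have D: "((\<lambda>z. g z * qexp (of_int m * z)) has_field_derivative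
        g z * qexp (of_int m * z) * u + deriv g z * qexp (of_int m * z)) (at z within S)" if "z \<in> S" for z
    proof -
      have "(g has_field_derivative deriv g z) (at z)"
        using holomorphic_derivI[OF assms(2,1) that] .
      from DERIV_cong[OF DERIV_mult[OF this has_field_derivative_qexp_cmult[of "of_int m"]]]
      show ?thesis by (rule has_field_derivative_at_within) (simp add: u_def algebra_simps)
    qed
    have "((\<lambda>z. g z * qexp (of_int m * z) * u + deriv g z * qexp (of_int m * z)) has_contour_integral
        g (1/2) * qexp (of_int m * (1/2)) - g (- 1/2) * qexp (of_int m * (- 1/2))) unit_segment"
      using contour_integral_primitive[OF D _ assms(3)] by simp
    from has_contour_integral_diff[OF this has_contour_integral_rmul[OF i, of u]]
    have "((\<lambda>z. deriv g z * qexp (of_int m * z)) has_contour_integral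
        (g (1/2) * qexp (of_int m * (1/2)) - g (- 1/2) * qexp (of_int m * (- 1/2))) - i * u) unit_segment"
      by simp
    from has_contour_integral_bound_linepath[OF this B0]
    have "norm ((g (1/2) * qexp (of_int m * (1/2)) - g (- 1/2) * qexp (of_int m * (- 1/2))) - i * u) \<le> B * norm (1/2 - (- 1/2 :: complex))"
      using B norm_qexp_unit_segment by (simp add: norm_mult)
    hence 1: "norm ((g (1/2) * qexp (of_int m * (1/2)) - g (- 1/2) * qexp (of_int m * (- 1/2))) - i * u) \<le> B"
      by simp
    have tri: "norm c \<le> norm a + norm b + B" if "norm ((a - b) - c) \<le> B" for a b c :: complex
      using that norm_triangle_ineq4[of a b] norm_triangle_ineq3[of "a - b" c] by linarith
    have "norm (i * u) \<le> norm (g (1/2) * qexp (of_int m * (1/2))) + norm (g (- 1/2) * qexp (of_int m * (- 1/2))) + B"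
      using 1 tri by blast
    hence "norm i * norm u \<le> norm (g (1/2)) + norm (g (- 1/2)) + B"
      using norm_qexp_unit_segment[of "1/2" m] norm_qexp_unit_segment[of "- 1/2" m]
      by (simp add: norm_mult)
    thus "norm i \<le> C / \<bar>of_int m\<bar>"
      using m by (simp add: C_def u(2) field_simps)
  qed
qed

lemma atLeastAtMost_int_Suc:
  "{- int (Suc N)..int (Suc N)} = insert (int (Suc N)) (insert (- int (Suc N)) {- int N..int N})"
  by auto

lemma qexp_telescope:
  "(\<Sum>n\<in>{- int N..int N}. qexp (- of_int n * z)) * (qexp z - 1) =
     qexp (of_int (int (Suc N)) * z) - qexp (of_int (- int N) * z)"
proof (induction N)
  case (Suc N)
  have *: "qexp (- of_int n * z) * (qexp z - 1) = qexp (of_int (1 - n) * z) - qexp (of_int (- n) * z)" for n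
    by (simp add: algebra_simps flip: qexp_add)
  have "(\<Sum>n\<in>{- int (Suc N)..int (Suc N)}. qexp (- of_int n * z)) * (qexp z - 1) =
      qexp (- of_int (int (Suc N)) * z) * (qexp z - 1) + qexp (- of_int (- int (Suc N)) * z) * (qexp z - 1) +
      (\<Sum>n\<in>{- int N..int N}. qexp (- of_int n * z)) * (qexp z - 1)"
    unfolding atLeastAtMost_int_Suc by (simp add: algebra_simps)
  thus ?case unfolding Suc.IH * by (simp add: algebra_simps)
qed simp

lemma qexp_unit_segment_integral:
  "((\<lambda>z. qexp (- of_int n * z)) has_contour_integral (if n = 0 then 1 else 0)) unit_segment"
proof (cases "n = 0")
  case True
  thus ?thesis using has_contour_integral_linepath[of "\<lambda>z. 1" 1 "- 1/2" "1/2"]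
    contour_integral_primitive[of UNIV "\<lambda>z. z" "\<lambda>z. 1" unit_segment] by (auto intro: derivative_intros)
next
  case False
  define u where "u = 2 * of_real pi * \<i> * complex_of_int (- n)"
  have u: "u \<noteq> 0" using False by (simp add: u_def)
  have "((\<lambda>z. qexp (- of_int n * z) / u) has_field_derivative qexp (- of_int n * z)) (at z within UNIV)" for z
    using DERIV_cdivide[OF has_field_derivative_qexp_cmult[of "- of_int n" z], of u] u by (simp add: u_def)
  from contour_integral_primitive[OF this, of unit_segment]
  have "((\<lambda>z. qexp (- of_int n * z)) has_contour_integral
      qexp (- of_int n * (1/2)) / u - qexp (- of_int n * (- 1/2)) / u) unit_segment" by simp
  moreover have "qexp (- of_int n * (- 1/2)) = qexp (- of_int n * (1/2)) * qexp (of_int n)"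
    unfolding qexp_add[symmetric] by (rule arg_cong[of _ _ qexp]) simp
  ultimately show ?thesis using False by simp
qed

text \<open>
  Chernoff's argument: dividing \<open>p(z) - p(0)\<close> by \<open>q - 1\<close> makes the symmetric partial sums of the
  Fourier coefficients telescope.
\<close>

lemma poisson_gaussian:
  assumes t: "t > 0"
  shows "(\<lambda>N. \<Sum>n\<in>{- int N..int N}. complex_of_real (sqrt t * exp (- (pi * (real_of_int n)\<^sup>2 * t))))
           \<longlonglongrightarrow> gauss_per t 0"
proof -
  define S :: "complex set" where "S = {z. \<bar>Re z\<bar> < 1 \<and> \<bar>Im z\<bar> < 1}"
  have S: "open S" "0 \<in> interior S"
    using open_box_strip interior_open[OF open_box_strip] by (auto simp: S_def)
  define P where "P = gauss_per t"
  have P: "P holomorphic_on S" unfolding P_def S_def by (rule gauss_per_holomorphic[OF t])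
  \<comment> \<open>Divided differences at 0, with the removable singularity filled in.
    \<open>B\<close> has no zero in the box, as \<open>qexp z = 1\<close> only at integers and 0 is
    the only integer there; so the quotient \<open>g\<close> is holomorphic.\<close>
  define A where "A z = (if z = 0 then deriv P 0 else (P z - P 0) / (z - 0))" for z
  define B where "B z = (if z = 0 then deriv qexp 0 else (qexp z - qexp 0) / (z - 0))" for z
  have A: "A holomorphic_on S" unfolding A_def by (rule pole_lemma[OF P S(2)])
  have B: "B holomorphic_on S" unfolding B_def
    by (rule pole_lemma[OF _ S(2)]) (use qexp_holomorphic[of "\<lambda>z. z"] in auto)
  have B0: "B z \<noteq> 0" if z: "z \<in> S" for z
  proof (cases "z = 0")
    case True
    thus ?thesis using DERIV_imp_deriv[OF has_field_derivative_qexp[of 0]] by (simp add: B_def)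
  next
    case False
    have "qexp z \<noteq> 1"
    proof
      assume "qexp z = 1"
      then obtain n where n: "z = of_int n" using qexp_eq_1_iff by blast
      hence "\<bar>real_of_int n\<bar> < 1" using z by (simp add: S_def)
      thus False using False n by simp
    qed
    thus ?thesis using False by (simp add: B_def)
  qed
  define g where "g z = A z / B z" for z
  have g: "g holomorphic_on S" unfolding g_def by (intro holomorphic_intros A B B0)
  have Pg: "P z - P 0 = g z * (qexp z - 1)" if "z \<in> S" for z
  proof (cases "z = 0")
    case False
    thus ?thesis using B0[OF that] by (simp add: g_def A_def B_def)
  qed simp
  have pi_sub: "path_image unit_segment \<subseteq> S" using unit_segment_subset by (simp add: S_def)
  obtain C where C: "\<And>m i. m \<noteq> 0 \<Longrightarrow>
    ((\<lambda>z. g z * qexp (of_int m * z)) has_contour_integral i) unit_segment \<Longrightarrow> norm i \<le> C / \<bar>of_int m\<bar>"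
    using riemann_lebesgue_holomorphic[OF S(1) g pi_sub] by blast
  define s where "s N = (\<Sum>n\<in>{- int N..int N}. complex_of_real (sqrt t * exp (- (pi * (real_of_int n)\<^sup>2 * t))))" for N
  have 1: "((\<lambda>z. (P z - P 0) * (\<Sum>n\<in>{- int N..int N}. qexp (- of_int n * z))) has_contour_integral s N - P 0)
      unit_segment" for N
  proof -
    have "((\<lambda>z. \<Sum>n\<in>{- int N..int N}. P z * qexp (- of_int n * z) - P 0 * qexp (- of_int n * z))
        has_contour_integral (\<Sum>n\<in>{- int N..int N}.
          of_real (sqrt t * exp (- (pi * (real_of_int n)\<^sup>2 * t))) - P 0 * (if n = 0 then 1 else 0))) unit_segment"
      unfolding P_def
      by (intro has_contour_integral_sum has_contour_integral_diff gauss_per_fourier t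
            has_contour_integral_lmul qexp_unit_segment_integral) auto
    also have "(\<lambda>z. \<Sum>n\<in>{- int N..int N}. P z * qexp (- of_int n * z) - P 0 * qexp (- of_int n * z)) =
        (\<lambda>z. (P z - P 0) * (\<Sum>n\<in>{- int N..int N}. qexp (- of_int n * z)))"
      by (simp add: sum_distrib_left algebra_simps)
    also have "(\<Sum>n\<in>{- int N..int N}. of_real (sqrt t * exp (- (pi * (real_of_int n)\<^sup>2 * t))) -
        P 0 * (if n = 0 then 1 else 0)) = s N - P 0"
      unfolding sum_subtractf s_def by (simp add: if_distrib sum.delta cong: if_cong)
    finally show ?thesis .
  qed
  have gint: "(\<lambda>z. g z * qexp (of_int m * z)) contour_integrable_on unit_segment" for m
    by (intro contour_integrable_continuous_linepath holomorphic_on_imp_continuous_on holomorphic_intros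
          holomorphic_on_subset[OF g]) (use pi_sub in auto)
  have bound: "norm (s N - P 0) \<le> C / real (Suc N) + C / real N" if N: "N > 0" for N
  proof -
    define I where "I m = contour_integral unit_segment (\<lambda>z. g z * qexp (of_int m * z))" for m
    have I: "((\<lambda>z. g z * qexp (of_int m * z)) has_contour_integral I m) unit_segment" for m
      unfolding I_def by (rule has_contour_integral_integral[OF gint])
    have "((\<lambda>z. g z * qexp (of_int (int (Suc N)) * z) - g z * qexp (of_int (- int N) * z))
        has_contour_integral I (int (Suc N)) - I (- int N)) unit_segment"
      by (intro has_contour_integral_diff I)
    hence "((\<lambda>z. (P z - P 0) * (\<Sum>n\<in>{- int N..int N}. qexp (- of_int n * z)))
        has_contour_integral I (int (Suc N)) - I (- int N)) unit_segment"
    proof (rule has_contour_integral_eq)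
      fix z assume "z \<in> path_image unit_segment"
      hence "z \<in> S" using pi_sub by blast
      from Pg[OF this] show "g z * qexp (of_int (int (Suc N)) * z) - g z * qexp (of_int (- int N) * z) =
          (P z - P 0) * (\<Sum>n\<in>{- int N..int N}. qexp (- of_int n * z))"
        using qexp_telescope[where N = N and z = z] by (metis mult.assoc mult.commute right_diff_distrib)
    qed
    hence "s N - P 0 = I (int (Suc N)) - I (- int N)"
      using has_contour_integral_unique[OF 1] by blast
    moreover have "norm (I (int (Suc N))) \<le> C / real (Suc N)" using C[OF _ I, of "int (Suc N)"] by simp
    moreover have "norm (I (- int N)) \<le> C / real N" using C[OF _ I, of "- int N"] N by simp
    ultimately show ?thesis using norm_triangle_ineq4[of "I (int (Suc N))" "I (- int N)"] by simp
  qed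
  have "(\<lambda>N. s N - P 0) \<longlonglongrightarrow> 0"
  proof (rule Lim_null_comparison)
    show "eventually (\<lambda>N. norm (s N - P 0) \<le> C / real (Suc N) + C / real N) sequentially"
      using eventually_gt_at_top[of 0] by eventually_elim (rule bound)
    show "(\<lambda>N. C / real (Suc N) + C / real N) \<longlonglongrightarrow> 0" by real_asymp
  qed
  thus ?thesis unfolding s_def P_def by (simp add: LIM_zero_iff)
qed
subsection \<open>The theta function\<close>

lemma summable_on_int_geometric:
  fixes q :: real
  assumes "0 \<le> q" "q < 1"
  shows "(\<lambda>n::int. q ^ nat \<bar>n\<bar>) summable_on UNIV"
proof -
  have g: "(\<lambda>n::nat. q ^ n) summable_on UNIV"
    using assms by (subst summable_on_UNIV_nonneg_real_iff) (auto intro!: summable_geometric)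
  have "((\<lambda>n::int. q ^ nat \<bar>n\<bar>) \<circ> int) summable_on UNIV"
    using g by (simp add: o_def)
  hence 1: "(\<lambda>n::int. q ^ nat \<bar>n\<bar>) summable_on range int"
    by (subst summable_on_reindex) (auto simp: inj_on_def)
  have "((\<lambda>n::int. q ^ nat \<bar>n\<bar>) \<circ> (\<lambda>n. - int n)) summable_on UNIV"
    using g by (simp add: o_def)
  hence 2: "(\<lambda>n::int. q ^ nat \<bar>n\<bar>) summable_on range (\<lambda>n. - int n)"
    by (subst summable_on_reindex) (auto simp: inj_on_def)
  have "(\<lambda>n::int. q ^ nat \<bar>n\<bar>) summable_on (range (\<lambda>n. - int n) - range int)"
    by (rule summable_on_subset_banach[OF 2]) auto
  hence "(\<lambda>n::int. q ^ nat \<bar>n\<bar>) summable_on (range int \<union> (range (\<lambda>n. - int n) - range int))"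
    by (intro summable_on_Un_disjoint 1) auto
  also have "range int \<union> (range (\<lambda>n. - int n) - range int) = (UNIV :: int set)"
    by (auto simp: image_iff) (metis int_cases2)
  finally show ?thesis .
qed

lemma norm_qexp_square: "norm (qexp (of_int (n\<^sup>2) * z)) = exp (- (2 * pi * Im z)) ^ nat (n\<^sup>2)"
proof -
  have "real (nat (n\<^sup>2)) = real_of_int (n\<^sup>2)" by simp
  hence "exp (- (2 * pi * Im z)) ^ nat (n\<^sup>2) = exp (real_of_int (n\<^sup>2) * - (2 * pi * Im z))"
    by (metis exp_of_nat_mult)
  also have "\<dots> = norm (qexp (of_int (n\<^sup>2) * z))"
    by (simp add: norm_qexp algebra_simps del: of_int_power)
  finally show ?thesis ..
qed

lemma abs_le_square_int: "\<bar>n\<bar> \<le> (n\<^sup>2 :: int)"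
proof (cases "n = 0")
  case False
  hence "\<bar>n\<bar> * 1 \<le> \<bar>n\<bar> * \<bar>n\<bar>" by (intro mult_left_mono) auto
  thus ?thesis by (simp only: power2_eq_square abs_mult_self_eq mult_1_right)
qed simp

lemma theta_abs_summable:
  assumes "Im z > 0"
  shows "(\<lambda>n::int. norm (qexp (of_int (n\<^sup>2) * z))) summable_on UNIV"
proof (rule Infinite_Sum.abs_summable_on_comparison_test')
  show "(\<lambda>n::int. exp (- (2 * pi * Im z)) ^ nat \<bar>n\<bar>) summable_on UNIV"
    using assms by (intro summable_on_int_geometric) auto
  show "norm (qexp (of_int (n\<^sup>2) * z)) \<le> exp (- (2 * pi * Im z)) ^ nat \<bar>n\<bar>" for n
  proof -
    have "nat \<bar>n\<bar> \<le> nat (n\<^sup>2)" using abs_le_square_int[of n] by simp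
    thus ?thesis unfolding norm_qexp_square using assms
      by (intro power_decreasing) auto
  qed
qed

lemma theta_has_sum:
  assumes "Im z > 0"
  shows "((\<lambda>n::int. qexp (of_int (n\<^sup>2) * z)) has_sum theta z) UNIV"
  unfolding theta_def
  by (rule has_sum_infsum, rule Infinite_Sum.abs_summable_summable[OF theta_abs_summable[OF assms]])

lemma has_sum_int_imp_symmetric_limit:
  fixes f :: "int \<Rightarrow> 'a :: real_normed_vector"
  assumes "(f has_sum S) UNIV"
  shows "(\<lambda>N. \<Sum>n\<in>{- int N..int N}. f n) \<longlonglongrightarrow> S"
proof -
  have "filterlim (\<lambda>N. {- int N..int N}) (finite_subsets_at_top UNIV) sequentially"
    unfolding filterlim_finite_subsets_at_top
  proof safe
    fix X :: "int set" assume X: "finite X"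
    define B where "B = Max (abs ` X)"
    have B: "\<bar>x\<bar> \<le> B" if "x \<in> X" for x
      unfolding B_def using X that by (intro Max_ge) auto
    show "eventually (\<lambda>N. finite {- int N..int N} \<and> X \<subseteq> {- int N..int N} \<and> {- int N..int N} \<subseteq> UNIV) sequentially"
      using eventually_ge_at_top[of "nat B"]
    proof eventually_elim
      case (elim N)
      have "x \<in> {- int N..int N}" if "x \<in> X" for x using B[OF that] elim by auto
      thus ?case by auto
    qed
  qed
  thus ?thesis using assms unfolding has_sum_def by (rule filterlim_compose[rotated])
qed

lemma theta_q_expansion:
  "has_q_expansion theta (\<lambda>n. of_nat (card {s::int. s\<^sup>2 = int n}))"
  unfolding has_q_expansion_def
proof (intro allI impI)
  fix z :: complex assume z: "Im z > 0"
  define h where "h s = (nat (s\<^sup>2), s)" for s :: int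
  define B where "B n = {s::int. s\<^sup>2 = int n}" for n
  have fin: "finite (B n)" for n
  proof (rule finite_subset)
    show "B n \<subseteq> {- int n..int n}"
    proof
      fix s assume "s \<in> B n"
      hence "s\<^sup>2 = int n" by (simp add: B_def)
      thus "s \<in> {- int n..int n}" using abs_le_square_int[of s] by auto
    qed
  qed simp
  have img: "h ` UNIV = Sigma UNIV B" by (auto simp: h_def B_def image_iff)
  have "((\<lambda>(n, s). qexp (of_int (s\<^sup>2) * z)) \<circ> h has_sum theta z) UNIV"
    using theta_has_sum[OF z] by (simp add: o_def h_def)
  hence "((\<lambda>(n, s). qexp (of_int (s\<^sup>2) * z)) has_sum theta z) (Sigma UNIV B)"
    unfolding img[symmetric] by (subst has_sum_reindex) (auto simp: inj_on_def h_def)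
  hence "((\<lambda>n. of_nat (card (B n)) * qexp z ^ n) has_sum theta z) UNIV"
  proof (rule has_sum_SigmaD)
    fix n :: nat
    have "(\<Sum>s\<in>B n. qexp (of_int (s\<^sup>2) * z)) = (\<Sum>s\<in>B n. qexp z ^ n)"
      by (intro sum.cong refl) (auto simp: B_def qexp_power simp flip: of_int_power)
    thus "((\<lambda>s. case (n, s) of (n, s) \<Rightarrow> qexp (of_int (s\<^sup>2) * z)) has_sum of_nat (card (B n)) * qexp z ^ n) (B n)"
      using has_sum_finite[OF fin, of "\<lambda>s. qexp (of_int (s\<^sup>2) * z)" n] by simp
  qed
  thus "(\<lambda>n. of_nat (card {s::int. s\<^sup>2 = int n}) * qexp z ^ n) sums theta z"
    unfolding B_def by (rule has_sum_imp_sums)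
qed

lemma theta_holomorphic: "theta holomorphic_on uhp"
  by (rule has_q_expansion_holomorphic[OF theta_q_expansion])

lemma theta_add_int: "theta (z + of_int b) = theta z"
proof -
  have "qexp (of_int (n\<^sup>2) * (z + of_int b)) = qexp (of_int (n\<^sup>2) * z)" for n
  proof -
    have "of_int (n\<^sup>2) * (z + of_int b) = of_int (n\<^sup>2) * z + of_int (n\<^sup>2 * b)"
      by (simp add: algebra_simps)
    thus ?thesis by (simp only: qexp_add qexp_of_int) simp
  qed
  thus ?thesis by (simp add: theta_def)
qed

text \<open>Both sides equal \<open>gauss_per t 0\<close>: the left one is the sum of the Gaussian
  over the integers, the right one the sum of its Fourier coefficients.\<close>

lemma theta_inversion_imag:
  assumes t: "t > 0"
  shows "theta (\<i> / of_real (2 * t)) = of_real (sqrt t) * theta (\<i> * of_real t / 2)"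
proof -
  have "(\<lambda>N. gauss_per_partial t N 0) \<longlonglongrightarrow> gauss_per t 0"
    using tendsto_uniform_limitI[OF gauss_per_uniform_limit[OF t], of 0] by simp
  also have "(\<lambda>N. gauss_per_partial t N 0) =
      (\<lambda>N. \<Sum>n\<in>{- int N..int N}. qexp (of_int (n\<^sup>2) * (\<i> / of_real (2 * t))))"
  proof
    fix N
    have g: "gaussian t (of_int n) = qexp (of_int (n\<^sup>2) * (\<i> / of_real (2 * t)))" for n
      using t by (simp add: gaussian_def qexp_def field_simps)
    show "gauss_per_partial t N 0 = (\<Sum>n\<in>{- int N..int N}. qexp (of_int (n\<^sup>2) * (\<i> / of_real (2 * t))))"
    proof (induction N)
      case 0
      show ?case using g[of 0] by (simp add: gauss_per_partial_def)
    next
      case (Suc N)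
      have "gauss_per_partial t (Suc N) 0 =
          gauss_per_partial t N 0 + gaussian t (of_int (int (Suc N))) + gaussian t (of_int (- int (Suc N)))"
        by (simp add: gauss_per_partial_def)
      thus ?case unfolding Suc.IH g atLeastAtMost_int_Suc
        by (subst sum.insert; simp add: add_ac)+
    qed
  qed
  finally have "(\<lambda>N. \<Sum>n\<in>{- int N..int N}. qexp (of_int (n\<^sup>2) * (\<i> / of_real (2 * t)))) \<longlonglongrightarrow> gauss_per t 0" .
  moreover have "Im (\<i> / of_real (2 * t)) > 0" using t by simp
  ultimately have eq: "gauss_per t 0 = theta (\<i> / of_real (2 * t))"
    using has_sum_int_imp_symmetric_limit[OF theta_has_sum] LIMSEQ_unique by blast
  have "(\<lambda>N. of_real (sqrt t) * (\<Sum>n\<in>{- int N..int N}. qexp (of_int (n\<^sup>2) * (\<i> * of_real t / 2))))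
      \<longlonglongrightarrow> of_real (sqrt t) * theta (\<i> * of_real t / 2)"
    using t by (intro tendsto_mult_left has_sum_int_imp_symmetric_limit theta_has_sum) simp
  also have "(\<lambda>N. of_real (sqrt t) * (\<Sum>n\<in>{- int N..int N}. qexp (of_int (n\<^sup>2) * (\<i> * of_real t / 2)))) =
      (\<lambda>N. \<Sum>n\<in>{- int N..int N}. complex_of_real (sqrt t * exp (- (pi * (real_of_int n)\<^sup>2 * t))))"
  proof (intro ext, subst sum_distrib_left, intro sum.cong refl)
    fix n :: int
    have "qexp (of_int (n\<^sup>2) * (\<i> * of_real t / 2)) = of_real (exp (- (pi * (real_of_int n)\<^sup>2 * t)))"
      by (simp add: qexp_def exp_of_real[symmetric] algebra_simps)
    thus "of_real (sqrt t) * qexp (of_int (n\<^sup>2) * (\<i> * of_real t / 2)) =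
        complex_of_real (sqrt t * exp (- (pi * (real_of_int n)\<^sup>2 * t)))" by simp
  qed
  finally have "gauss_per t 0 = of_real (sqrt t) * theta (\<i> * of_real t / 2)"
    by (rule LIMSEQ_unique[OF poisson_gaussian[OF t]])
  thus ?thesis by (simp only: eq)
qed

section \<open>Inversion on the whole half plane, and the growth of theta\<close>

lemma Im_neg_inverse_4:
  assumes "Im z > 0" shows "Im (- 1 / (4 * z)) > 0"
proof -
  have "- 1 / (4 * z) = - (inverse z) / 4" by (simp add: field_simps)
  hence "Im (- 1 / (4 * z)) = Im (- (inverse z) / 4)" by (rule arg_cong)
  also have "\<dots> = Im z / ((Re z)\<^sup>2 + (Im z)\<^sup>2) / 4" by simp
  also have "\<dots> > 0" using assms by (intro divide_pos_pos add_nonneg_pos) auto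
  finally show ?thesis .
qed

text \<open>Identity theorem: the two sides agree on the imaginary axis, and both are holomorphic
  because \<open>- 2 * \<i> * z\<close> stays in the right half plane, away from the cut of
  \<open>csqrt\<close>.\<close>

lemma theta_inversion:
  assumes "Im z > 0"
  shows "theta (- 1 / (4 * z)) = csqrt (- 2 * \<i> * z) * theta z"
proof -
  have ns: "- 2 * \<i> * z \<notin> \<real>\<^sub>\<le>\<^sub>0" if "Im z > 0" for z
    using that by (auto simp: complex_nonpos_Reals_iff)
  have z0: "z \<noteq> 0" if "Im z > 0" for z :: complex using that by auto
  have hol: "(\<lambda>z. theta (- 1 / (4 * z)) - csqrt (- 2 * \<i> * z) * theta z) holomorphic_on uhp"
  proof (intro holomorphic_intros theta_holomorphic)
    show "(\<lambda>z. theta (- 1 / (4 * z))) holomorphic_on uhp"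
    proof (rule holomorphic_on_compose_gen[of "\<lambda>z. - 1 / (4 * z)" uhp theta uhp, unfolded o_def])
      show "(\<lambda>z. - 1 / (4 * z)) holomorphic_on uhp" using z0 by (intro holomorphic_intros) auto
      show "(\<lambda>z. - 1 / (4 * z)) ` uhp \<subseteq> uhp" using Im_neg_inverse_4 by blast
    qed (rule theta_holomorphic)
  qed (use ns in auto)
  have lim: "\<i> islimpt {z. Re z = 0 \<and> Im z > 0}"
    unfolding islimpt_approachable
  proof (intro allI impI)
    fix e :: real assume e: "e > 0"
    show "\<exists>x'\<in>{z. Re z = 0 \<and> Im z > 0}. x' \<noteq> \<i> \<and> dist x' \<i> < e"
      using e by (intro bexI[of _ "\<i> * of_real (1 + e/2)"]) (auto simp: dist_norm complex_eq_iff norm_mult algebra_simps cmod_def)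
  qed
  have zero: "theta (- 1 / (4 * z)) - csqrt (- 2 * \<i> * z) * theta z = 0" if "z \<in> {z. Re z = 0 \<and> Im z > 0}" for z
  proof -
    define t where "t = 2 * Im z"
    have t: "t > 0" using that by (simp add: t_def)
    have z: "z = \<i> * of_real t / 2" using that by (simp add: t_def complex_eq_iff)
    have "- 1 / (4 * z) = \<i> / of_real (2 * t)" using t unfolding z by (simp add: field_simps)
    moreover have "csqrt (- 2 * \<i> * z) = of_real (sqrt t)" using t unfolding z by simp
    ultimately show ?thesis using theta_inversion_imag[OF t] by (simp only: z[symmetric]) simp
  qed
  have "theta (- 1 / (4 * z)) - csqrt (- 2 * \<i> * z) * theta z = 0"
    by (rule analytic_continuation[OF hol open_uhp connected_uhp _ _ lim zero]) (use assms in auto)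
  thus ?thesis by simp
qed

text \<open>The map \<open>z / (4 * z + 1)\<close> is inversion, translation by -1 and inversion
  again, with \<open>u\<close> the intermediate point.\<close>

lemma theta_step:
  assumes z: "Im z > 0"
  shows "theta (z / (4 * z + 1)) = csqrt (4 * z + 1) * theta z"
proof -
  define u where "u = - 1 / (4 * z) - 1"
  have z0: "z \<noteq> 0" "4 * z + 1 \<noteq> 0" using z by (auto simp: complex_eq_iff)
  have u: "Im u > 0" unfolding u_def using Im_neg_inverse_4[OF z] by simp
  have "z / (4 * z + 1) = - 1 / (4 * u)"
  proof -
    have "4 * u = - (4 * z + 1) / z" using z0 by (simp add: u_def field_simps)
    hence "- 1 / (4 * u) = - 1 / (- (4 * z + 1) / z)" by (simp only:)
    also have "\<dots> = z / (4 * z + 1)" using z0(2)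
      by (simp only: divide_divide_eq_right minus_divide_left[symmetric] minus_divide_right[symmetric]) simp
    finally show ?thesis ..
  qed
  hence "theta (z / (4 * z + 1)) = csqrt (- 2 * \<i> * u) * theta u" using theta_inversion[OF u] by simp
  also have "theta u = theta (- 1 / (4 * z))" using theta_add_int[of "- 1 / (4 * z)" "- 1"] by (simp add: u_def)
  also have "\<dots> = csqrt (- 2 * \<i> * z) * theta z" by (rule theta_inversion[OF z])
  finally have "theta (z / (4 * z + 1)) = (csqrt (- 2 * \<i> * u) * csqrt (- 2 * \<i> * z)) * theta z" by simp
  also have "csqrt (- 2 * \<i> * u) * csqrt (- 2 * \<i> * z) = csqrt (4 * z + 1)"
  proof (rule csqrt_unique[symmetric])
    have "(- 2 * \<i> * u) * (- 2 * \<i> * z) = 4 * z + 1"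
      using z0 by (simp add: u_def field_simps)
    thus "(csqrt (- 2 * \<i> * u) * csqrt (- 2 * \<i> * z))\<^sup>2 = 4 * z + 1"
      by (simp add: power_mult_distrib)
    \<comment> \<open>Both radicands lie in the right half plane, so each root has argument of size
      less than pi/4. The product therefore has positive real part and is the principal
      root.\<close>
    have bd: "\<bar>Im (csqrt v)\<bar> < Re (csqrt v)" if "Re v > 0" for v
    proof -
      have "Re ((csqrt v)\<^sup>2) > 0" using that by simp
      hence "(Im (csqrt v))\<^sup>2 < (Re (csqrt v))\<^sup>2" by (simp only: Re_power2)
      thus ?thesis using Re_csqrt[of v] power2_less_imp_less[of "\<bar>Im (csqrt v)\<bar>" "Re (csqrt v)"] by simp
    qed
    have "\<bar>Im (csqrt (- 2 * \<i> * u))\<bar> * \<bar>Im (csqrt (- 2 * \<i> * z))\<bar> <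
        Re (csqrt (- 2 * \<i> * u)) * Re (csqrt (- 2 * \<i> * z))"
      by (intro mult_strict_mono') (use bd[of "- 2 * \<i> * u"] bd[of "- 2 * \<i> * z"] u z in auto)
    moreover have "Im (csqrt (- 2 * \<i> * u)) * Im (csqrt (- 2 * \<i> * z)) \<le>
        \<bar>Im (csqrt (- 2 * \<i> * u))\<bar> * \<bar>Im (csqrt (- 2 * \<i> * z))\<bar>"
      by (metis abs_ge_self abs_mult)
    ultimately show "0 < Re (csqrt (- 2 * \<i> * u) * csqrt (- 2 * \<i> * z)) \<or>
        Re (csqrt (- 2 * \<i> * u) * csqrt (- 2 * \<i> * z)) = 0 \<and>
        0 \<le> Im (csqrt (- 2 * \<i> * u) * csqrt (- 2 * \<i> * z))"
      by (simp only: times_complex.simps) linarith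
  qed
  finally show ?thesis .
qed

lemma norm_theta_le_imag:
  assumes "Im z \<ge> y" "y > 0"
  shows "norm (theta z) \<le> norm (theta (\<i> * of_real y))"
proof -
  have z: "Im z > 0" "Im (\<i> * of_real y) > 0" using assms by auto
  have real: "qexp (of_int (n\<^sup>2) * (\<i> * of_real y)) = of_real (norm (qexp (of_int (n\<^sup>2) * (\<i> * of_real y))))" for n
    unfolding norm_qexp by (simp add: qexp_def exp_of_real[symmetric] algebra_simps)
  have "((\<lambda>n. norm (qexp (of_int (n\<^sup>2) * (\<i> * of_real y)))) has_sum Re (theta (\<i> * of_real y))) UNIV"
    using has_sum_Re[OF theta_has_sum[OF z(2)]] by (subst (asm) real) (simp del: of_int_power)
  moreover have "((\<lambda>n. norm (qexp (of_int (n\<^sup>2) * z))) has_sum (\<Sum>\<^sub>\<infinity>n. norm (qexp (of_int (n\<^sup>2) * z)))) UNIV"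
    by (rule has_sum_infsum[OF theta_abs_summable[OF z(1)]])
  moreover have "norm (qexp (of_int (n\<^sup>2) * z)) \<le> norm (qexp (of_int (n\<^sup>2) * (\<i> * of_real y)))" for n
    unfolding norm_qexp_square using assms by (intro power_mono) auto
  ultimately have "(\<Sum>\<^sub>\<infinity>n. norm (qexp (of_int (n\<^sup>2) * z))) \<le> Re (theta (\<i> * of_real y))"
    by (meson has_sum_mono)
  moreover have "norm (theta z) \<le> (\<Sum>\<^sub>\<infinity>n. norm (qexp (of_int (n\<^sup>2) * z)))"
    unfolding theta_def by (rule Infinite_Sum.norm_infsum_bound[OF theta_abs_summable[OF z(1)]])
  ultimately show ?thesis using complex_Re_le_cmod[of "theta (\<i> * of_real y)"] by linarith
qed

text \<open>Below height 1/2, inversion takes \<open>\<i> * y\<close> to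
  \<open>\<i> / (4 * y)\<close>, which lies above height 1/2, at the cost of a factor of order
  \<open>1 / sqrt y\<close>. This growth is exactly what boundedness at all cusps requires in weight
  1/2.\<close>

lemma norm_theta_bound:
  assumes z: "Im z > 0"
  shows "norm (theta z) \<le> norm (theta (\<i> / 2)) * (1 + 1 / sqrt (Im z))"
proof (cases "Im z \<ge> 1/2")
  case True
  hence "norm (theta z) \<le> norm (theta (\<i> / 2)) * 1" using norm_theta_le_imag[of "1/2" z] by simp
  also have "\<dots> \<le> norm (theta (\<i> / 2)) * (1 + 1 / sqrt (Im z))"
    using z by (intro mult_left_mono) auto
  finally show ?thesis .
next
  case False
  define y where "y = Im z"
  have y: "0 < y" "y < 1/2" using z False by (auto simp: y_def)
  have "norm (theta z) \<le> norm (theta (\<i> * of_real y))" using norm_theta_le_imag[of y z] y by (simp add: y_def)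
  also have "theta (\<i> * of_real y) = of_real (sqrt (1 / (2 * y))) * theta (\<i> * of_real (1 / (2 * y)) / 2)"
  proof -
    have "\<i> / of_real (2 * (1 / (2 * y))) = \<i> * complex_of_real y" using y by simp
    thus ?thesis using theta_inversion_imag[of "1 / (2 * y)"] y by simp
  qed
  also have "norm \<dots> \<le> (1 / sqrt y) * norm (theta (\<i> / 2))"
    unfolding norm_mult
  proof (intro mult_mono)
    have "sqrt (1 / (2 * y)) \<le> sqrt (1 / y)" using y by (intro real_sqrt_le_mono) (simp add: field_simps)
    thus "norm (complex_of_real (sqrt (1 / (2 * y)))) \<le> 1 / sqrt y"
      using y unfolding norm_of_real by (simp add: real_sqrt_divide)
    have "1/2 \<le> 1 / (4 * y)" using y by (simp add: field_simps)
    thus "norm (theta (\<i> * of_real (1 / (2 * y)) / 2)) \<le> norm (theta (\<i> / 2))"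
      using norm_theta_le_imag[of "1/2" "\<i> * of_real (1 / (2 * y)) / 2"] by simp
  qed (use y in auto)
  also have "\<dots> \<le> norm (theta (\<i> / 2)) * (1 + 1 / sqrt (Im z))"
    by (simp add: y_def algebra_simps)
  finally show ?thesis .
qed
subsection \<open>The transformation law of theta\<close>

lemma cz_d_nonzero:
  assumes "c \<noteq> 0 \<or> d \<noteq> 0" "Im z > 0"
  shows "of_real c * z + of_real d \<noteq> 0"
proof
  assume *: "of_real c * z + of_real d = 0"
  have "Im (of_real c * z + of_real d) = c * Im z" by simp
  hence "c = 0" using assms(2) * by simp
  thus False using * assms(1) by simp
qed

lemma csqrt_affine:
  fixes \<alpha> :: real and z :: complex
  assumes "Im z > 0"
  defines "v \<equiv> csqrt (1 + of_real \<alpha> * z)"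
  shows "Re v > 0" "\<alpha> \<ge> 0 \<Longrightarrow> Im v \<ge> 0" "\<alpha> \<le> 0 \<Longrightarrow> Im v \<le> 0" "\<alpha> > 0 \<Longrightarrow> Im v > 0"
proof -
  have "v\<^sup>2 = 1 + of_real \<alpha> * z" by (simp add: v_def)
  hence "Im (v\<^sup>2) = \<alpha> * Im z" by simp
  hence im: "2 * Re v * Im v = \<alpha> * Im z" by (simp add: Im_power2)
  show re: "Re v > 0"
  proof (rule ccontr)
    assume "\<not> Re v > 0"
    hence r0: "Re v = 0" using Re_csqrt[of "1 + of_real \<alpha> * z"] by (simp add: v_def)
    hence "\<alpha> = 0" using im assms(1) by simp
    hence "v = 1" by (simp add: v_def)
    thus False using r0 by simp
  qed
  have im': "Im v = \<alpha> * Im z / (2 * Re v)" using im re by (simp add: field_simps)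
  show "Im v \<ge> 0" if "\<alpha> \<ge> 0" unfolding im' using that assms(1) re by simp
  show "Im v \<le> 0" if "\<alpha> \<le> 0" unfolding im' using that assms(1) re
    by (intro divide_nonpos_pos mult_nonpos_nonneg) auto
  show "Im v > 0" if "\<alpha> > 0" unfolding im' using that assms(1) re by simp
qed

text \<open>The quotient of the roots is a root of the quotient; that it is the principal one means
  \<open>Re (p * cnj q) > 0\<close>. If \<open>\<alpha>\<close> and \<open>\<beta>\<close> have the
  same sign, so do the imaginary parts of the roots, and both products in \<open>Re r\<close> are
  nonnegative. For opposite signs, \<open>Im r\<close> has the sign of
  \<open>\<alpha> - \<beta>\<close>, and so has \<open>Im (r\<^sup>2) = 2 * Re r * Im r\<close>;
  hence \<open>Re r > 0\<close>.\<close>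

lemma csqrt_affine_ratio:
  assumes z: "Im z > 0"
  shows "csqrt ((1 + of_real \<alpha> * z) / (1 + of_real \<beta> * z)) =
           csqrt (1 + of_real \<alpha> * z) / csqrt (1 + of_real \<beta> * z)"
proof -
  define p where "p = csqrt (1 + of_real \<alpha> * z)"
  define q where "q = csqrt (1 + of_real \<beta> * z)"
  note P = csqrt_affine[OF z, of \<alpha>, folded p_def]
  note Q = csqrt_affine[OF z, of \<beta>, folded q_def]
  have p2: "p\<^sup>2 = 1 + of_real \<alpha> * z" and q2: "q\<^sup>2 = 1 + of_real \<beta> * z" by (simp_all add: p_def q_def)
  define r where "r = p * cnj q"
  have "r\<^sup>2 = p\<^sup>2 * cnj (q\<^sup>2)" by (simp add: r_def power_mult_distrib)
  hence "Im (r\<^sup>2) = (\<alpha> - \<beta>) * Im z" unfolding p2 q2 by (simp add: algebra_simps)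
  hence im: "2 * Re r * Im r = (\<alpha> - \<beta>) * Im z" by (simp add: Im_power2)
  have Rer: "Re r = Re p * Re q + Im p * Im q" and Imr: "Im r = Im p * Re q - Re p * Im q"
    by (simp_all add: r_def)
  have "Re r > 0"
  proof -
    consider "\<alpha> \<ge> 0" "\<beta> \<ge> 0" | "\<alpha> \<le> 0" "\<beta> \<le> 0" | "\<alpha> > 0" "\<beta> < 0" | "\<alpha> < 0" "\<beta> > 0" by linarith
    thus ?thesis
    proof cases
      case 1
      thus ?thesis unfolding Rer using P Q by (intro add_pos_nonneg mult_pos_pos mult_nonneg_nonneg) auto
    next
      case 2
      thus ?thesis unfolding Rer using P Q by (intro add_pos_nonneg mult_pos_pos mult_nonpos_nonpos) auto
    next
      case 3
      have "Im p * Re q > 0" "Re p * Im q \<le> 0"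
        using P Q 3 by (auto intro!: mult_pos_pos mult_nonneg_nonpos)
      hence "Im r > 0" unfolding Imr by linarith
      moreover have "(\<alpha> - \<beta>) * Im z > 0" using 3 z by (intro mult_pos_pos) auto
      hence "Re r * Im r > 0" using im by linarith
      ultimately show ?thesis by (simp add: zero_less_mult_iff)
    next
      case 4
      have "Im p * Re q \<le> 0" "Re p * Im q > 0"
        using P Q 4 by (auto intro!: mult_pos_pos mult_nonpos_nonneg)
      hence "Im r < 0" unfolding Imr by linarith
      moreover have "(\<alpha> - \<beta>) * Im z < 0" using 4 z by (intro mult_neg_pos) auto
      hence "Re r * Im r < 0" using im by linarith
      ultimately show ?thesis by (simp add: mult_less_0_iff)
    qed
  qed
  moreover have "p / q = r / of_real ((norm q)\<^sup>2)"
    unfolding r_def using complex_div_cnj[of p q] by simp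
  hence "Re (p / q) = Re r / (norm q)\<^sup>2" by (simp only: Re_divide_of_real)
  moreover have "q \<noteq> 0" using Q(1) by auto
  ultimately have "Re (p / q) > 0" by simp
  moreover have "(p / q)\<^sup>2 = (1 + of_real \<alpha> * z) / (1 + of_real \<beta> * z)"
    by (simp add: power_divide p2 q2)
  ultimately show ?thesis unfolding p_def[symmetric] q_def[symmetric] by (intro csqrt_unique) auto
qed

text \<open>
  Normalising by \<open>d\<close> absorbs the sign convention of the Kronecker symbol for negative \<open>d\<close> into the
  branch of the square root.
\<close>

lemma theta_factor_alt:
  assumes d: "d \<noteq> 0" and z: "Im z > 0"
  shows "theta_factor c d z = inverse (if d mod 4 = 1 then 1 else \<i>) * of_int (jacobi c (nat \<bar>d\<bar>)) *
    ((if d < 0 then \<i> else 1) * of_real (sqrt \<bar>real_of_int d\<bar>) *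
     csqrt (1 + of_real (real_of_int c / real_of_int d) * z))"
proof -
  define l where "l = real_of_int c / real_of_int d"
  define v where "v = csqrt (1 + of_real l * z)"
  note V = csqrt_affine[OF z, of l, folded v_def]
  define s where "s = sqrt \<bar>real_of_int d\<bar>"
  have s: "s > 0" "s\<^sup>2 = \<bar>real_of_int d\<bar>" using d by (auto simp: s_def)
  have v2: "v\<^sup>2 = 1 + of_real l * z" by (simp add: v_def)
  have dl: "of_int d * (1 + of_real l * z) = of_int c * z + of_int d"
    using d by (simp add: l_def field_simps)
  have "of_int (if c < 0 \<and> d < 0 then - 1 else 1) * csqrt (of_int c * z + of_int d) =
      (if d < 0 then \<i> else 1) * of_real s * v"
  proof (cases "d < 0")
    case False
    have "(of_real s * v)\<^sup>2 = of_real (s\<^sup>2) * v\<^sup>2" by (simp add: power_mult_distrib)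
    also have "\<dots> = of_int c * z + of_int d" unfolding s(2) v2 using False dl by simp
    finally have "csqrt (of_int c * z + of_int d) = of_real s * v"
      using V s by (intro csqrt_unique) auto
    thus ?thesis using False by simp
  next
    case True
    have w2: "(\<i> * of_real s * v)\<^sup>2 = of_int c * z + of_int d"
    proof -
      have "(\<i> * of_real s * v)\<^sup>2 = - of_real (s\<^sup>2) * v\<^sup>2" by (simp add: power_mult_distrib)
      also have "\<dots> = of_int c * z + of_int d" unfolding s(2) v2 using True dl by simp
      finally show ?thesis .
    qed
    show ?thesis
    proof (cases "c < 0")
      case c: True
      hence "l > 0" using True by (simp add: l_def divide_neg_neg)
      hence "csqrt (of_int c * z + of_int d) = - (\<i> * of_real s * v)"
        using V s w2 by (intro csqrt_unique) auto
      thus ?thesis using c True by simp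
    next
      case c: False
      hence "l \<le> 0" using True by (simp add: l_def divide_nonneg_neg)
      hence "Im v \<le> 0" using V by simp
      hence "csqrt (of_int c * z + of_int d) = \<i> * of_real s * v"
        using V s w2 by (intro csqrt_unique) (auto simp: mult_le_0_iff zero_less_mult_iff mult_less_0_iff)
      thus ?thesis using c True by simp
    qed
  qed
  moreover have "theta_factor c d z = inverse (if d mod 4 = 1 then 1 else \<i>) * of_int (jacobi c (nat \<bar>d\<bar>)) *
      (of_int (if c < 0 \<and> d < 0 then - 1 else 1) * csqrt (of_int c * z + of_int d))"
    unfolding theta_factor_def kronecker_eq_jacobi[OF d] by simp
  ultimately show ?thesis unfolding v_def l_def s_def by simp
qed

lemma Im_moebius_step:
  assumes "Im z > 0" shows "Im (z / (1 + of_real \<beta> * z)) > 0"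
proof -
  have nz: "1 + of_real \<beta> * z \<noteq> 0" using cz_d_nonzero[of \<beta> 1 z] assms by (simp add: add.commute)
  have "Im (z / (1 + of_real \<beta> * z)) = Im (z * cnj (1 + of_real \<beta> * z) / of_real ((norm (1 + of_real \<beta> * z))\<^sup>2))"
    by (subst complex_div_cnj) simp
  also have "\<dots> = Im (z * cnj (1 + of_real \<beta> * z)) / (norm (1 + of_real \<beta> * z))\<^sup>2"
    by (rule Im_divide_of_real)
  also have "Im (z * cnj (1 + of_real \<beta> * z)) = Im z" by (simp add: algebra_simps)
  finally show ?thesis using assms nz by simp
qed

lemma theta_step_pm:
  assumes z: "Im z > 0" and e: "e = 1 \<or> e = (- 1 :: int)"
  shows "theta (z / (1 + of_real (- 4 * of_int e) * z)) = csqrt (1 + of_real (- 4 * of_int e) * z) * theta z"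
proof (cases "e = - 1")
  case True
  thus ?thesis using theta_step[OF z] by (simp add: add.commute)
next
  case False
  hence e1: "e = 1" using e by simp
  define y where "y = 1 + complex_of_real (- 4) * z"
  define z' where "z' = z / y"
  have y0: "y \<noteq> 0" using cz_d_nonzero[of "- 4" 1 z] z by (simp add: y_def add.commute)
  have z': "Im z' > 0" unfolding z'_def y_def by (rule Im_moebius_step[OF z])
  have 1: "4 * z' + 1 = inverse y" using y0 by (simp add: z'_def y_def field_simps)
  hence "z' / (4 * z' + 1) = z" using y0 by (simp add: z'_def)
  hence "theta z = csqrt (inverse y) * theta z'" using theta_step[OF z'] 1 by simp
  moreover have "y \<notin> \<real>\<^sub>\<le>\<^sub>0" using z by (auto simp: y_def complex_nonpos_Reals_iff)
  ultimately have "theta z = inverse (csqrt y) * theta z'" by (simp add: csqrt_inverse)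
  hence "theta z' = csqrt y * theta z" using y0 by simp
  thus ?thesis unfolding z'_def y_def e1 by simp
qed

theorem theta_transformation:
  assumes "a * d - b * c = 1" "4 dvd c" "Im z > 0"
  shows "theta (int_moebius a b c d z) = theta_factor c d z * theta z"
  using assms
proof (induction "nat (\<bar>c\<bar> + \<bar>d\<bar>)" arbitrary: a b c d z rule: less_induct)
  case less
  note det = less.prems(1) and c4 = less.prems(2) and z = less.prems(3)
  have od: "odd d"
  proof
    assume "even d"
    moreover have "even c" using c4 by (meson dvd_trans even_numeral)
    ultimately have "even (a * d - b * c)" by simp
    thus False using det by simp
  qed
  have cop: "coprime c d"
  proof (rule coprimeI)
    fix x assume "x dvd c" "x dvd d"
    hence "x dvd a * d - b * c" by simp
    thus "is_unit x" using det by simp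
  qed
  show ?case
  proof (cases "c = 0")
    case True
    hence "a * d = 1" using det by simp
    hence ad: "a = 1 \<and> d = 1 \<or> a = - 1 \<and> d = - 1" by (simp add: zmult_eq_1_iff)
    have k: "kronecker 0 1 = 1" "kronecker 0 (- 1) = 1" by (simp_all add: kronecker_def)
    from ad show ?thesis
    proof
      assume "a = 1 \<and> d = 1"
      thus ?thesis using True k theta_add_int[of z b] by (simp add: moebius_def theta_factor_def)
    next
      \<comment> \<open>The factor is trivial here as well: \<open>inverse \<i>\<close> cancels
        against \<open>csqrt (- 1) = \<i>\<close>.\<close>
      assume *: "a = - 1 \<and> d = - 1"
      have "int_moebius a b c d z = z + of_int (- b)" using * True by (simp add: moebius_def)
      thus ?thesis using True * k theta_add_int[of z "- b"] by (simp add: theta_factor_def)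
    qed
  next
    case c0: False
    have d0: "d \<noteq> 0" using od by auto
    have nz: "of_int c * z + of_int d \<noteq> 0"
      using cz_d_nonzero[of "of_int c" "of_int d" z] d0 z by simp
    \<comment> \<open>The case in which neither move would shorten the pair: adding
      \<open>\<plusminus> c\<close> to \<open>d\<close> helps for
      \<open>\<bar>c\<bar> < 2 * \<bar>d\<bar>\<close>, adding \<open>\<plusminus> 4 * d\<close> to
      \<open>c\<close> for the reverse inequality. Parity excludes equality.\<close>
    have ne: "\<bar>c\<bar> \<noteq> 2 * \<bar>d\<bar>"
    proof
      assume *: "\<bar>c\<bar> = 2 * \<bar>d\<bar>"
      have "4 dvd \<bar>c\<bar>" using c4 by simp
      hence "even \<bar>d\<bar>" unfolding * by presburger
      thus False using od by simp
    qed
    show ?thesis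
    proof (cases "\<bar>c\<bar> < 2 * \<bar>d\<bar>")
      case True
      \<comment> \<open>The sign is chosen so that the absolute values are subtracted, not
        added.\<close>
      define e where "e = (if c * d > 0 then - 1 else 1 :: int)"
      have "e * c = - c \<and> (c > 0 \<and> d > 0 \<or> c < 0 \<and> d < 0) \<or> e * c = c \<and> (c > 0 \<and> d < 0 \<or> c < 0 \<and> d > 0)"
        using c0 d0 by (auto simp: e_def zero_less_mult_iff)
      hence "\<bar>d + e * c\<bar> = \<bar>\<bar>d\<bar> - \<bar>c\<bar>\<bar>" by (elim disjE conjE) linarith+
      hence "\<bar>c\<bar> + \<bar>d + e * c\<bar> < \<bar>c\<bar> + \<bar>d\<bar>" using True c0 by linarith
      hence dec: "nat (\<bar>c\<bar> + \<bar>d + e * c\<bar>) < nat (\<bar>c\<bar> + \<bar>d\<bar>)"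
        by (subst nat_less_eq_zless) auto
      have "theta (int_moebius a (b + e * a) c (d + e * c) (z - of_int e)) =
          theta_factor c (d + e * c) (z - of_int e) * theta (z - of_int e)"
        using det c4 z by (intro less.hyps dec) (simp_all add: algebra_simps)
      also have "int_moebius a (b + e * a) c (d + e * c) (z - of_int e) = int_moebius a b c d z"
        by (simp add: moebius_def algebra_simps)
      also have "theta (z - of_int e) = theta z" using theta_add_int[of z "- e"] by simp
      also have "theta_factor c (d + e * c) (z - of_int e) = theta_factor c d z"
      proof -
        have "kronecker c (d + e * c) = kronecker c d"
          by (rule kronecker_periodic[OF c4 c0 cop, symmetric]) (simp add: cong_iff_dvd_diff)
        moreover have "(d + e * c) mod 4 = d mod 4" using c4 by (simp add: mod_eq_dvd_iff)
        moreover have "of_int c * (z - of_int e) + of_int (d + e * c) = of_int c * z + of_int d"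
          by (simp add: algebra_simps)
        ultimately show ?thesis unfolding theta_factor_def by (simp only:)
      qed
      finally show ?thesis .
    next
      case False
      hence big: "\<bar>c\<bar> > 2 * \<bar>d\<bar>" using ne by simp
      define e where "e = (if c * d > 0 then - 1 else 1 :: int)"
      have e: "e = 1 \<or> e = - 1" by (simp add: e_def)
      define \<beta> where "\<beta> = - 4 * real_of_int e"
      define y where "y = 1 + of_real \<beta> * z"
      define z' where "z' = z / y"
      have y0: "y \<noteq> 0" using cz_d_nonzero[of \<beta> 1 z] z by (simp add: y_def add.commute)
      have z': "Im z' > 0" unfolding z'_def y_def by (rule Im_moebius_step[OF z])
      have "4 * e * d = - 4 * d \<and> (c > 0 \<and> d > 0 \<or> c < 0 \<and> d < 0) \<or>
          4 * e * d = 4 * d \<and> (c > 0 \<and> d < 0 \<or> c < 0 \<and> d > 0)"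
        using c0 d0 by (auto simp: e_def zero_less_mult_iff)
      hence "\<bar>c + 4 * e * d\<bar> = \<bar>\<bar>c\<bar> - 4 * \<bar>d\<bar>\<bar>" by (elim disjE conjE) linarith+
      hence "\<bar>c + 4 * e * d\<bar> + \<bar>d\<bar> < \<bar>c\<bar> + \<bar>d\<bar>" using big d0 by linarith
      hence dec: "nat (\<bar>c + 4 * e * d\<bar> + \<bar>d\<bar>) < nat (\<bar>c\<bar> + \<bar>d\<bar>)"
        by (subst nat_less_eq_zless) auto
      have "theta (int_moebius (a + 4 * e * b) b (c + 4 * e * d) d z') =
          theta_factor (c + 4 * e * d) d z' * theta z'"
        using det c4 z' by (intro less.hyps dec) (simp_all add: algebra_simps)
      also have "int_moebius (a + 4 * e * b) b (c + 4 * e * d) d z' = int_moebius a b c d z"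
      proof -
        have num: "of_int (a + 4 * e * b) * z' + of_int b = (of_int a * z + of_int b) / y"
          and den: "of_int (c + 4 * e * d) * z' + of_int d = (of_int c * z + of_int d) / y"
          using y0 by (simp_all add: z'_def field_simps) (simp_all add: y_def \<beta>_def algebra_simps)
        show ?thesis unfolding moebius_def num den using y0 by simp
      qed
      also have "theta z' = csqrt y * theta z"
        unfolding z'_def y_def \<beta>_def by (rule theta_step_pm[OF z e])
      \<comment> \<open>With \<open>d\<close> fixed, the numerator of the Jacobi symbol changes by a
        multiple of \<open>d\<close>, and the normalised roots multiply by
        \<open>csqrt_affine_ratio\<close>. This is the cocycle relation for the second
        generator.\<close>
      also have "theta_factor (c + 4 * e * d) d z' * (csqrt y * theta z) = theta_factor c d z * theta z"
      proof -
        define l where "l = real_of_int c / real_of_int d"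
        have l': "real_of_int (c + 4 * e * d) / real_of_int d = l - \<beta>"
          using d0 by (simp add: l_def \<beta>_def field_simps)
        have "1 + of_real (l - \<beta>) * z' = (1 + of_real l * z) / y"
          using y0 by (simp add: z'_def field_simps) (simp add: y_def algebra_simps)
        hence "csqrt (1 + of_real (l - \<beta>) * z') * csqrt y = csqrt (1 + of_real l * z)"
          using csqrt_affine_ratio[OF z, of l \<beta>] csqrt_affine(1)[OF z, of \<beta>] y0 unfolding y_def by auto
        moreover have "jacobi (c + 4 * e * d) (nat \<bar>d\<bar>) = jacobi c (nat \<bar>d\<bar>)"
          using od by (intro jacobi_cong) (auto simp: even_nat_iff cong_iff_dvd_diff)
        ultimately show ?thesis
          unfolding theta_factor_alt[OF d0 z'] theta_factor_alt[OF d0 z] l' l_def[symmetric] by simp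
      qed
      finally show ?thesis .
    qed
  qed
qed
subsection \<open>Covariance of Rankin--Cohen brackets\<close>

text \<open>
  The coefficient of \<open>(c / (cz + d))\<^sup>n\<^sup>-\<^sup>j F\<^sub>1\<^sup>(\<^sup>j\<^sup>)\<close> in the \<open>n\<close>-th derivative of a form of weight \<open>\<kappa>\<close> at the
  transformed point; the recursion is what differentiation produces.
\<close>

fun slash_coeff :: "complex \<Rightarrow> nat \<Rightarrow> nat \<Rightarrow> complex" where
  "slash_coeff \<kappa> 0 0 = 1"
| "slash_coeff \<kappa> 0 (Suc j) = 0"
| "slash_coeff \<kappa> (Suc n) 0 = (\<kappa> + of_nat n) * slash_coeff \<kappa> n 0"
| "slash_coeff \<kappa> (Suc n) (Suc j) =
     (\<kappa> + of_nat (n + Suc j)) * slash_coeff \<kappa> n (Suc j) + slash_coeff \<kappa> n j"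

lemma slash_coeff_eq_0: "n < j \<Longrightarrow> slash_coeff \<kappa> n j = 0"
  by (induction \<kappa> n j rule: slash_coeff.induct) auto

lemma slash_coeff_Suc:
  "slash_coeff \<kappa> (Suc n) j =
     (\<kappa> + of_nat (n + j)) * slash_coeff \<kappa> n j + (if j = 0 then 0 else slash_coeff \<kappa> n (j - 1))"
  by (cases j) simp_all

text \<open>The coefficient is \<open>n choose j\<close> times the rising factorial of
  \<open>\<kappa> + j\<close> of length \<open>n - j\<close>. The cleared form remains meaningful
  when \<open>pochhammer \<kappa> j\<close> vanishes.\<close>

lemma slash_coeff_closed:
  "j \<le> n \<Longrightarrow> slash_coeff \<kappa> n j * (fact (n - j) * (fact j * pochhammer \<kappa> j)) = fact n * pochhammer \<kappa> n"
proof (induction n arbitrary: j)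
  case (Suc n)
  have A: "slash_coeff \<kappa> n j * (fact (Suc n - j) * (fact j * pochhammer \<kappa> j)) =
      of_nat (Suc n - j) * (fact n * pochhammer \<kappa> n)" for j
  proof (cases "j \<le> n")
    case True
    hence "Suc n - j = Suc (n - j)" by simp
    hence "(fact (Suc n - j) :: complex) = of_nat (Suc n - j) * fact (n - j)" by simp
    thus ?thesis using Suc.IH[OF True] by (simp add: algebra_simps)
  qed (simp add: slash_coeff_eq_0)
  have B: "(if j = 0 then 0 else slash_coeff \<kappa> n (j - 1)) * (fact (Suc n - j) * (fact j * pochhammer \<kappa> j)) =
      of_nat j * (\<kappa> + of_nat j - 1) * (fact n * pochhammer \<kappa> n)"
  proof (cases j)
    case (Suc i)
    hence i: "i \<le> n" using Suc.prems by simp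
    have "slash_coeff \<kappa> n i * (fact (n - i) * (fact (Suc i) * pochhammer \<kappa> (Suc i))) =
        of_nat (Suc i) * (\<kappa> + of_nat i) * (slash_coeff \<kappa> n i * (fact (n - i) * (fact i * pochhammer \<kappa> i)))"
      by (simp add: pochhammer_Suc algebra_simps)
    thus ?thesis unfolding Suc.IH[OF i] using Suc by simp
  qed simp
  have "slash_coeff \<kappa> (Suc n) j * (fact (Suc n - j) * (fact j * pochhammer \<kappa> j)) =
     ((\<kappa> + of_nat (n + j)) * of_nat (Suc n - j) + of_nat j * (\<kappa> + of_nat j - 1)) * (fact n * pochhammer \<kappa> n)"
    unfolding slash_coeff_Suc distrib_right B mult.assoc A by (simp add: algebra_simps)
  also have "(\<kappa> + of_nat (n + j)) * of_nat (Suc n - j) + of_nat j * (\<kappa> + of_nat j - 1) =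
      of_nat (Suc n) * (\<kappa> + of_nat n)"
    using Suc.prems by (simp add: of_nat_diff algebra_simps)
  finally show ?case by (simp add: pochhammer_Suc algebra_simps)
qed simp

lemma holomorphic_higher_deriv_DERIV:
  assumes "f holomorphic_on S" "open S" "z \<in> S"
  shows "((deriv ^^ n) f has_field_derivative (deriv ^^ Suc n) f z) (at z)"
  using holomorphic_derivI[OF holomorphic_higher_deriv[OF assms(1,2)] assms(2,3)] by simp

lemma moebius_uhp:
  fixes a b c d :: real
  assumes det: "a * d - b * c > 0" and z: "Im z > 0"
  shows "of_real c * z + of_real d \<noteq> 0"
    and "Im (moebius (of_real a) (of_real b) (of_real c) (of_real d) z) =
           (a * d - b * c) * Im z / (norm (of_real c * z + of_real d))\<^sup>2"
    and "Im (moebius (of_real a) (of_real b) (of_real c) (of_real d) z) > 0"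
proof -
  show nz: "of_real c * z + of_real d \<noteq> 0"
  proof
    assume *: "of_real c * z + of_real d = 0"
    have "Im (of_real c * z + of_real d) = c * Im z" by simp
    hence "c = 0" using z * by simp
    thus False using * det by simp
  qed
  have "Im (moebius (of_real a) (of_real b) (of_real c) (of_real d) z) =
      Im ((of_real a * z + of_real b) * cnj (of_real c * z + of_real d) / of_real ((norm (of_real c * z + of_real d))\<^sup>2))"
    unfolding moebius_def by (subst complex_div_cnj) simp
  also have "\<dots> = Im ((of_real a * z + of_real b) * cnj (of_real c * z + of_real d)) / (norm (of_real c * z + of_real d))\<^sup>2"
    by (rule Im_divide_of_real)
  also have "Im ((of_real a * z + of_real b) * cnj (of_real c * z + of_real d)) = (a * d - b * c) * Im z"
    by (simp add: algebra_simps)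
  finally show *: "Im (moebius (of_real a) (of_real b) (of_real c) (of_real d) z) =
           (a * d - b * c) * Im z / (norm (of_real c * z + of_real d))\<^sup>2" .
  show "Im (moebius (of_real a) (of_real b) (of_real c) (of_real d) z) > 0"
    unfolding * using det z nz by simp
qed

lemma int_moebius_uhp:
  assumes det: "a * d - b * c = (1 :: int)" and z: "Im z > 0"
  shows "of_int c * z + of_int d \<noteq> 0"
    and "Im (int_moebius a b c d z) = Im z / (norm (of_int c * z + of_int d))\<^sup>2"
    and "Im (int_moebius a b c d z) > 0"
proof -
  have "real_of_int a * of_int d - of_int b * of_int c = 1"
    using det by (metis of_int_1 of_int_diff of_int_mult)
  thus "of_int c * z + of_int d \<noteq> 0"
    "Im (int_moebius a b c d z) = Im z / (norm (of_int c * z + of_int d))\<^sup>2"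
    "Im (int_moebius a b c d z) > 0"
    using moebius_uhp[of "of_int a" "of_int d" "of_int b" "of_int c" z] z by simp_all
qed

lemma int_moebius_DERIV:
  assumes det: "a * d - b * c = (1 :: int)" and z: "Im z > 0"
  shows "(int_moebius a b c d has_field_derivative inverse ((of_int c * z + of_int d)\<^sup>2)) (at z)"
proof -
  note nz = int_moebius_uhp(1)[OF det z]
  have "complex_of_int a * of_int d - of_int b * of_int c = 1"
    using det by (metis of_int_1 of_int_diff of_int_mult)
  hence ad: "complex_of_int a * of_int d = 1 + of_int b * of_int c" by (simp add: algebra_simps)
  have "(int_moebius a b c d has_field_derivative
      ((of_int a * 1 + 0) * (of_int c * z + of_int d) - (of_int a * z + of_int b) * (of_int c * 1 + 0)) /
      ((of_int c * z + of_int d) * (of_int c * z + of_int d))) (at z)"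
    unfolding moebius_def using nz
    by (intro DERIV_divide DERIV_add DERIV_cmult DERIV_ident DERIV_const)
  also have "(of_int a * 1 + 0) * (of_int c * z + of_int d) - (of_int a * z + of_int b) * (of_int c * 1 + 0) = (1 :: complex)"
    using ad by (simp add: algebra_simps)
  finally show ?thesis by (simp add: power2_eq_square field_simps)
qed

text \<open>The automorphy factor \<open>e\<close> enters only through its logarithmic derivative,
  which covers integral weight, weight 1/2 and constant multipliers alike. Allowing
  \<open>F1\<close> to differ from \<open>F\<close> is what makes it applicable at the cusps, where
  the function is not invariant.\<close>

lemma higher_deriv_slash:
  fixes F F1 e :: "complex \<Rightarrow> complex" and a b c d :: int and \<kappa> :: complex
  assumes F: "F holomorphic_on uhp" and F1: "F1 holomorphic_on uhp"
    and det: "a * d - b * c = 1"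
    and e: "\<And>z. Im z > 0 \<Longrightarrow> (e has_field_derivative \<kappa> * (of_int c / (of_int c * z + of_int d)) * e z) (at z)"
    and eq: "\<And>z. Im z > 0 \<Longrightarrow> F (int_moebius a b c d z) = e z * F1 z"
    and z: "Im z > 0"
  shows "(deriv ^^ n) F (int_moebius a b c d z) = e z * (of_int c * z + of_int d) ^ (2 * n) *
    (\<Sum>j\<le>n. slash_coeff \<kappa> n j * (of_int c / (of_int c * z + of_int d)) ^ (n - j) * (deriv ^^ j) F1 z)"
  using z
proof (induction n arbitrary: z)
  case 0
  thus ?case using eq by simp
next
  case (Suc n)
  define \<rho> where "\<rho> z = of_int c / (of_int c * z + of_int d)" for z :: complex
  define J where "J z = of_int c * z + of_int d" for z :: complex
  define s where "s z = (\<Sum>j\<le>n. slash_coeff \<kappa> n j * \<rho> z ^ (n - j) * (deriv ^^ j) F1 z)" for z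
  have nz: "J z \<noteq> 0" unfolding J_def by (rule int_moebius_uhp(1)[OF det Suc.prems])
  have D\<rho>: "(\<rho> has_field_derivative - (\<rho> z)\<^sup>2) (at z)"
  proof -
    have "(\<rho> has_field_derivative ((0 * J z - of_int c * (of_int c * 1 + 0)) / (J z * J z))) (at z)"
      using nz unfolding \<rho>_def J_def
      by (intro DERIV_divide DERIV_add DERIV_cmult DERIV_ident DERIV_const)
    thus ?thesis by (simp add: \<rho>_def J_def[symmetric] power2_eq_square)
  qed
  have DJ: "(J has_field_derivative of_int c) (at z)"
    unfolding J_def by (auto intro!: derivative_eq_intros)
  have Ds: "(s has_field_derivative (\<Sum>j\<le>n. slash_coeff \<kappa> n j *
      (\<rho> z ^ (n - j) * (deriv ^^ Suc j) F1 z - of_nat (n - j) * \<rho> z ^ (Suc n - j) * (deriv ^^ j) F1 z))) (at z)"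
    unfolding s_def
  proof (intro DERIV_sum)
    fix j assume j: "j \<in> {..n}"
    have "((\<lambda>z. \<rho> z ^ (n - j)) has_field_derivative of_nat (n - j) * (- (\<rho> z)\<^sup>2 * \<rho> z ^ (n - j - Suc 0))) (at z)"
      by (rule DERIV_power[OF D\<rho>])
    also have "of_nat (n - j) * (- (\<rho> z)\<^sup>2 * \<rho> z ^ (n - j - Suc 0)) = - (of_nat (n - j) * \<rho> z ^ (Suc n - j))"
    proof (cases "n - j")
      case (Suc m)
      hence "Suc n - j = Suc (Suc m)" using j by simp
      thus ?thesis using Suc by (simp add: power2_eq_square)
    qed simp
    finally have "((\<lambda>z. \<rho> z ^ (n - j)) has_field_derivative - (of_nat (n - j) * \<rho> z ^ (Suc n - j))) (at z)" .
    from DERIV_cmult[OF DERIV_mult[OF this holomorphic_higher_deriv_DERIV[OF F1 open_uhp, of z j]], of "slash_coeff \<kappa> n j"] Suc.prems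
    show "((\<lambda>z. slash_coeff \<kappa> n j * \<rho> z ^ (n - j) * (deriv ^^ j) F1 z) has_field_derivative
        slash_coeff \<kappa> n j * (\<rho> z ^ (n - j) * (deriv ^^ Suc j) F1 z - of_nat (n - j) * \<rho> z ^ (Suc n - j) * (deriv ^^ j) F1 z)) (at z)"
      by (simp add: mult.assoc algebra_simps del: funpow.simps)
  qed
  define s' where "s' = (\<Sum>j\<le>n. slash_coeff \<kappa> n j *
      (\<rho> z ^ (n - j) * (deriv ^^ Suc j) F1 z - of_nat (n - j) * \<rho> z ^ (Suc n - j) * (deriv ^^ j) F1 z))"
  have DJn: "((\<lambda>z. J z ^ (2 * n)) has_field_derivative of_nat (2 * n) * \<rho> z * J z ^ (2 * n)) (at z)"
  proof -
    have "((\<lambda>z. J z ^ (2 * n)) has_field_derivative of_nat (2 * n) * (of_int c * J z ^ (2 * n - Suc 0))) (at z)"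
      by (rule DERIV_power[OF DJ])
    moreover have "of_nat (2 * n) * (of_int c * J z ^ (2 * n - Suc 0)) = of_nat (2 * n) * \<rho> z * J z ^ (2 * n)"
      using nz by (cases n) (simp_all add: \<rho>_def J_def[symmetric])
    ultimately show ?thesis by (simp only:)
  qed
  have R: "((\<lambda>z. e z * J z ^ (2 * n) * s z) has_field_derivative
      e z * J z ^ (2 * n) * ((\<kappa> + of_nat (2 * n)) * \<rho> z * s z + s')) (at z)"
  proof -
    have "((\<lambda>z. e z * J z ^ (2 * n) * s z) has_field_derivative
      (\<kappa> * \<rho> z * e z * J z ^ (2 * n) + of_nat (2 * n) * \<rho> z * J z ^ (2 * n) * e z) * s z + s' * (e z * J z ^ (2 * n))) (at z)"
      using e[OF Suc.prems] Ds unfolding s'_def \<rho>_def[symmetric]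
      by (intro DERIV_mult DJn) auto
    thus ?thesis by (rule DERIV_cong) (simp add: algebra_simps)
  qed
  have L: "((\<lambda>z. (deriv ^^ n) F (int_moebius a b c d z)) has_field_derivative
      (deriv ^^ Suc n) F (int_moebius a b c d z) * inverse ((J z)\<^sup>2)) (at z)"
    using holomorphic_higher_deriv_DERIV[OF F open_uhp, of "int_moebius a b c d z" n]
      int_moebius_uhp(3)[OF det Suc.prems] int_moebius_DERIV[OF det Suc.prems]
    unfolding J_def by (intro DERIV_chain2) auto
  have "((\<lambda>z. e z * J z ^ (2 * n) * s z) has_field_derivative
      (deriv ^^ Suc n) F (int_moebius a b c d z) * inverse ((J z)\<^sup>2)) (at z)"
    using L
  proof (rule has_field_derivative_transform_within_open[OF _ open_uhp])
    show "(deriv ^^ n) F (int_moebius a b c d x) = e x * J x ^ (2 * n) * s x" if "x \<in> uhp" for x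
      using Suc.IH[of x] that by (simp add: J_def s_def \<rho>_def)
  qed (use Suc.prems in auto)
  from DERIV_unique[OF this R]
  have "(deriv ^^ Suc n) F (int_moebius a b c d z) =
      e z * J z ^ (2 * Suc n) * ((\<kappa> + of_nat (2 * n)) * \<rho> z * s z + s')"
    using nz by (simp add: field_simps power2_eq_square del: funpow.simps)
  also have "(\<kappa> + of_nat (2 * n)) * \<rho> z * s z + s' =
      (\<Sum>j\<le>Suc n. slash_coeff \<kappa> (Suc n) j * \<rho> z ^ (Suc n - j) * (deriv ^^ j) F1 z)"
  proof -
    have "(\<kappa> + of_nat (2 * n)) * \<rho> z * s z + s' =
      (\<Sum>j\<le>n. (\<kappa> + of_nat (n + j)) * slash_coeff \<kappa> n j * \<rho> z ^ (Suc n - j) * (deriv ^^ j) F1 z) +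
      (\<Sum>j\<le>n. slash_coeff \<kappa> n j * \<rho> z ^ (n - j) * (deriv ^^ Suc j) F1 z)"
      unfolding s_def s'_def sum_distrib_left sum.distrib[symmetric]
      by (intro sum.cong refl) (simp add: Suc_diff_le of_nat_diff algebra_simps del: funpow.simps)
    also have "(\<Sum>j\<le>n. (\<kappa> + of_nat (n + j)) * slash_coeff \<kappa> n j * \<rho> z ^ (Suc n - j) * (deriv ^^ j) F1 z) =
      (\<Sum>j\<le>Suc n. (\<kappa> + of_nat (n + j)) * slash_coeff \<kappa> n j * \<rho> z ^ (Suc n - j) * (deriv ^^ j) F1 z)"
      by (simp add: slash_coeff_eq_0)
    finally show ?thesis
      unfolding sum.atMost_Suc_shift by (simp add: sum.distrib algebra_simps del: funpow.simps)
  qed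
  finally show ?case unfolding J_def \<rho>_def .
qed

section \<open>Cohen--Kuznetsov series and covariance of the bracket\<close>

definition rc_sum :: "real \<Rightarrow> real \<Rightarrow> nat \<Rightarrow> (nat \<Rightarrow> complex) \<Rightarrow> (nat \<Rightarrow> complex) \<Rightarrow> complex" where
  "rc_sum k\<^sub>1 k\<^sub>2 w X Y = (\<Sum>j\<le>w. (- 1) ^ j * of_real ((k\<^sub>1 + real w - 1) gchoose (w - j)) *
        of_real ((k\<^sub>2 + real w - 1) gchoose j) * X j * Y (w - j))"

text \<open>The Cohen--Kuznetsov series of a sequence of derivatives. In this normalisation a
  bracket is a coefficient of a product of two series, and the slash action multiplies a series by
  an exponential.\<close>

definition ck_fps :: "real \<Rightarrow> (nat \<Rightarrow> complex) \<Rightarrow> complex fps" where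
  "ck_fps \<kappa> X = Abs_fps (\<lambda>j. X j / (fact j * of_real (pochhammer \<kappa> j)))"

lemma rc_sum_eq_fps:
  assumes "k\<^sub>1 > 0" "k\<^sub>2 > 0"
  shows "rc_sum k\<^sub>1 k\<^sub>2 w X Y = of_real (pochhammer k\<^sub>1 w * pochhammer k\<^sub>2 w) *
           fps_nth (ck_fps k\<^sub>1 (\<lambda>j. (- 1) ^ j * X j) * ck_fps k\<^sub>2 Y) w"
  unfolding rc_sum_def fps_mult_nth sum_distrib_left atLeast0AtMost
proof (intro sum.cong refl)
  fix j assume j: "j \<in> {..w}"
  have g: "((k + real w - 1) gchoose (w - i)) * (fact (w - i) * pochhammer k i) = pochhammer k w"
    if "i \<le> w" for k :: real and i
  proof -
    have "(k + real w - 1) gchoose (w - i) = pochhammer (k + real i) (w - i) / fact (w - i)"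
      using that by (subst gbinomial_pochhammer') (simp add: of_nat_diff)
    moreover have "pochhammer k w = pochhammer k i * pochhammer (k + real i) (w - i)"
      using pochhammer_product[OF that, of k] by simp
    ultimately show ?thesis by simp
  qed
  have p: "pochhammer k\<^sub>1 i > 0" "pochhammer k\<^sub>2 i > 0" for i
    using assms by (auto intro: pochhammer_pos)
  have 1: "(k\<^sub>1 + real w - 1) gchoose (w - j) = pochhammer k\<^sub>1 w / (fact (w - j) * pochhammer k\<^sub>1 j)"
    using g[of j k\<^sub>1] j p(1)[of j] by (simp add: field_simps)
  have 2: "(k\<^sub>2 + real w - 1) gchoose j = pochhammer k\<^sub>2 w / (fact j * pochhammer k\<^sub>2 (w - j))"
    using g[of "w - j" k\<^sub>2] j p(2)[of "w - j"] by (simp add: field_simps)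
  show "(- 1) ^ j * of_real ((k\<^sub>1 + real w - 1) gchoose (w - j)) *
        of_real ((k\<^sub>2 + real w - 1) gchoose j) * X j * Y (w - j) =
      of_real (pochhammer k\<^sub>1 w * pochhammer k\<^sub>2 w) *
        (fps_nth (ck_fps k\<^sub>1 (\<lambda>j. (- 1) ^ j * X j)) j * fps_nth (ck_fps k\<^sub>2 Y) (w - j))"
    unfolding 1 2 ck_fps_def by (simp add: field_simps)
qed

text \<open>Cohen--Kuznetsov: the two exponential factors cancel in the product.\<close>

lemma rc_sum_slash:
  fixes X Y x y :: "nat \<Rightarrow> complex"
  assumes k: "k\<^sub>1 > 0" "k\<^sub>2 > 0"
    and X: "\<And>n. X n = e\<^sub>1 * J ^ (2 * n) * (\<Sum>j\<le>n. slash_coeff (of_real k\<^sub>1) n j * \<rho> ^ (n - j) * x j)"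
    and Y: "\<And>n. Y n = e\<^sub>2 * J ^ (2 * n) * (\<Sum>j\<le>n. slash_coeff (of_real k\<^sub>2) n j * \<rho> ^ (n - j) * y j)"
  shows "rc_sum k\<^sub>1 k\<^sub>2 w X Y = e\<^sub>1 * e\<^sub>2 * J ^ (2 * w) * rc_sum k\<^sub>1 k\<^sub>2 w x y"
proof -
  have main: "Z n / (fact n * of_real (pochhammer \<kappa> n)) =
      e * J ^ (2 * n) * (\<Sum>j\<le>n. (\<rho> ^ (n - j) / fact (n - j)) * (z j / (fact j * of_real (pochhammer \<kappa> j))))"
    if \<kappa>: "\<kappa> > 0" and Z: "\<And>n. Z n = e * J ^ (2 * n) * (\<Sum>j\<le>n. slash_coeff (of_real \<kappa>) n j * \<rho> ^ (n - j) * z j)"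
    for Z z :: "nat \<Rightarrow> complex" and e n and \<kappa> :: real
  proof -
    have p: "of_real (pochhammer \<kappa> i) \<noteq> (0 :: complex)" for i
      using pochhammer_pos[OF \<kappa>, of i] by simp
    have K: "slash_coeff (of_real \<kappa>) n j / (fact n * of_real (pochhammer \<kappa> n)) =
        1 / (fact (n - j) * (fact j * of_real (pochhammer \<kappa> j)))" if "j \<le> n" for j
      using slash_coeff_closed[OF that, of "of_real \<kappa>"] p[of n] p[of j]
      by (simp add: pochhammer_of_real[symmetric] field_simps)
    have "(\<Sum>j\<le>n. slash_coeff (of_real \<kappa>) n j * \<rho> ^ (n - j) * z j) / (fact n * of_real (pochhammer \<kappa> n)) =
      (\<Sum>j\<le>n. (slash_coeff (of_real \<kappa>) n j / (fact n * of_real (pochhammer \<kappa> n))) * (\<rho> ^ (n - j) * z j))"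
      by (simp add: sum_divide_distrib mult.assoc)
    also have "\<dots> = (\<Sum>j\<le>n. (\<rho> ^ (n - j) / fact (n - j)) * (z j / (fact j * of_real (pochhammer \<kappa> j))))"
      by (intro sum.cong refl) (use K in simp)
    finally show ?thesis unfolding Z by (simp add: times_divide_eq_right[symmetric] del: times_divide_eq_right)
  qed
  have GY: "fps_nth (ck_fps k\<^sub>2 Y) n = e\<^sub>2 * J ^ (2 * n) * fps_nth (fps_exp \<rho> * ck_fps k\<^sub>2 y) n" for n
  proof -
    have "fps_nth (ck_fps k\<^sub>2 Y) n = Y n / (fact n * of_real (pochhammer k\<^sub>2 n))"
      by (simp add: ck_fps_def)
    also note main[OF k(2) Y, of n]
    also have "(\<Sum>j\<le>n. (\<rho> ^ (n - j) / fact (n - j)) * (y j / (fact j * of_real (pochhammer k\<^sub>2 j)))) =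
        fps_nth (ck_fps k\<^sub>2 y * fps_exp \<rho>) n"
      unfolding fps_mult_nth atLeast0AtMost by (intro sum.cong refl) (simp add: ck_fps_def mult_ac)
    finally show ?thesis by (simp add: mult.commute)
  qed
  \<comment> \<open>The alternating signs of the bracket, attached to the first factor, replace
    \<open>\<rho>\<close> by \<open>- \<rho>\<close> in its exponential.\<close>
  have GX: "fps_nth (ck_fps k\<^sub>1 (\<lambda>j. (- 1) ^ j * X j)) n =
      e\<^sub>1 * J ^ (2 * n) * fps_nth (fps_exp (- \<rho>) * ck_fps k\<^sub>1 (\<lambda>j. (- 1) ^ j * x j)) n" for n
  proof -
    have "fps_nth (ck_fps k\<^sub>1 (\<lambda>j. (- 1) ^ j * X j)) n = (- 1) ^ n * (X n / (fact n * of_real (pochhammer k\<^sub>1 n)))"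
      by (simp add: ck_fps_def)
    also have "\<dots> = e\<^sub>1 * J ^ (2 * n) * (\<Sum>j\<le>n. (- 1) ^ n * ((\<rho> ^ (n - j) / fact (n - j)) * (x j / (fact j * of_real (pochhammer k\<^sub>1 j)))))"
      unfolding main[OF k(1) X, of n] sum_distrib_left[symmetric] by (simp add: algebra_simps)
    also have "(\<Sum>j\<le>n. (- 1) ^ n * ((\<rho> ^ (n - j) / fact (n - j)) * (x j / (fact j * of_real (pochhammer k\<^sub>1 j))))) =
        (\<Sum>j\<le>n. ((- 1) ^ j * x j / (fact j * of_real (pochhammer k\<^sub>1 j))) * ((- \<rho>) ^ (n - j) / fact (n - j)))"
    proof (intro sum.cong refl)
      fix j assume "j \<in> {..n}"
      hence "(- 1 :: complex) ^ n = (- 1) ^ j * (- 1) ^ (n - j)" by (simp flip: power_add)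
      moreover have "(- \<rho>) ^ (n - j) = (- 1) ^ (n - j) * \<rho> ^ (n - j)" by (rule power_minus)
      ultimately show "(- 1) ^ n * ((\<rho> ^ (n - j) / fact (n - j)) * (x j / (fact j * of_real (pochhammer k\<^sub>1 j)))) =
        ((- 1) ^ j * x j / (fact j * of_real (pochhammer k\<^sub>1 j))) * ((- \<rho>) ^ (n - j) / fact (n - j))"
        by (simp add: mult_ac)
    qed
    also have "\<dots> = fps_nth (ck_fps k\<^sub>1 (\<lambda>j. (- 1) ^ j * x j) * fps_exp (- \<rho>)) n"
      by (simp add: ck_fps_def fps_mult_nth atLeast0AtMost)
    finally show ?thesis by (simp add: mult.commute)
  qed
  have "fps_nth (ck_fps k\<^sub>1 (\<lambda>j. (- 1) ^ j * X j) * ck_fps k\<^sub>2 Y) w =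
      e\<^sub>1 * e\<^sub>2 * J ^ (2 * w) * fps_nth ((fps_exp (- \<rho>) * ck_fps k\<^sub>1 (\<lambda>j. (- 1) ^ j * x j)) * (fps_exp \<rho> * ck_fps k\<^sub>2 y)) w"
    unfolding fps_mult_nth[of "ck_fps k\<^sub>1 (\<lambda>j. (- 1) ^ j * X j)"]
      fps_mult_nth[of "fps_exp (- \<rho>) * ck_fps k\<^sub>1 (\<lambda>j. (- 1) ^ j * x j)"] sum_distrib_left GX GY
  proof (intro sum.cong refl)
    fix i assume "i \<in> {0..w}"
    hence "2 * w = 2 * i + 2 * (w - i)" by simp
    hence "J ^ (2 * w) = J ^ (2 * i) * J ^ (2 * (w - i))" by (metis power_add)
    thus "e\<^sub>1 * J ^ (2 * i) * u * (e\<^sub>2 * J ^ (2 * (w - i)) * v) = e\<^sub>1 * e\<^sub>2 * J ^ (2 * w) * (u * v)" for u v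
      by simp
  qed
  also have "(fps_exp (- \<rho>) * ck_fps k\<^sub>1 (\<lambda>j. (- 1) ^ j * x j)) * (fps_exp \<rho> * ck_fps k\<^sub>2 y) =
      (fps_exp (- \<rho>) * fps_exp \<rho>) * (ck_fps k\<^sub>1 (\<lambda>j. (- 1) ^ j * x j) * ck_fps k\<^sub>2 y)"
    by (simp add: mult_ac)
  also have "fps_exp (- \<rho>) * fps_exp \<rho> = (1 :: complex fps)"
    by (simp flip: fps_exp_add_mult)
  finally show ?thesis unfolding rc_sum_eq_fps[OF k] by simp
qed

lemma rankin_cohen_eq_rc_sum:
  "rankin_cohen k\<^sub>1 k\<^sub>2 w F G z = inverse ((2 * of_real pi * \<i>) ^ w) *
     rc_sum k\<^sub>1 k\<^sub>2 w (\<lambda>j. (deriv ^^ j) F z) (\<lambda>j. (deriv ^^ j) G z)"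
  by (simp add: rankin_cohen_def rc_sum_def)

theorem rankin_cohen_covariant:
  fixes F F1 G G1 e\<^sub>1 e\<^sub>2 :: "complex \<Rightarrow> complex" and a b c d :: int
  assumes k: "k\<^sub>1 > 0" "k\<^sub>2 > 0"
    and hol: "F holomorphic_on uhp" "F1 holomorphic_on uhp" "G holomorphic_on uhp" "G1 holomorphic_on uhp"
    and det: "a * d - b * c = 1"
    and e: "\<And>z. Im z > 0 \<Longrightarrow> (e\<^sub>1 has_field_derivative of_real k\<^sub>1 * (of_int c / (of_int c * z + of_int d)) * e\<^sub>1 z) (at z)"
      "\<And>z. Im z > 0 \<Longrightarrow> (e\<^sub>2 has_field_derivative of_real k\<^sub>2 * (of_int c / (of_int c * z + of_int d)) * e\<^sub>2 z) (at z)"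
    and eq: "\<And>z. Im z > 0 \<Longrightarrow> F (int_moebius a b c d z) = e\<^sub>1 z * F1 z"
      "\<And>z. Im z > 0 \<Longrightarrow> G (int_moebius a b c d z) = e\<^sub>2 z * G1 z"
    and z: "Im z > 0"
  shows "rankin_cohen k\<^sub>1 k\<^sub>2 w F G (int_moebius a b c d z) =
           e\<^sub>1 z * e\<^sub>2 z * (of_int c * z + of_int d) ^ (2 * w) * rankin_cohen k\<^sub>1 k\<^sub>2 w F1 G1 z"
  unfolding rankin_cohen_eq_rc_sum
  by (subst rc_sum_slash[OF k higher_deriv_slash[OF hol(1,2) det e(1) eq(1) z] higher_deriv_slash[OF hol(3,4) det e(2) eq(2) z]])
     simp_all

text \<open>Cauchy's estimate on the disc of radius \<open>Im z / 2\<close>: it stays in the region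
  where \<open>F\<close> is bounded, and its radius tends to infinity.\<close>

lemma higher_deriv_tendsto_0:
  assumes F: "F holomorphic_on uhp" and B: "Bfun F (filtercomap Im at_top)" and n: "n > 0"
  shows "((deriv ^^ n) F \<longlongrightarrow> 0) (filtercomap Im at_top)"
proof -
  obtain K where K: "K > 0" "eventually (\<lambda>z. norm (F z) \<le> K) (filtercomap Im at_top)"
    using B by (auto simp: Bfun_def)
  then obtain Y where Y: "\<And>z. Im z \<ge> Y \<Longrightarrow> norm (F z) \<le> K"
    by (auto simp: eventually_filtercomap_at_top_linorder)
  have bd: "norm ((deriv ^^ n) F z) \<le> fact n * K / (Im z / 2) ^ n" if z: "Im z \<ge> max 1 (2 * Y)" for z
  proof (rule Cauchy_inequality)
    have sub: "cball z (Im z / 2) \<subseteq> uhp"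
    proof
      fix x assume "x \<in> cball z (Im z / 2)"
      hence "\<bar>Im z - Im x\<bar> \<le> Im z / 2"
        using abs_Im_le_cmod[of "z - x"] by (simp add: dist_norm)
      moreover have "Im z \<ge> 1" using z by simp
      ultimately have "Im x > 0" by linarith
      thus "x \<in> uhp" by simp
    qed
    show "F holomorphic_on ball z (Im z / 2)"
      using F sub ball_subset_cball by (blast intro: holomorphic_on_subset)
    show "continuous_on (cball z (Im z / 2)) F"
      using F sub by (blast intro: holomorphic_on_imp_continuous_on holomorphic_on_subset)
    show "0 < Im z / 2" using z by simp
    show "norm (F x) \<le> K" if "norm (z - x) = Im z / 2" for x
    proof (rule Y)
      have "\<bar>Im z - Im x\<bar> \<le> Im z / 2" using abs_Im_le_cmod[of "z - x"] that by simp
      thus "Im x \<ge> Y" using z by linarith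
    qed
  qed
  have lim: "((\<lambda>y. fact n * K / (y / 2) ^ n) \<longlongrightarrow> 0) at_top"
    using n by real_asymp
  show ?thesis
  proof (rule Lim_null_comparison)
    show "eventually (\<lambda>z. norm ((deriv ^^ n) F z) \<le> fact n * K / (Im z / 2) ^ n) (filtercomap Im at_top)"
      unfolding eventually_filtercomap_at_top_linorder using bd by blast
    show "((\<lambda>z. fact n * K / (Im z / 2) ^ n) \<longlongrightarrow> 0) (filtercomap Im at_top)"
      by (rule filterlim_compose[OF lim filterlim_filtercomap])
  qed
qed

lemma tendsto_0_mult_Bfun:
  fixes f g :: "'a \<Rightarrow> 'b :: real_normed_algebra"
  assumes "(f \<longlongrightarrow> 0) F" "Bfun g F"
  shows "((\<lambda>x. f x * g x) \<longlongrightarrow> 0) F"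
  using assms bounded_bilinear.Zfun_prod_Bfun[OF bounded_bilinear_mult]
  by (simp add: tendsto_Zfun_iff)

text \<open>In the term \<open>j = 0\<close> all \<open>w\<close> derivatives fall on
  \<open>G\<close>, in the others at least one falls on \<open>F\<close>. Decay of \<open>F\<close>
  itself is thus needed for \<open>w = 0\<close> only.\<close>

lemma rankin_cohen_tendsto_0:
  assumes F: "F holomorphic_on uhp" "Bfun F (filtercomap Im at_top)"
    and G: "G holomorphic_on uhp" "Bfun G (filtercomap Im at_top)"
    and w: "w > 0 \<or> (F \<longlongrightarrow> 0) (filtercomap Im at_top)"
  shows "(rankin_cohen k\<^sub>1 k\<^sub>2 w F G \<longlongrightarrow> 0) (filtercomap Im at_top)"
proof -
  have Bd: "Bfun ((deriv ^^ j) H) (filtercomap Im at_top)"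
    if "H holomorphic_on uhp" "Bfun H (filtercomap Im at_top)" for H :: "complex \<Rightarrow> complex" and j
  proof (cases "j = 0")
    case False
    hence "((deriv ^^ j) H \<longlongrightarrow> 0) (filtercomap Im at_top)" using higher_deriv_tendsto_0 that by blast
    from tendstoD[OF this, of 1] have "eventually (\<lambda>z. norm ((deriv ^^ j) H z) \<le> 1) (filtercomap Im at_top)"
      by (rule eventually_mono) simp_all
    thus ?thesis by (rule BfunI)
  qed (use that in simp)
  have "((\<lambda>z. (deriv ^^ j) F z * (deriv ^^ (w - j)) G z) \<longlongrightarrow> 0) (filtercomap Im at_top)" if "j \<le> w" for j
  proof (cases "j = 0 \<and> w > 0")
    case True
    hence "((deriv ^^ (w - j)) G \<longlongrightarrow> 0) (filtercomap Im at_top)" using higher_deriv_tendsto_0[OF G] by simp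
    from tendsto_0_mult_Bfun[OF this Bd[OF F, of j]] show ?thesis by (simp add: mult.commute)
  next
    case False
    hence "((deriv ^^ j) F \<longlongrightarrow> 0) (filtercomap Im at_top)"
      using higher_deriv_tendsto_0[OF F, of j] w that by (cases "j = 0") auto
    from tendsto_0_mult_Bfun[OF this Bd[OF G]] show ?thesis .
  qed
  hence "((\<lambda>z. inverse ((2 * of_real pi * \<i>) ^ w) *
     (\<Sum>j\<le>w. (- 1) ^ j * of_real ((k\<^sub>1 + real w - 1) gchoose (w - j)) *
        of_real ((k\<^sub>2 + real w - 1) gchoose j) * ((deriv ^^ j) F z * (deriv ^^ (w - j)) G z))) \<longlongrightarrow> 0) (filtercomap Im at_top)"
    by (intro tendsto_mult_right_zero tendsto_null_sum) auto
  thus ?thesis unfolding rankin_cohen_def by (simp add: mult.assoc)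
qed
subsection \<open>The polynomials of the two brackets\<close>

text \<open>The upper entry \<open>w - 1/2\<close> belongs to weight 1/2. The identity is a form of
  the duplication formula, and \<open>4 ^ j\<close> is the factor that the argument
  \<open>4 * (u * v)\<close> supplies in \<open>rc_poly_identity\<close>.\<close>

lemma gbinomial_half_closed:
  "j \<le> w \<Longrightarrow> 4 ^ j * ((real w - 1/2) gchoose j) * (fact w * fact j * fact (2 * (w - j))) =
     fact (2 * w) * fact (w - j)"
proof (induction j)
  case (Suc j)
  define n where "n = w - Suc j"
  have n: "w - j = Suc n" "w - Suc j = n" using Suc.prems by (simp_all add: n_def)
  have wn: "real w = real n + real j + 1" using Suc.prems by (simp add: n_def of_nat_diff)
  define g where "g = (real w - 1/2) gchoose j"
  have IH: "4 ^ j * g * (fact w * fact j * fact (2 * Suc n)) = fact (2 * w) * fact (Suc n)"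
    using Suc.IH Suc.prems by (simp add: n(1) g_def)
  have rec: "real (Suc j) * ((real w - 1/2) gchoose Suc j) = (real n + 1/2) * g"
    using gbinomial_mult_1[of "real w - 1/2" j] wn unfolding g_def by (simp add: algebra_simps)
  have f2: "(fact (2 * Suc n) :: real) = real (2 * n + 2) * (real (2 * n + 1) * fact (2 * n))"
    by (simp add: algebra_simps)
  have "real (Suc n) * (4 ^ Suc j * ((real w - 1/2) gchoose Suc j) * (fact w * fact (Suc j) * fact (2 * n))) =
      real (Suc n) * (4 * 4 ^ j * (real (Suc j) * ((real w - 1/2) gchoose Suc j)) * (fact w * fact j * fact (2 * n)))"
    by (simp add: algebra_simps)
  also have "\<dots> = 4 ^ j * g * (fact w * fact j * (real (2 * n + 2) * (real (2 * n + 1) * fact (2 * n))))"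
    unfolding rec by (simp add: algebra_simps)
  also have "\<dots> = fact (2 * w) * fact (Suc n)" using IH unfolding f2 .
  also have "\<dots> = real (Suc n) * (fact (2 * w) * fact n)" by (simp add: algebra_simps)
  finally have "real (Suc n) * (4 ^ Suc j * ((real w - 1/2) gchoose Suc j) * (fact w * fact (Suc j) * fact (2 * n))) =
    real (Suc n) * (fact (2 * w) * fact n)" .
  hence "4 ^ Suc j * ((real w - 1/2) gchoose Suc j) * (fact w * fact (Suc j) * fact (2 * n)) = fact (2 * w) * fact n"
    by (subst (asm) mult_left_cancel) auto
  thus ?case unfolding n(2) .
qed simp

text \<open>Vandermonde's convolution, divided by the factorials that do not depend on
  \<open>j\<close>.\<close>

lemma vandermonde_factorials:
  assumes "k > 0"
  shows "(\<Sum>j\<le>min m n. 1 / (fact j * fact (m - j) * fact (n - j) * fact (k + j - 1) :: real)) =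
           real ((k + m + n - 1) choose n) / (fact m * fact (k + n - 1))"
proof -
  have "(k + m + n - 1) choose n = (\<Sum>j\<le>n. (m choose j) * ((k + n - 1) choose (n - j)))"
    using vandermonde[of m "k + n - 1" n] assms by (simp add: add_ac)
  also have "\<dots> = (\<Sum>j\<le>min m n. (m choose j) * ((k + n - 1) choose (n - j)))"
    by (rule sum.mono_neutral_right) (auto simp: binomial_eq_0)
  finally have "real ((k + m + n - 1) choose n) / (fact m * fact (k + n - 1)) =
      (\<Sum>j\<le>min m n. real (m choose j) * real ((k + n - 1) choose (n - j)) / (fact m * fact (k + n - 1)))"
    by (simp add: sum_divide_distrib)
  also have "\<dots> = (\<Sum>j\<le>min m n. 1 / (fact j * fact (m - j) * fact (n - j) * fact (k + j - 1)))"
  proof (intro sum.cong refl)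
    fix j assume "j \<in> {..min m n}"
    hence j: "j \<le> m" "j \<le> n" by auto
    have "k + n - 1 - (n - j) = k + j - 1" using j assms by simp
    hence 2: "real ((k + n - 1) choose (n - j)) = fact (k + n - 1) / (fact (n - j) * fact (k + j - 1))"
      using binomial_fact[of "n - j" "k + n - 1", where 'a = real] assms by simp
    show "real (m choose j) * real ((k + n - 1) choose (n - j)) / (fact m * fact (k + n - 1)) =
        1 / (fact j * fact (m - j) * fact (n - j) * fact (k + j - 1))"
      unfolding binomial_fact[OF j(1), where 'a = real] 2 by simp
  qed
  finally show ?thesis ..
qed

text \<open>The conditional coefficient makes the range of \<open>m\<close> independent of
  \<open>j\<close>, so that the sums over \<open>j\<close> and \<open>m\<close> can be exchanged;
  \<open>j \<le> m\<close> also guards the truncated subtraction \<open>m - j\<close>.\<close>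

lemma uv_power_expand:
  fixes u v :: complex
  assumes "j \<le> w"
  shows "(u * v) ^ j * (u - v) ^ (2 * (w - j)) =
    (\<Sum>m\<le>2 * w. (if j \<le> m \<and> j \<le> 2 * w - m then (- 1) ^ (m + j) * of_nat ((2 * (w - j)) choose (m - j)) else 0) *
       (u ^ m * v ^ (2 * w - m)))"
proof -
  define N where "N = 2 * (w - j)"
  have wN: "2 * w = N + 2 * j" using assms by (simp add: N_def)
  have "(u - v) ^ N = (v - u) ^ N"
    using power_minus_even[of N "u - v"] by (simp add: N_def)
  also have "\<dots> = (- u + v) ^ N" by simp
  also have "\<dots> = (\<Sum>i\<le>N. of_nat (N choose i) * (- u) ^ i * v ^ (N - i))" by (rule binomial_ring)
  finally have "(u * v) ^ j * (u - v) ^ N = (\<Sum>i\<le>N. (u * v) ^ j * (of_nat (N choose i) * (- u) ^ i * v ^ (N - i)))"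
    by (simp add: sum_distrib_left)
  also have "\<dots> = (\<Sum>i\<le>N. (- 1) ^ i * of_nat (N choose i) * (u ^ (i + j) * v ^ (2 * w - (i + j))))"
  proof (intro sum.cong refl)
    fix i assume "i \<in> {..N}"
    hence "2 * w - (i + j) = j + (N - i)" using wN by simp
    thus "(u * v) ^ j * (of_nat (N choose i) * (- u) ^ i * v ^ (N - i)) =
        (- 1) ^ i * of_nat (N choose i) * (u ^ (i + j) * v ^ (2 * w - (i + j)))"
      by (simp add: power_add power_mult_distrib power_minus[of u] algebra_simps)
  qed
  also have "\<dots> = (\<Sum>m\<in>{j..N + j}. (- 1) ^ (m - j) * of_nat (N choose (m - j)) * (u ^ m * v ^ (2 * w - m)))"
    by (rule sum.reindex_bij_witness[of _ "\<lambda>m. m - j" "\<lambda>i. i + j"]) auto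
  also have "\<dots> = (\<Sum>m\<in>{j..N + j}. (if j \<le> m \<and> j \<le> 2 * w - m then (- 1) ^ (m + j) * of_nat (N choose (m - j)) else 0) *
       (u ^ m * v ^ (2 * w - m)))"
  proof (intro sum.cong refl)
    fix m assume "m \<in> {j..N + j}"
    hence m: "j \<le> m" "j \<le> 2 * w - m" using wN by auto
    have "m + j = (m - j) + 2 * j" using m by simp
    hence "(- 1 :: complex) ^ (m + j) = (- 1) ^ (m - j)" by (simp only: power_add power_mult) simp
    thus "(- 1) ^ (m - j) * of_nat (N choose (m - j)) * (u ^ m * v ^ (2 * w - m)) =
      (if j \<le> m \<and> j \<le> 2 * w - m then (- 1) ^ (m + j) * of_nat (N choose (m - j)) else 0) * (u ^ m * v ^ (2 * w - m))"
      using m by simp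
  qed
  also have "\<dots> = (\<Sum>m\<le>2 * w. (if j \<le> m \<and> j \<le> 2 * w - m then (- 1) ^ (m + j) * of_nat (N choose (m - j)) else 0) *
       (u ^ m * v ^ (2 * w - m)))"
    by (rule sum.mono_neutral_left) (auto simp: wN)
  finally show ?thesis unfolding N_def .
qed

text \<open>Compared at \<open>u ^ m * v ^ (2 * w - m)\<close>, the left side is a sum over
  \<open>j\<close> that Vandermonde evaluates to a product of two binomial coefficients, as on the
  right. The two outer binomial coefficients balance the remaining factorials.\<close>

lemma rc_poly_identity:
  assumes k: "k > 0"
  shows "of_nat ((k + 2 * w - 1) choose w) * rc_poly (real k) (1/2) w (4 * (u * v)) ((u - v)\<^sup>2) =
         of_nat ((2 * w) choose w) * rc_poly (real k) (real k) (2 * w) u v"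
proof -
  define L where "L m j = real ((k + w - 1) choose (w - j)) * ((real w - 1/2) gchoose j) * 4 ^ j *
     (if j \<le> m \<and> j \<le> 2 * w - m then real ((2 * (w - j)) choose (m - j)) else 0)" for m j
  have coeff: "real ((k + 2 * w - 1) choose w) * (\<Sum>j\<le>w. L m j) =
      real ((2 * w) choose w) * (real ((k + 2 * w - 1) choose (2 * w - m)) * real ((k + 2 * w - 1) choose m))"
    if m: "m \<le> 2 * w" for m
  proof -
    define n where "n = 2 * w - m"
    have mn: "m + n = 2 * w" using m by (simp add: n_def)
    have minw: "min m n \<le> w" using mn by simp
    have "(\<Sum>j\<le>w. L m j) = (\<Sum>j\<le>min m n. L m j)"
      by (rule sum.mono_neutral_right) (use minw in \<open>auto simp: L_def n_def\<close>)
    also have "\<dots> = (\<Sum>j\<le>min m n. fact (2 * w) * fact (k + w - 1) / fact w *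
        (1 / (fact j * fact (m - j) * fact (n - j) * fact (k + j - 1))))"
    proof (intro sum.cong refl)
      fix j assume "j \<in> {..min m n}"
      hence j: "j \<le> m" "j \<le> n" "j \<le> w" using minw by auto
      have "k + w - 1 - (w - j) = k + j - 1" using j by simp
      hence 1: "real ((k + w - 1) choose (w - j)) = fact (k + w - 1) / (fact (w - j) * fact (k + j - 1))"
        using binomial_fact[of "w - j" "k + w - 1", where 'a = real] k by simp
      have "2 * (w - j) - (m - j) = n - j" using j mn by simp
      hence 2: "real ((2 * (w - j)) choose (m - j)) = fact (2 * (w - j)) / (fact (m - j) * fact (n - j))"
        using binomial_fact[of "m - j" "2 * (w - j)", where 'a = real] j mn by simp
      have 3: "((real w - 1/2) gchoose j) * 4 ^ j = fact (2 * w) * fact (w - j) / (fact w * fact j * fact (2 * (w - j)))"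
        using gbinomial_half_closed[OF j(3)] by (simp add: field_simps)
      have "L m j = real ((k + w - 1) choose (w - j)) * (((real w - 1/2) gchoose j) * 4 ^ j) * real ((2 * (w - j)) choose (m - j))"
        using j by (simp add: L_def n_def)
      thus "L m j = fact (2 * w) * fact (k + w - 1) / fact w * (1 / (fact j * fact (m - j) * fact (n - j) * fact (k + j - 1)))"
        unfolding 1 2 3 by (simp add: field_simps)
    qed
    also have "\<dots> = fact (2 * w) * fact (k + w - 1) / fact w * (real ((k + m + n - 1) choose n) / (fact m * fact (k + n - 1)))"
      unfolding sum_distrib_left[symmetric] vandermonde_factorials[OF k] ..
    finally have S: "(\<Sum>j\<le>w. L m j) = \<dots>" .
    have kmn: "k + m + n - 1 = k + 2 * w - 1" using mn by simp
    have "k + 2 * w - 1 - m = k + n - 1" using mn k by simp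
    hence b1: "real ((k + 2 * w - 1) choose m) = fact (k + 2 * w - 1) / (fact m * fact (k + n - 1))"
      using binomial_fact[of m "k + 2 * w - 1", where 'a = real] mn k by simp
    have "k + 2 * w - 1 - w = k + w - 1" by simp
    hence b2: "real ((k + 2 * w - 1) choose w) = fact (k + 2 * w - 1) / (fact w * fact (k + w - 1))"
      using binomial_fact[of w "k + 2 * w - 1", where 'a = real] k by simp
    have "2 * w - w = w" by simp
    hence b3: "real ((2 * w) choose w) = fact (2 * w) / (fact w * fact w)"
      using binomial_fact[of w "2 * w", where 'a = real] by simp
    show ?thesis unfolding S kmn b1 b2 b3 n_def[symmetric] by (simp add: field_simps)
  qed
  have gk: "of_real ((real k + real n - 1) gchoose i) = (of_nat ((k + n - 1) choose i) :: complex)" for n i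
  proof -
    have "real k + real n - 1 = real (k + n - 1)" using k by (simp add: of_nat_diff)
    thus ?thesis by (simp only: binomial_gbinomial[symmetric] of_real_of_nat_eq)
  qed
  have "rc_poly (real k) (1/2) w (4 * (u * v)) ((u - v)\<^sup>2) =
      (\<Sum>j\<le>w. (- 1) ^ j * of_nat ((k + w - 1) choose (w - j)) * of_real ((real w - 1/2) gchoose j) * 4 ^ j *
        ((u * v) ^ j * (u - v) ^ (2 * (w - j))))"
    unfolding rc_poly_def gk
  proof (intro sum.cong refl)
    fix j
    have "1/2 + real w - 1 = real w - 1/2" by simp
    moreover have "(4 * (u * v)) ^ j * ((u - v)\<^sup>2) ^ (w - j) = 4 ^ j * ((u * v) ^ j * (u - v) ^ (2 * (w - j)))"
      by (simp only: power_mult_distrib power_mult[symmetric] mult.assoc)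
    ultimately show "(- 1) ^ j * of_nat ((k + w - 1) choose (w - j)) * of_real ((1/2 + real w - 1) gchoose j) *
        (4 * (u * v)) ^ j * ((u - v)\<^sup>2) ^ (w - j) =
      (- 1) ^ j * of_nat ((k + w - 1) choose (w - j)) * of_real ((real w - 1/2) gchoose j) * 4 ^ j *
        ((u * v) ^ j * (u - v) ^ (2 * (w - j)))" by (metis mult.assoc)
  qed
  also have "\<dots> = (\<Sum>j\<le>w. \<Sum>m\<le>2 * w. (- 1) ^ m * of_real (L m j) * (u ^ m * v ^ (2 * w - m)))"
  proof (intro sum.cong refl)
    fix j assume "j \<in> {..w}"
    hence j: "j \<le> w" by simp
    show "(- 1) ^ j * of_nat ((k + w - 1) choose (w - j)) * of_real ((real w - 1/2) gchoose j) * 4 ^ j *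
        ((u * v) ^ j * (u - v) ^ (2 * (w - j))) = (\<Sum>m\<le>2 * w. (- 1) ^ m * of_real (L m j) * (u ^ m * v ^ (2 * w - m)))"
      unfolding uv_power_expand[OF j] sum_distrib_left
    proof (intro sum.cong refl)
      fix m
      have "(- 1 :: complex) ^ j * (- 1) ^ (m + j) = (- 1) ^ m"
        by (simp flip: power_add) (simp add: power_add mult.assoc flip: power_mult_distrib)
      note sgn = this
      have "a * X * Y * Z * ((b * W) * V) = (a * b) * (X * Y * Z * W) * V" for a b X Y Z W V :: complex
        by (simp only: mult_ac)
      from this[of "(- 1) ^ j" _ _ _ "(- 1) ^ (m + j)"]
      have s: "(- 1 :: complex) ^ j * X * Y * Z * (((- 1) ^ (m + j) * W) * V) = (- 1) ^ m * (X * Y * Z * W) * V" for X Y Z W V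
        unfolding sgn .
      show "(- 1) ^ j * of_nat ((k + w - 1) choose (w - j)) * of_real ((real w - 1/2) gchoose j) * 4 ^ j *
          ((if j \<le> m \<and> j \<le> 2 * w - m then (- 1) ^ (m + j) * of_nat ((2 * (w - j)) choose (m - j)) else 0) * (u ^ m * v ^ (2 * w - m))) =
        (- 1) ^ m * of_real (L m j) * (u ^ m * v ^ (2 * w - m))"
      proof (cases "j \<le> m \<and> j \<le> 2 * w - m")
        case True
        have "complex_of_real (L m j) = of_nat ((k + w - 1) choose (w - j)) * of_real ((real w - 1/2) gchoose j) * 4 ^ j *
            of_nat ((2 * (w - j)) choose (m - j))"
          unfolding L_def if_P[OF True] by simp
        thus ?thesis unfolding if_P[OF True] s by (simp only:)
      next
        case False
        thus ?thesis unfolding L_def if_not_P[OF False] by simp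
      qed
    qed
  qed
  also have "\<dots> = (\<Sum>m\<le>2 * w. (- 1) ^ m * of_real (\<Sum>j\<le>w. L m j) * (u ^ m * v ^ (2 * w - m)))"
    by (subst sum.swap) (simp add: sum_distrib_left sum_distrib_right)
  finally have lhs: "rc_poly (real k) (1/2) w (4 * (u * v)) ((u - v)\<^sup>2) =
      (\<Sum>m\<le>2 * w. (- 1) ^ m * of_real (\<Sum>j\<le>w. L m j) * (u ^ m * v ^ (2 * w - m)))" .
  have "of_nat ((k + 2 * w - 1) choose w) * rc_poly (real k) (1/2) w (4 * (u * v)) ((u - v)\<^sup>2) =
      (\<Sum>m\<le>2 * w. (- 1) ^ m * of_real (real ((k + 2 * w - 1) choose w) * (\<Sum>j\<le>w. L m j)) * (u ^ m * v ^ (2 * w - m)))"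
    unfolding lhs sum_distrib_left[of _ _ "{..2 * w}"]
    by (intro sum.cong refl) (simp only: of_real_mult of_real_of_nat_eq mult_ac)
  also have "\<dots> = (\<Sum>m\<le>2 * w. of_nat ((2 * w) choose w) * ((- 1) ^ m * of_nat ((k + 2 * w - 1) choose (2 * w - m)) *
       of_nat ((k + 2 * w - 1) choose m) * u ^ m * v ^ (2 * w - m)))"
  proof (intro sum.cong refl)
    fix m assume "m \<in> {..2 * w}"
    hence "m \<le> 2 * w" by simp
    show "(- 1) ^ m * of_real (real ((k + 2 * w - 1) choose w) * (\<Sum>j\<le>w. L m j)) * (u ^ m * v ^ (2 * w - m)) =
      of_nat ((2 * w) choose w) * ((- 1) ^ m * of_nat ((k + 2 * w - 1) choose (2 * w - m)) *
       of_nat ((k + 2 * w - 1) choose m) * u ^ m * v ^ (2 * w - m))"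
      unfolding coeff[OF \<open>m \<le> 2 * w\<close>] by simp
  qed
  also have "\<dots> = of_nat ((2 * w) choose w) * rc_poly (real k) (real k) (2 * w) u v"
    unfolding rc_poly_def gk sum_distrib_left ..
  finally show ?thesis .
qed

lemma rc_poly_homogeneous:
  "rc_poly k\<^sub>1 k\<^sub>2 w (c * x) (c * y) = c ^ w * rc_poly k\<^sub>1 k\<^sub>2 w x y"
  unfolding rc_poly_def sum_distrib_left
proof (intro sum.cong refl)
  fix j assume "j \<in> {..w}"
  hence "c ^ w = c ^ j * c ^ (w - j)" by (simp flip: power_add)
  thus "(- 1) ^ j * of_real ((k\<^sub>1 + real w - 1) gchoose (w - j)) * of_real ((k\<^sub>2 + real w - 1) gchoose j) *
      (c * x) ^ j * (c * y) ^ (w - j) =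
    c ^ w * ((- 1) ^ j * of_real ((k\<^sub>1 + real w - 1) gchoose (w - j)) * of_real ((k\<^sub>2 + real w - 1) gchoose j) *
      x ^ j * y ^ (w - j))"
    by (simp add: power_mult_distrib)
qed

lemma rc_poly_0_0: "w > 0 \<Longrightarrow> rc_poly k\<^sub>1 k\<^sub>2 w 0 0 = 0"
  using rc_poly_homogeneous[of k\<^sub>1 k\<^sub>2 w 0 0 0] by (simp add: power_0_left)

lemma rc_poly_0: "rc_poly k\<^sub>1 k\<^sub>2 0 x y = 1"
  by (simp add: rc_poly_def)

subsection \<open>Euler factors\<close>

text \<open>For completely multiplicative \<open>\<psi>\<close> and \<open>n > 0\<close>: the
  coefficient of the Dirichlet series of \<open>E\<close> times the L-series of
  \<open>\<psi>\<close> without its Euler factors at \<open>S\<close>.\<close>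

definition sieved :: "nat set \<Rightarrow> (nat \<Rightarrow> complex) \<Rightarrow> (nat \<Rightarrow> complex) \<Rightarrow> nat \<Rightarrow> complex" where
  "sieved S \<psi> E n = (\<Sum>g | g dvd n \<and> (\<forall>q\<in>S. \<not> q dvd g). \<psi> g * E (n div g))"

text \<open>The admissible \<open>g\<close> divisible by \<open>p\<close> are \<open>p * h\<close>
  with \<open>h\<close> an admissible divisor of \<open>n div p\<close>, and \<open>\<psi> p\<close>
  factors out. If \<open>p\<close> lies in \<open>S\<close> already there are no such
  \<open>g\<close>; the identity survives when \<open>\<psi> p = 0\<close> kills the subtracted
  term, which is the case needed for the extra prime 2.\<close>

lemma sieved_insert:
  assumes n: "n > 0" and p: "prime p" and S: "\<And>q. q \<in> S \<Longrightarrow> prime q"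
    and mult: "\<And>m n. \<psi> (m * n) = \<psi> m * \<psi> n" and pS: "p \<notin> S \<or> \<psi> p = 0"
  shows "sieved (insert p S) \<psi> E n =
    sieved S \<psi> E n - \<psi> p * (if p dvd n then sieved S \<psi> E (n div p) else 0)"
proof -
  define A where "A = {g. g dvd n \<and> (\<forall>q\<in>S. \<not> q dvd g)}"
  have fin: "finite A" unfolding A_def using n by (auto intro: finite_subset[OF _ finite_divisors_nat[of n]])
  have "sieved S \<psi> E n = (\<Sum>g\<in>A. \<psi> g * E (n div g))" by (simp add: sieved_def A_def)
  also have "A = {g\<in>A. \<not> p dvd g} \<union> {g\<in>A. p dvd g}" by auto
  also have "(\<Sum>g\<in>{g\<in>A. \<not> p dvd g} \<union> {g\<in>A. p dvd g}. \<psi> g * E (n div g)) =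
      (\<Sum>g\<in>{g\<in>A. \<not> p dvd g}. \<psi> g * E (n div g)) + (\<Sum>g\<in>{g\<in>A. p dvd g}. \<psi> g * E (n div g))"
    by (rule sum.union_disjoint) (use fin in auto)
  also have "(\<Sum>g\<in>{g\<in>A. \<not> p dvd g}. \<psi> g * E (n div g)) = sieved (insert p S) \<psi> E n"
    unfolding sieved_def A_def by (intro sum.cong) auto
  also have "(\<Sum>g\<in>{g\<in>A. p dvd g}. \<psi> g * E (n div g)) = \<psi> p * (if p dvd n then sieved S \<psi> E (n div p) else 0)"
  proof (cases "p dvd n \<and> \<psi> p \<noteq> 0")
    case False
    have "\<psi> g * E (n div g) = 0" if "g \<in> {g\<in>A. p dvd g}" for g
    proof -
      have "p dvd n" using that by (auto simp: A_def intro: dvd_trans)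
      hence "\<psi> p = 0" using False by simp
      moreover obtain h where "g = p * h" using \<open>g \<in> {g\<in>A. p dvd g}\<close> by blast
      ultimately show ?thesis using mult by simp
    qed
    hence "(\<Sum>g\<in>{g\<in>A. p dvd g}. \<psi> g * E (n div g)) = 0" by (intro sum.neutral) blast
    moreover have "\<psi> p * (if p dvd n then sieved S \<psi> E (n div p) else 0) = 0" using False by auto
    ultimately show ?thesis by (simp only:)
  next
    case True
    then obtain m where m: "n = p * m" by (auto elim: dvdE)
    have p0: "p > 0" using p by (simp add: prime_gt_0_nat)
    have np: "p \<notin> S" using pS True by simp
    have eq: "(\<forall>q\<in>S. \<not> q dvd p * h) \<longleftrightarrow> (\<forall>q\<in>S. \<not> q dvd h)" for h
    proof -
      have "q dvd p * h \<longleftrightarrow> q dvd h" if "q \<in> S" for q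
      proof -
        have "prime q" "q \<noteq> p" using S that np by auto
        hence "\<not> q dvd p" using p by (metis primes_dvd_imp_eq)
        thus ?thesis using \<open>prime q\<close> by (simp add: prime_dvd_mult_iff)
      qed
      thus ?thesis by blast
    qed
    have "(\<Sum>g\<in>{g\<in>A. p dvd g}. \<psi> g * E (n div g)) =
        (\<Sum>h | h dvd m \<and> (\<forall>q\<in>S. \<not> q dvd h). \<psi> (p * h) * E (n div (p * h)))"
    proof (rule sum.reindex_bij_witness[of _ "\<lambda>h. p * h" "\<lambda>g. g div p"])
      fix g assume g: "g \<in> {g \<in> A. p dvd g}"
      then obtain h where h: "g = p * h" by (auto elim: dvdE)
      show "p * (g div p) = g" using h p0 by simp
      show "g div p \<in> {h. h dvd m \<and> (\<forall>q\<in>S. \<not> q dvd h)}"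
        using g h p0 eq[of h] by (auto simp: A_def m)
      show "\<psi> (p * (g div p)) * E (n div (p * (g div p))) = \<psi> g * E (n div g)" using h p0 by simp
    next
      fix h assume h: "h \<in> {h. h dvd m \<and> (\<forall>q\<in>S. \<not> q dvd h)}"
      show "p * h div p = h" using p0 by simp
      show "p * h \<in> {g \<in> A. p dvd g}" using h eq[of h] by (auto simp: A_def m)
    qed
    also have "\<dots> = \<psi> p * sieved S \<psi> E m"
      unfolding sieved_def sum_distrib_left using p0 by (intro sum.cong refl) (simp add: mult m)
    finally show ?thesis using True m p0 by simp
  qed
  finally show ?thesis by simp
qed

text \<open>The induction starts at an arbitrary \<open>S\<close> because the divisor brackets come
  sieved at the primes of \<open>r / d\<close>. The coefficient at 0 is kept apart, since every
  number divides 0 and \<open>sieved\<close> has no meaning there.\<close>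

lemma euler_op_list_expansion:
  assumes mult: "\<And>m n. \<psi> (m * n) = \<psi> m * \<psi> n"
  shows "distinct ps \<Longrightarrow> (\<And>p. p \<in> set ps \<Longrightarrow> prime p \<and> (p \<notin> S \<or> \<psi> p = 0)) \<Longrightarrow> (\<And>q. q \<in> S \<Longrightarrow> prime q) \<Longrightarrow>
    has_q_expansion F c \<Longrightarrow> c 0 = 0 \<Longrightarrow> (\<And>n. n > 0 \<Longrightarrow> c n = sieved S \<psi> E n) \<Longrightarrow>
    has_q_expansion (fold (\<lambda>p. op_IB 1 (- \<psi> p) p) ps F) (\<lambda>n. if n = 0 then 0 else sieved (S \<union> set ps) \<psi> E n)"
proof (induction ps arbitrary: S F c)
  case Nil
  thus ?case by (auto intro: has_q_expansion_cong)
next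
  case (Cons p ps)
  have p: "prime p" "p \<notin> S \<or> \<psi> p = 0" using Cons.prems(2)[of p] by auto
  hence p0: "p > 0" by (simp add: prime_gt_0_nat)
  define c' where "c' n = 1 * c n + - \<psi> p * (if p dvd n then c (n div p) else 0)" for n
  have "has_q_expansion (\<lambda>z. 1 * F z + - \<psi> p * F (of_nat p * z)) c'"
    unfolding c'_def
    by (intro has_q_expansion_add has_q_expansion_cmult has_q_expansion_dilate Cons.prems(4) p0)
  hence "has_q_expansion (op_IB 1 (- \<psi> p) p F) c'" unfolding op_IB_def .
  moreover have "c' 0 = 0" using Cons.prems(5) by (simp add: c'_def)
  moreover have "c' n = sieved (insert p S) \<psi> E n" if "n > 0" for n
  proof -
    have "n div p > 0" if "p dvd n" using \<open>n > 0\<close> that p0 by (simp add: div_greater_zero_iff dvd_imp_le)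
    thus ?thesis
      using sieved_insert[of n p S \<psi> E] that p Cons.prems(3,6) mult by (auto simp: c'_def)
  qed
  moreover have "prime q \<and> (q \<notin> insert p S \<or> \<psi> q = 0)" if "q \<in> set ps" for q
    using Cons.prems(1) Cons.prems(2)[of q] that by auto
  moreover have "prime q" if "q \<in> insert p S" for q using that p(1) Cons.prems(3) by auto
  ultimately have "has_q_expansion (fold (\<lambda>p. op_IB 1 (- \<psi> p) p) ps (op_IB 1 (- \<psi> p) p F))
      (\<lambda>n. if n = 0 then 0 else sieved (insert p S \<union> set ps) \<psi> E n)"
    using Cons.prems(1) by (intro Cons.IH[where c = c']) auto
  moreover have "insert p S \<union> set ps = S \<union> set (p # ps)" by auto
  ultimately show ?case by (simp only: fold_simps)
qed
subsection \<open>Behaviour at the cusps\<close>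

lemma Bfun_compose_filterlim:
  fixes g :: "'a \<Rightarrow> 'b :: real_normed_vector"
  assumes "Bfun g F'" "filterlim h F' F"
  shows "Bfun (\<lambda>x. g (h x)) F"
proof -
  obtain K where "eventually (\<lambda>x. norm (g x) \<le> K) F'" using assms(1) by (auto simp: Bfun_def)
  from eventually_compose_filterlim[OF this assms(2)] show ?thesis by (rule BfunI)
qed

lemma filterlim_affine_Im_at_top:
  fixes A B D :: int
  assumes "A > 0" "D > 0"
  shows "filterlim (\<lambda>z. (of_int A * z + of_int B) / of_int D) (filtercomap Im at_top) (filtercomap Im at_top)"
  unfolding filterlim_filtercomap_iff
proof -
  have "Im ((of_int A * z + of_int B) / of_int D) = of_int A * Im z / of_int D" for z
    using Im_divide_of_real[of "of_int A * z + of_int B" "of_int D"] by simp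
  moreover have "filterlim (\<lambda>y. of_int A * y / of_int D :: real) at_top at_top"
    using assms by real_asymp
  ultimately show "filterlim (Im \<circ> (\<lambda>z. (of_int A * z + of_int B) / of_int D)) at_top (filtercomap Im at_top)"
    unfolding o_def using filterlim_compose[OF _ filterlim_filtercomap] by auto
qed

text \<open>Hermite normal form of diag(l, 1) times the given matrix: an element of
  \<open>SL\<^sub>2(\<int>)\<close> times an upper triangular matrix, with \<open>A\<close> the gcd
  of the first column. The behaviour of \<open>f (l * z)\<close> at a cusp thereby becomes that of
  \<open>f\<close> at some cusp.\<close>

lemma hermite_decomposition:
  fixes a b c d l :: int
  assumes det: "a * d - b * c = 1" and l: "l > 0"
  obtains a' b' c' d' A B D where "a' * d' - b' * c' = 1" "A > 0" "D > 0"
    "l * a = a' * A" "l * b = a' * B + b' * D" "c = c' * A" "d = c' * B + d' * D"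
proof -
  define A where "A = gcd (l * a) c"
  have "l * a \<noteq> 0 \<or> c \<noteq> 0" using det l by auto
  hence A: "A > 0" by (auto simp: A_def)
  obtain a' c' where ac: "l * a = a' * A" "c = c' * A" "coprime a' c'"
    unfolding A_def using gcd_coprime_exists[of "l * a" c] A by (auto simp: A_def)
  obtain x y where xy: "x * a' + y * c' = 1"
    using bezout_int[of a' c'] ac(3) by (metis coprime_imp_gcd_eq_1)
  define d' where "d' = x"
  define b' where "b' = - y"
  have det': "a' * d' - b' * c' = 1" using xy by (simp add: d'_def b'_def algebra_simps)
  define B where "B = d' * l * b - b' * d"
  define D where "D = - c' * l * b + a' * d"
  have "A * D = l * (a * d - b * c)"
  proof -
    have "A * D = - (c' * A) * l * b + (a' * A) * d" by (simp add: D_def algebra_simps)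
    also have "\<dots> = l * (a * d - b * c)" unfolding ac(1,2)[symmetric] by (simp add: algebra_simps)
    finally show ?thesis .
  qed
  hence "A * D > 0" using det l by simp
  hence D: "D > 0" using A by (simp add: zero_less_mult_iff)
  have "a' * B + b' * D = l * b * (a' * d' - b' * c')" "c' * B + d' * D = d * (a' * d' - b' * c')"
    by (simp_all add: B_def D_def algebra_simps)
  hence "l * b = a' * B + b' * D" "d = c' * B + d' * D" using det' by simp_all
  thus ?thesis using that[OF det' A D ac(1)] ac(2) by blast
qed

lemma hermite_moebius:
  fixes a b c d l a' b' c' d' A B D :: int
  assumes det: "a' * d' - b' * c' = 1" and AD: "A > 0" "D > 0"
    and eq: "l * a = a' * A" "l * b = a' * B + b' * D" "c = c' * A" "d = c' * B + d' * D"
    and z: "Im z > 0"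
  defines "z' \<equiv> (of_int A * z + of_int B) / of_int D"
  shows "of_int l * int_moebius a b c d z = int_moebius a' b' c' d' z'"
    and "of_int c * z + of_int d = of_int D * (of_int c' * z' + of_int d')"
    and "Im z' > 0"
proof -
  have D0: "complex_of_int D \<noteq> 0" using AD by simp
  show den: "of_int c * z + of_int d = of_int D * (of_int c' * z' + of_int d')"
    unfolding eq z'_def using D0 by (simp add: field_simps)
  have "of_int l * (of_int a * z + of_int b) = of_int (l * a) * z + of_int (l * b)" by (simp add: algebra_simps)
  also have "\<dots> = of_int D * (of_int a' * z' + of_int b')"
    unfolding eq z'_def using D0 by (simp add: field_simps)
  finally show "of_int l * int_moebius a b c d z = int_moebius a' b' c' d' z'"
    unfolding moebius_def den times_divide_eq_right using D0 by simp
  have "Im z' = of_int A * Im z / of_int D"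
    unfolding z'_def using Im_divide_of_real[of "of_int A * z + of_int B" "of_int D"] by simp
  thus "Im z' > 0" using AD z by simp
qed

lemma norm_theta_factor:
  assumes "coprime c d" "odd d"
  shows "norm (theta_factor c d z) = sqrt (norm (of_int c * z + of_int d))"
proof -
  have d: "d \<noteq> 0" "odd (nat \<bar>d\<bar>)" using assms(2) by (auto simp: even_nat_iff)
  have "(jacobi c (nat \<bar>d\<bar>))\<^sup>2 = 1" using assms d by (intro jacobi_square) auto
  hence "\<bar>jacobi c (nat \<bar>d\<bar>)\<bar> = 1" by (auto simp: power2_eq_1_iff)
  hence "\<bar>kronecker c d\<bar> = 1" unfolding kronecker_eq_jacobi[OF d(1)] by (simp add: abs_mult)
  moreover have "norm (csqrt x) = sqrt (norm x)" for x by (rule norm_csqrt)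
  ultimately show ?thesis unfolding theta_factor_def
    by (simp add: norm_mult norm_inverse del: of_int_abs flip: of_int_abs)
qed

text \<open>The translation by \<open>4 * m\<close>, conjugated by the given matrix, is the matrix
  with entries \<open>a'\<close>, \<open>b'\<close>, \<open>c'\<close>, \<open>d'\<close> in
  \<open>\<Gamma>\<^sub>0(4)\<close>, where the law of theta applies. Absolute values discard the
  root of unity in the factor.\<close>

lemma norm_theta_cusp_periodic:
  assumes det: "a * d - b * c = (1 :: int)" and z: "Im z > 0"
  shows "norm (theta (int_moebius a b c d (z + of_int (4 * m)))) / sqrt (norm (of_int c * (z + of_int (4 * m)) + of_int d)) =
         norm (theta (int_moebius a b c d z)) / sqrt (norm (of_int c * z + of_int d))"
proof -
  define u where "u = int_moebius a b c d z"
  define J where "J = of_int c * z + of_int d"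
  have u: "Im u > 0" unfolding u_def by (rule int_moebius_uhp(3)[OF det z])
  have J: "J \<noteq> 0" unfolding J_def by (rule int_moebius_uhp(1)[OF det z])
  have z4: "Im (z + of_int (4 * m)) > 0" using z by simp
  note J4 = int_moebius_uhp(1)[OF det z4]
  define a' b' c' d' where "a' = 1 - 4 * m * a * c" and "b' = 4 * m * a\<^sup>2" and "c' = - 4 * m * c\<^sup>2" and "d' = 1 + 4 * m * a * c"
  have det': "a' * d' - b' * c' = 1" by (simp add: a'_def b'_def c'_def d'_def power2_eq_square algebra_simps)
  have c4: "4 dvd c'" by (simp add: c'_def)
  have od: "odd d'" by (simp add: d'_def)
  have cop: "coprime c' d'"
  proof (rule coprimeI)
    fix x assume "x dvd c'" "x dvd d'"
    hence "x dvd a' * d' - b' * c'" by simp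
    thus "is_unit x" using det' by simp
  qed
  have detc: "complex_of_int a * of_int d = 1 + of_int b * of_int c"
    using det by (metis add.commute diff_add_cancel of_int_1 of_int_add of_int_mult)
  have den: "of_int c' * u + of_int d' = (of_int c * (z + of_int (4 * m)) + of_int d) / J"
  proof -
    have "(of_int c' * u + of_int d') * J = of_int c' * (of_int a * z + of_int b) + of_int d' * J"
      unfolding u_def moebius_def J_def[symmetric] using J by (simp add: distrib_right)
    also have "\<dots> = of_int c * z + of_int d + 4 * of_int m * of_int c * (of_int a * of_int d - of_int b * of_int c)"
      by (simp add: c'_def d'_def J_def power2_eq_square algebra_simps)
    also have "\<dots> = of_int c * (z + of_int (4 * m)) + of_int d" using detc by (simp add: algebra_simps)
    finally show ?thesis using J by (simp add: field_simps)
  qed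
  have num: "of_int a' * u + of_int b' = (of_int a * (z + of_int (4 * m)) + of_int b) / J"
  proof -
    have "(of_int a' * u + of_int b') * J = of_int a' * (of_int a * z + of_int b) + of_int b' * J"
      unfolding u_def moebius_def J_def[symmetric] using J by (simp add: distrib_right)
    also have "\<dots> = of_int a * z + of_int b + 4 * of_int m * of_int a * (of_int a * of_int d - of_int b * of_int c)"
      by (simp add: a'_def b'_def J_def power2_eq_square algebra_simps)
    also have "\<dots> = of_int a * (z + of_int (4 * m)) + of_int b" using detc by (simp add: algebra_simps)
    finally show ?thesis using J by (simp add: field_simps)
  qed
  have "int_moebius a' b' c' d' u = int_moebius a b c d (z + of_int (4 * m))"
    unfolding moebius_def num den using J by simp
  hence "norm (theta (int_moebius a b c d (z + of_int (4 * m)))) =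
      sqrt (norm ((of_int c * (z + of_int (4 * m)) + of_int d) / J)) * norm (theta u)"
    using theta_transformation[OF det' c4 u] norm_theta_factor[OF cop od, of u] by (simp add: norm_mult den)
  thus ?thesis using J J4 unfolding u_def[symmetric] J_def[symmetric]
    by (simp add: norm_divide real_sqrt_divide)
qed

text \<open>By periodicity the real part may be taken in [0, 4]. There
  \<open>1 \<le> J \<le> R * Im z\<close> for \<open>J\<close> the modulus of \<open>cz + d\<close>,
  and \<open>norm_theta_bound\<close> at height \<open>Im z / J\<^sup>2\<close> grows no faster than
  \<open>sqrt J\<close>.\<close>

lemma theta_cusp_bounded:
  assumes det: "a * d - b * c = (1 :: int)"
  shows "Bfun (\<lambda>z. theta (int_moebius a b c d z) / csqrt (of_int c * z + of_int d)) (filtercomap Im at_top)"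
proof -
  define C where "C = norm (theta (\<i> / 2))"
  \<comment> \<open>The 5 is 4 from \<open>Re z \<le> 4\<close> plus 1 from the imaginary
    part.\<close>
  define R where "R = 5 * \<bar>real_of_int c\<bar> + \<bar>real_of_int d\<bar>"
  have bd: "norm (theta (int_moebius a b c d z)) / sqrt (norm (of_int c * z + of_int d)) \<le> C * (1 + sqrt R)"
    if y: "Im z \<ge> 1" and x: "0 \<le> Re z" "Re z \<le> 4" for z
  proof -
    have z: "Im z > 0" using y by simp
    define J where "J = norm (of_int c * z + of_int d)"
    have J1: "J \<ge> 1"
    proof (cases "c = 0")
      case True
      hence "a * d = 1" using det by simp
      hence "d = 1 \<or> d = - 1" by (auto simp: zmult_eq_1_iff)
      thus ?thesis using True by (auto simp: J_def)
    next
      case False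
      have "1 * 1 \<le> \<bar>real_of_int c\<bar> * Im z" using False y by (intro mult_mono) auto
      also have "\<dots> = \<bar>Im (of_int c * z + of_int d)\<bar>" using z by (simp add: abs_mult)
      also have "\<dots> \<le> J" unfolding J_def by (rule abs_Im_le_cmod)
      finally show ?thesis by simp
    qed
    have "J \<le> \<bar>Re (of_int c * z + of_int d)\<bar> + \<bar>Im (of_int c * z + of_int d)\<bar>"
      unfolding J_def by (rule cmod_le)
    also have "\<dots> \<le> (\<bar>real_of_int c\<bar> * 4 + \<bar>real_of_int d\<bar>) + \<bar>real_of_int c\<bar> * Im z"
    proof (intro add_mono)
      have "\<bar>real_of_int c * Re z\<bar> \<le> \<bar>real_of_int c\<bar> * 4" unfolding abs_mult using x by (intro mult_left_mono) auto
      thus "\<bar>Re (of_int c * z + of_int d)\<bar> \<le> \<bar>real_of_int c\<bar> * 4 + \<bar>real_of_int d\<bar>"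
        using abs_triangle_ineq[of "real_of_int c * Re z" "of_int d"] by simp
      show "\<bar>Im (of_int c * z + of_int d)\<bar> \<le> \<bar>real_of_int c\<bar> * Im z" using z by (simp add: abs_mult)
    qed
    also have "\<dots> \<le> (\<bar>real_of_int c\<bar> * 4 + \<bar>real_of_int d\<bar>) * Im z + \<bar>real_of_int c\<bar> * Im z"
      using y mult_left_mono[of 1 "Im z" "\<bar>real_of_int c\<bar> * 4 + \<bar>real_of_int d\<bar>"] by simp
    also have "\<dots> = R * Im z" by (simp add: R_def algebra_simps)
    finally have JR: "J \<le> R * Im z" .
    have u: "Im (int_moebius a b c d z) = Im z / J\<^sup>2" "Im (int_moebius a b c d z) > 0"
      using int_moebius_uhp(2,3)[OF det z] by (simp_all add: J_def)
    have sq: "sqrt (Im z / J\<^sup>2) = sqrt (Im z) / J" using J1 by (simp add: real_sqrt_divide)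
    have "norm (theta (int_moebius a b c d z)) \<le> C * (1 + J / sqrt (Im z))"
      using norm_theta_bound[OF u(2)] unfolding u(1) sq C_def by simp
    hence "norm (theta (int_moebius a b c d z)) / sqrt J \<le> C * (1 + J / sqrt (Im z)) / sqrt J"
      using J1 by (intro divide_right_mono) auto
    also have "\<dots> = C * (1 / sqrt J + sqrt J / sqrt (Im z))"
    proof -
      have "J / sqrt J = sqrt J" using J1 by (simp add: real_div_sqrt)
      hence "(1 + J / sqrt (Im z)) / sqrt J = 1 / sqrt J + sqrt J / sqrt (Im z)"
        by (simp add: add_divide_distrib divide_divide_eq_left mult.commute[of "sqrt (Im z)"]) 
           (metis divide_divide_eq_left)
      thus ?thesis by (metis times_divide_eq_right)
    qed
    also have "\<dots> \<le> C * (1 + sqrt R)"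
    proof (intro mult_left_mono add_mono)
      show "1 / sqrt J \<le> 1" using J1 by simp
      have "sqrt J \<le> sqrt R * sqrt (Im z)" using JR by (simp flip: real_sqrt_mult)
      thus "sqrt J / sqrt (Im z) \<le> sqrt R" using z by (simp add: field_simps)
    qed (simp add: C_def)
    finally show ?thesis by (simp add: J_def)
  qed
  have "norm (theta (int_moebius a b c d z) / csqrt (of_int c * z + of_int d)) \<le> C * (1 + sqrt R)"
    if y: "Im z \<ge> 1" for z
  proof -
    define m where "m = - \<lfloor>Re z / 4\<rfloor>"
    define z1 where "z1 = z + of_int (4 * m)"
    have "Im z1 \<ge> 1" "0 \<le> Re z1" "Re z1 \<le> 4" using y by (simp_all add: z1_def m_def; linarith)+
    from bd[OF this] norm_theta_cusp_periodic[OF det, of z m] y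
    show ?thesis by (simp add: z1_def norm_divide norm_csqrt)
  qed
  thus ?thesis
    by (intro BfunI[where K = "C * (1 + sqrt R)"]) (auto simp: eventually_filtercomap_at_top_linorder)
qed

subsection \<open>The theta bracket is a cusp form\<close>

text \<open>For \<open>c \<noteq> 0\<close> the radicand is never real. For \<open>c = 0\<close> it
  may be a negative constant on the branch cut, but then the function is constant.\<close>

lemma csqrt_factor_DERIV:
  assumes det: "a * d - b * c = (1 :: int)" and z: "Im z > 0"
  shows "((\<lambda>z. csqrt (of_int c * z + of_int d)) has_field_derivative
      of_real (1/2) * (of_int c / (of_int c * z + of_int d)) * csqrt (of_int c * z + of_int d)) (at z)"
proof (cases "c = 0")
  case False
  define J where "J = of_int c * z + of_int d"
  have nz: "csqrt J \<noteq> 0" "J \<noteq> 0" using int_moebius_uhp(1)[OF det z] by (auto simp: J_def)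
  have "J \<notin> \<real>\<^sub>\<le>\<^sub>0" using False z by (auto simp: J_def complex_nonpos_Reals_iff)
  hence "((\<lambda>z. csqrt (of_int c * z + of_int d)) has_field_derivative (of_int c * 1 + 0) / (2 * csqrt J)) (at z)"
    unfolding J_def by (intro has_field_derivative_csqrt' DERIV_add DERIV_cmult DERIV_ident DERIV_const)
  moreover have "(of_int c * 1 + 0) / (2 * csqrt J) = of_real (1/2) * (of_int c / J) * csqrt J"
  proof -
    have "(of_int c * 1 + 0) / (2 * s) = of_real (1/2) * (of_int c / (s * s)) * s" if "s \<noteq> 0" for s :: complex
      using that by (simp add: field_simps)
    moreover have "csqrt J * csqrt J = J" by (metis power2_csqrt power2_eq_square)
    ultimately show ?thesis using nz(1) by metis
  qed
  ultimately show ?thesis by (simp add: J_def)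
qed simp

lemma power_factor_DERIV:
  assumes det: "a * d - b * c = (1 :: int)" and z: "Im z > 0"
  shows "((\<lambda>z. (of_int c * z + of_int d) ^ k) has_field_derivative
      of_real (real k) * (of_int c / (of_int c * z + of_int d)) * (of_int c * z + of_int d) ^ k) (at z)"
proof -
  define J where "J = of_int c * z + of_int d"
  have nz: "J \<noteq> 0" using int_moebius_uhp(1)[OF det z] by (simp add: J_def)
  have "((\<lambda>z. (of_int c * z + of_int d) ^ k) has_field_derivative of_nat k * ((of_int c * 1 + 0) * J ^ (k - Suc 0))) (at z)"
    unfolding J_def by (intro DERIV_power DERIV_add DERIV_cmult DERIV_ident DERIV_const)
  moreover have "of_nat k * ((of_int c * 1 + 0) * J ^ (k - Suc 0)) = of_real (real k) * (of_int c / J) * J ^ k"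
    using nz by (cases k) simp_all
  ultimately show ?thesis unfolding J_def by (simp only:)
qed

lemma DERIV_cmult_factor:
  "(e has_field_derivative \<kappa> * \<rho> * e z) (at z) \<Longrightarrow>
   ((\<lambda>z. x * e z) has_field_derivative \<kappa> * \<rho> * (x * e z)) (at z)"
  using DERIV_cmult[of e "\<kappa> * \<rho> * e z" z UNIV x] by (simp add: algebra_simps)

lemma int_moebius_holomorphic:
  assumes "a * d - b * c = (1 :: int)"
  shows "int_moebius a b c d holomorphic_on uhp"
  unfolding moebius_def using int_moebius_uhp(1)[OF assms] by (intro holomorphic_intros) auto

lemma dilate_holomorphic:
  assumes "f holomorphic_on uhp" "l > 0"
  shows "(\<lambda>z. f (of_nat l * z)) holomorphic_on uhp"
proof (rule holomorphic_on_compose_gen[of "\<lambda>z. of_nat l * z" uhp f uhp, unfolded o_def])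
  show "(\<lambda>z. of_nat l * z) holomorphic_on uhp" by (intro holomorphic_intros)
  show "(\<lambda>z. of_nat l * z) ` uhp \<subseteq> uhp" using assms(2) by auto
qed (rule assms(1))

lemma csqrt_odd_power: "csqrt x ^ (2 * K + 1) = x ^ K * csqrt x"
  by (simp add: power_mult)

text \<open>\<open>F1\<close> and \<open>G1\<close> are the slash transforms of the two dilated
  functions, and covariance turns the bracket at the cusp into their bracket at infinity. The
  dilations by \<open>l\<close> and \<open>t\<close> may lead to different cusps, hence two Hermite
  decompositions.\<close>

lemma theta_bracket_cusp_vanishing:
  assumes k: "k > 0" and l: "l > 0" "t > 0"
    and f: "f holomorphic_on uhp"
    and bd: "\<And>a b c d. a * d - b * c = 1 \<Longrightarrow>
        Bfun (\<lambda>z. f (int_moebius a b c d z) / (of_int c * z + of_int d) ^ k) (filtercomap Im at_top)"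
    and w: "w > 0 \<or> (\<forall>a b c d. a * d - b * c = 1 \<longrightarrow>
        ((\<lambda>z. f (int_moebius a b c d z) / (of_int c * z + of_int d) ^ k) \<longlongrightarrow> 0) (filtercomap Im at_top))"
    and det: "a * d - b * c = (1 :: int)"
  defines "h \<equiv> rankin_cohen (real k) (1/2) w (\<lambda>z. f (of_nat l * z)) (\<lambda>z. theta (of_nat t * z))"
  shows "((\<lambda>z. h (int_moebius a b c d z) / csqrt (of_int c * z + of_int d) ^ (2 * (k + 2 * w) + 1)) \<longlongrightarrow> 0)
           (filtercomap Im at_top)"
proof -
  define F where "F z = f (of_nat l * z)" for z
  define G where "G z = theta (of_nat t * z)" for z
  define J where "J z = of_int c * z + of_int d" for z :: complex
  define F1 where "F1 z = F (int_moebius a b c d z) / J z ^ k" for z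
  define G1 where "G1 z = G (int_moebius a b c d z) / csqrt (J z)" for z
  have J0: "J z \<noteq> 0" if "Im z > 0" for z unfolding J_def by (rule int_moebius_uhp(1)[OF det that])
  have F: "F holomorphic_on uhp" unfolding F_def by (rule dilate_holomorphic[OF f l(1)])
  have G: "G holomorphic_on uhp" unfolding G_def by (rule dilate_holomorphic[OF theta_holomorphic l(2)])
  have comp: "(\<lambda>z. H (int_moebius a b c d z)) holomorphic_on uhp" if "H holomorphic_on uhp" for H
    using holomorphic_on_compose_gen[OF int_moebius_holomorphic[OF det] that] int_moebius_uhp(3)[OF det]
    by (auto simp: o_def)
  have F1: "F1 holomorphic_on uhp" unfolding F1_def J_def
    by (intro holomorphic_intros comp F) (use J0 in \<open>auto simp: J_def\<close>)
  have csq: "(\<lambda>z. csqrt (J z)) holomorphic_on uhp"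
    using csqrt_factor_DERIV[OF det] unfolding J_def holomorphic_on_def field_differentiable_def
    by (blast intro: has_field_derivative_at_within)
  have G1: "G1 holomorphic_on uhp" unfolding G1_def
    by (intro holomorphic_intros comp G csq) (use J0 in auto)
  obtain a' b' c' d' A B D where H: "a' * d' - b' * c' = 1" "A > 0" "D > 0"
    "int l * a = a' * A" "int l * b = a' * B + b' * D" "c = c' * A" "d = c' * B + d' * D"
    using hermite_decomposition[OF det, of "int l"] l by (metis of_nat_0_less_iff)
  define z' where "z' z = (of_int A * z + of_int B) / of_int D" for z :: complex
  have lim': "filterlim z' (filtercomap Im at_top) (filtercomap Im at_top)"
    unfolding z'_def by (rule filterlim_affine_Im_at_top[OF H(2,3)])
  have ev: "eventually (\<lambda>z. Im z > 0) (filtercomap Im at_top)"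
    unfolding eventually_filtercomap_at_top_linorder by (intro exI[of _ 1]) auto
  have F1eq: "F1 z = inverse (of_int D ^ k) * (f (int_moebius a' b' c' d' (z' z)) / (of_int c' * z' z + of_int d') ^ k)"
    if "Im z > 0" for z
  proof -
    note hm = hermite_moebius(1,2)[OF H(1-7) that, folded z'_def]
    have "F1 z = f (int_moebius a' b' c' d' (z' z)) / (of_int D ^ k * (of_int c' * z' z + of_int d') ^ k)"
      unfolding F1_def F_def J_def hm(2) power_mult_distrib using hm(1) by simp
    thus ?thesis by (simp add: divide_inverse mult_ac)
  qed
  have F1B: "Bfun F1 (filtercomap Im at_top)"
  proof -
    obtain K where K: "eventually (\<lambda>z. norm (f (int_moebius a' b' c' d' (z' z)) / (of_int c' * z' z + of_int d') ^ k) \<le> K)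
        (filtercomap Im at_top)"
      using Bfun_compose_filterlim[OF bd[OF H(1)] lim'] unfolding Bfun_def by blast
    have "eventually (\<lambda>z. norm (F1 z) \<le> norm (inverse (complex_of_int D ^ k)) * K) (filtercomap Im at_top)"
      using ev K
    proof eventually_elim
      case (elim z)
      show ?case unfolding F1eq[OF elim(1)] norm_mult by (rule mult_left_mono[OF elim(2)]) simp
    qed
    thus ?thesis by (rule BfunI)
  qed
  have F1lim: "w > 0 \<or> (F1 \<longlongrightarrow> 0) (filtercomap Im at_top)"
  proof (cases "w > 0")
    case False
    have "((\<lambda>z. inverse (of_int D ^ k) * (f (int_moebius a' b' c' d' (z' z)) / (of_int c' * z' z + of_int d') ^ k))
        \<longlongrightarrow> 0) (filtercomap Im at_top)"
      using False w H(1) by (intro tendsto_mult_right_zero filterlim_compose[OF _ lim']) auto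
    moreover have "eventually (\<lambda>z. inverse (of_int D ^ k) * (f (int_moebius a' b' c' d' (z' z)) / (of_int c' * z' z + of_int d') ^ k) = F1 z)
        (filtercomap Im at_top)"
      using ev by eventually_elim (use F1eq in simp)
    ultimately have "(F1 \<longlongrightarrow> 0) (filtercomap Im at_top)" by (rule Lim_transform_eventually)
    thus ?thesis by simp
  qed simp
  have G1B: "Bfun G1 (filtercomap Im at_top)"
  proof -
    obtain a' b' c' d' A B D where H: "a' * d' - b' * c' = 1" "A > 0" "D > 0"
      "int t * a = a' * A" "int t * b = a' * B + b' * D" "c = c' * A" "d = c' * B + d' * D"
      using hermite_decomposition[OF det, of "int t"] l by (metis of_nat_0_less_iff)
    define z' where "z' z = (of_int A * z + of_int B) / of_int D" for z :: complex
    have lim': "filterlim z' (filtercomap Im at_top) (filtercomap Im at_top)"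
      unfolding z'_def by (rule filterlim_affine_Im_at_top[OF H(2,3)])
    \<comment> \<open>Boundedness concerns only the norm, so no branch of the root of a product has
      to be determined.\<close>
    have G1eq: "norm (G1 z) = norm (theta (int_moebius a' b' c' d' (z' z)) / csqrt (of_int c' * z' z + of_int d')) / sqrt (of_int D)"
      if "Im z > 0" for z
      using hermite_moebius(1,2)[OF H(1-7) that] H(3) unfolding G1_def G_def J_def z'_def
      by (simp add: norm_divide norm_csqrt norm_mult real_sqrt_mult)
    obtain K where K: "eventually (\<lambda>z. norm (theta (int_moebius a' b' c' d' (z' z)) / csqrt (of_int c' * z' z + of_int d')) \<le> K)
        (filtercomap Im at_top)"
      using Bfun_compose_filterlim[OF theta_cusp_bounded[OF H(1)] lim'] unfolding Bfun_def by blast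
    have "eventually (\<lambda>z. norm (G1 z) \<le> K / sqrt (of_int D)) (filtercomap Im at_top)"
      using ev K by eventually_elim (use G1eq H(3) in \<open>auto intro!: divide_right_mono\<close>)
    thus ?thesis by (rule BfunI)
  qed
  have cov: "h (int_moebius a b c d z) / csqrt (J z) ^ (2 * (k + 2 * w) + 1) = rankin_cohen (real k) (1/2) w F1 G1 z"
    if z: "Im z > 0" for z
  proof -
    have "rankin_cohen (real k) (1/2) w F G (int_moebius a b c d z) =
        J z ^ k * csqrt (J z) * (of_int c * z + of_int d) ^ (2 * w) * rankin_cohen (real k) (1/2) w F1 G1 z"
    proof (rule rankin_cohen_covariant[where ?e\<^sub>1.0 = "\<lambda>z. J z ^ k" and ?e\<^sub>2.0 = "\<lambda>z. csqrt (J z)", OF _ _ F F1 G G1 det])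
      show "F (int_moebius a b c d z) = J z ^ k * F1 z" if "Im z > 0" for z using J0[OF that] by (simp add: F1_def)
      show "G (int_moebius a b c d z) = csqrt (J z) * G1 z" if "Im z > 0" for z using J0[OF that] by (simp add: G1_def)
      show "((\<lambda>z. J z ^ k) has_field_derivative of_real (real k) * (of_int c / (of_int c * z + of_int d)) * J z ^ k) (at z)"
        if "Im z > 0" for z unfolding J_def by (rule power_factor_DERIV[OF det that])
      show "((\<lambda>z. csqrt (J z)) has_field_derivative of_real (1/2) * (of_int c / (of_int c * z + of_int d)) * csqrt (J z)) (at z)"
        if "Im z > 0" for z unfolding J_def by (rule csqrt_factor_DERIV[OF det that])
    qed (use k z in auto)
    moreover have "csqrt (J z) ^ (2 * (k + 2 * w) + 1) = J z ^ k * csqrt (J z) * J z ^ (2 * w)"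
      by (subst csqrt_odd_power) (simp add: power_add mult_ac)
    moreover have "h = rankin_cohen (real k) (1/2) w F G" by (simp add: h_def F_def[abs_def] G_def[abs_def])
    ultimately show ?thesis using J0[OF z] by (simp add: J_def[symmetric])
  qed
  have "(rankin_cohen (real k) (1/2) w F1 G1 \<longlongrightarrow> 0) (filtercomap Im at_top)"
    by (rule rankin_cohen_tendsto_0[OF F1 F1B G1 G1B F1lim])
  moreover have "eventually (\<lambda>z. rankin_cohen (real k) (1/2) w F1 G1 z =
      h (int_moebius a b c d z) / csqrt (of_int c * z + of_int d) ^ (2 * (k + 2 * w) + 1)) (filtercomap Im at_top)"
    using ev by eventually_elim (use cov in \<open>simp add: J_def\<close>)
  ultimately show ?thesis by (rule Lim_transform_eventually)
qed

lemma chi_minus4_eq_chi4: "odd d \<Longrightarrow> chi_minus4 d = of_int (chi4 d)"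
proof -
  assume o: "odd d"
  have "kronecker (4 * - 1) d = jacobi 4 (nat \<bar>d\<bar>) * kronecker (- 1) d"
    by (rule kronecker_mult_left[OF o]) simp
  moreover have "jacobi 4 (nat \<bar>d\<bar>) = 1"
    using jacobi_mult_left[of "nat \<bar>d\<bar>" 2 2] jacobi_square[of "nat \<bar>d\<bar>" 2] o
    by (simp add: even_nat_iff power2_eq_square)
  ultimately show ?thesis using kronecker_eq_chi4[OF o] by (simp add: quadratic_character_def)
qed

lemma quadratic_character_eq_jacobi:
  assumes "odd d" "t > 0"
  shows "quadratic_character (int t) d = of_int (jacobi (int t) (nat \<bar>d\<bar>))"
proof -
  have d: "d \<noteq> 0" "odd (nat \<bar>d\<bar>)" using assms by (auto simp: even_nat_iff)
  have "jacobi 4 (nat \<bar>d\<bar>) = 1"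
    using jacobi_mult_left[of "nat \<bar>d\<bar>" 2 2] jacobi_square[of "nat \<bar>d\<bar>" 2] d
    by (simp add: power2_eq_square)
  hence "kronecker (4 * int t) d = jacobi (int t) (nat \<bar>d\<bar>)" "kronecker (int t) d = jacobi (int t) (nat \<bar>d\<bar>)"
    using d assms(2) by (simp_all add: kronecker_eq_jacobi jacobi_mult_left)
  thus ?thesis by (simp add: quadratic_character_def)
qed

theorem theta_bracket_transformation:
  assumes k: "k > 0" and r: "r > 0" and t: "t > 0" "t dvd N" and M: "4 * N * r dvd M"
    and f: "f holomorphic_on uhp"
    and tr: "\<And>a b c d z. a * d - b * c = 1 \<Longrightarrow> int N dvd c \<Longrightarrow> Im z > 0 \<Longrightarrow>
        f (int_moebius a b c d z) = chi d * (of_int c * z + of_int d) ^ k * f z"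
    and det: "a * d - b * c = 1" and c: "int M dvd c" and z: "Im z > 0"
  shows "theta_bracket k f w r t (int_moebius a b c d z) =
    (chi d * quadratic_character (int t) d * chi_minus4 d ^ k) * theta_factor c d z ^ (2 * (k + 2 * w) + 1) *
    theta_bracket k f w r t z"
proof -
  define F where "F z = f (of_nat (4 * r) * z)" for z
  define G where "G z = theta (of_nat t * z)" for z
  have F: "F holomorphic_on uhp" unfolding F_def by (rule dilate_holomorphic[OF f]) (use r in simp)
  have G: "G holomorphic_on uhp" unfolding G_def by (rule dilate_holomorphic[OF theta_holomorphic t(1)])
  have "int (4 * N * r) dvd c" using M c by (meson dvd_trans of_nat_dvd_iff)
  then obtain m where m: "c = int (4 * N * r) * m" by (auto elim: dvdE)
  obtain N' where N': "N = t * N'" using t(2) by (auto elim: dvdE)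
  \<comment> \<open>Conjugation by a dilation by \<open>l\<close> replaces \<open>b\<close>,
    \<open>c\<close> by \<open>l * b\<close>, \<open>c / l\<close>. With \<open>l = 4 * r\<close>
    the new entry \<open>c1\<close> is divisible by \<open>N\<close>; with \<open>l = t\<close> the
    new entry \<open>c2\<close> is divisible by 4, owing to \<open>t dvd N\<close>.\<close>
  define c1 where "c1 = int N * m"
  define c2 where "c2 = 4 * int N' * int r * m"
  have c1: "c = int (4 * r) * c1" "int N dvd c1" and c2: "c = int t * c2" "4 dvd c2"
    by (simp_all add: m c1_def c2_def N' algebra_simps)
  have od: "odd d"
  proof
    assume "even d"
    moreover have "even c" unfolding m by simp
    ultimately have "even (a * d - b * c)" by simp
    thus False using det by simp
  qed
  have cop: "coprime c d"
  proof (rule coprimeI)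
    fix x assume "x dvd c" "x dvd d"
    hence "x dvd a * d - b * c" by simp
    thus "is_unit x" using det by simp
  qed
  have Ftr: "F (int_moebius a b c d z) = (chi d * (of_int c * z + of_int d) ^ k) * F z" if "Im z > 0" for z
  proof -
    have "of_nat (4 * r) * int_moebius a b c d z = int_moebius a (int (4 * r) * b) c1 d (of_nat (4 * r) * z)"
      unfolding moebius_def c1(1) by (simp add: algebra_simps)
    moreover have "a * d - (int (4 * r) * b) * c1 = 1" using det c1(1) by (simp add: algebra_simps)
    moreover have "Im (of_nat (4 * r) * z) > 0" using that r by simp
    ultimately have "F (int_moebius a b c d z) = chi d * (of_int c1 * (of_nat (4 * r) * z) + of_int d) ^ k * f (of_nat (4 * r) * z)"
      unfolding F_def using tr c1(2) by metis
    thus ?thesis unfolding F_def c1(1) by (simp add: algebra_simps)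
  qed
  define \<eta> where "\<eta> = inverse (if d mod 4 = 1 then 1 else \<i>) * complex_of_int (kronecker c2 d)"
  have Gtr: "G (int_moebius a b c d z) = (\<eta> * csqrt (of_int c * z + of_int d)) * G z" if "Im z > 0" for z
  proof -
    have "of_nat t * int_moebius a b c d z = int_moebius a (int t * b) c2 d (of_nat t * z)"
      unfolding moebius_def c2(1) by (simp add: algebra_simps)
    moreover have "a * d - (int t * b) * c2 = 1" using det c2(1) by (simp add: algebra_simps)
    moreover have "Im (of_nat t * z) > 0" using that t by simp
    ultimately have "G (int_moebius a b c d z) = theta_factor c2 d (of_nat t * z) * theta (of_nat t * z)"
      unfolding G_def using theta_transformation c2(2) by metis
    moreover have "of_int c2 * (of_nat t * z) + of_int d = of_int c * z + of_int d"
      unfolding c2(1) by (simp add: algebra_simps)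
    ultimately show ?thesis unfolding G_def theta_factor_def \<eta>_def by simp
  qed
  have "rankin_cohen (real k) (1/2) w F G (int_moebius a b c d z) =
      (chi d * (of_int c * z + of_int d) ^ k) * (\<eta> * csqrt (of_int c * z + of_int d)) * (of_int c * z + of_int d) ^ (2 * w) *
      rankin_cohen (real k) (1/2) w F G z"
  proof (rule rankin_cohen_covariant[where ?e\<^sub>1.0 = "\<lambda>z. chi d * (of_int c * z + of_int d) ^ k" and
          ?e\<^sub>2.0 = "\<lambda>z. \<eta> * csqrt (of_int c * z + of_int d)", OF _ _ F F G G det])
    fix z :: complex assume z: "Im z > 0"
    show "((\<lambda>z. chi d * (of_int c * z + of_int d) ^ k) has_field_derivative
        of_real (real k) * (of_int c / (of_int c * z + of_int d)) * (chi d * (of_int c * z + of_int d) ^ k)) (at z)"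
      by (rule DERIV_cmult_factor[OF power_factor_DERIV[OF det z]])
    show "((\<lambda>z. \<eta> * csqrt (of_int c * z + of_int d)) has_field_derivative
        of_real (1/2) * (of_int c / (of_int c * z + of_int d)) * (\<eta> * csqrt (of_int c * z + of_int d))) (at z)"
      by (rule DERIV_cmult_factor[OF csqrt_factor_DERIV[OF det z]])
  qed (use k z Ftr Gtr in auto)
  moreover have "(chi d * quadratic_character (int t) d * chi_minus4 d ^ k) * theta_factor c d z ^ (2 * (k + 2 * w) + 1) =
      (chi d * (of_int c * z + of_int d) ^ k) * (\<eta> * csqrt (of_int c * z + of_int d)) * (of_int c * z + of_int d) ^ (2 * w)"
  proof -
    \<comment> \<open>The multipliers are compared by two facts: \<open>kronecker c d\<close> is
      \<open>jacobi t\<close> times \<open>kronecker c2 d\<close>, which accounts for the character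
      of \<open>t\<close>; and \<open>\<epsilon> ^ (2 * K)\<close> is \<open>chi4 d ^ K\<close> with
      \<open>K\<close> of the parity of \<open>k\<close>, which accounts for the power of
      \<open>chi_minus4\<close>.\<close>
    define K where "K = k + 2 * w"
    define J where "J = of_int c * z + of_int d"
    define \<epsilon> where "\<epsilon> = inverse (if d mod 4 = 1 then 1 else \<i>)"
    define x where "x = jacobi (int t) (nat \<bar>d\<bar>)"
    have d: "d \<noteq> 0" "odd (nat \<bar>d\<bar>)" using od by (auto simp: even_nat_iff)
    have "coprime (int t) (int (nat \<bar>d\<bar>))" using cop c2(1) by simp
    hence x2: "x * x = 1" unfolding x_def using jacobi_square[OF d(2)] by (simp add: power2_eq_square)
    have kc: "kronecker c d = x * kronecker c2 d"
      unfolding c2(1) x_def using t by (intro kronecker_mult_left[OF od]) simp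
    have "coprime c2 (int (nat \<bar>d\<bar>))" using cop c2(1) by simp
    hence "(jacobi c2 (nat \<bar>d\<bar>))\<^sup>2 = 1" using jacobi_square[OF d(2)] by blast
    hence k2: "(kronecker c2 d)\<^sup>2 = 1" unfolding kronecker_eq_jacobi[OF d(1)] by (simp add: power_mult_distrib)
    have kK: "(of_int (kronecker c d) :: complex) ^ (2 * K + 1) = of_int (x * kronecker c2 d)"
    proof -
      have "(kronecker c d)\<^sup>2 = 1" 
      proof -
        have "(x * kronecker c2 d)\<^sup>2 = (x * x) * (kronecker c2 d)\<^sup>2" by (simp add: power2_eq_square)
        thus ?thesis unfolding kc using k2 x2 by simp
      qed
      hence "kronecker c d ^ (2 * K + 1) = x * kronecker c2 d"
        unfolding power_add power_mult by (simp add: kc)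
      thus ?thesis by (metis of_int_power)
    qed
    have e2: "\<epsilon>\<^sup>2 = of_int (chi4 d)" by (simp add: \<epsilon>_def chi4_def power2_eq_square)
    have "(chi4 d)\<^sup>2 = 1" by (simp add: chi4_def)
    hence c4: "(of_int (chi4 d) :: complex) ^ k * of_int (chi4 d) ^ K = 1"
    proof -
      have "chi4 d ^ k * chi4 d ^ K = (chi4 d ^ 2) ^ (k + w)"
        by (simp add: K_def flip: power_add power_mult)
      hence "chi4 d ^ k * chi4 d ^ K = 1" using \<open>(chi4 d)\<^sup>2 = 1\<close> by simp
      thus ?thesis by (metis of_int_1 of_int_mult of_int_power)
    qed
    have "theta_factor c d z ^ (2 * K + 1) = \<epsilon> ^ (2 * K + 1) * of_int (kronecker c d) ^ (2 * K + 1) * csqrt J ^ (2 * K + 1)"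
      unfolding theta_factor_def J_def \<epsilon>_def power_mult_distrib ..
    also have "\<dots> = of_int (chi4 d) ^ K * \<epsilon> * of_int (x * kronecker c2 d) * (J ^ K * csqrt J)"
      unfolding kK csqrt_odd_power by (simp add: power_add power_mult e2)
    finally have tf: "theta_factor c d z ^ (2 * K + 1) = \<dots>" .
    have "(chi d * quadratic_character (int t) d * chi_minus4 d ^ k) * theta_factor c d z ^ (2 * K + 1) =
        chi d * (of_int (x * x) * (of_int (chi4 d) ^ k * of_int (chi4 d) ^ K)) * (\<epsilon> * of_int (kronecker c2 d)) * (J ^ K * csqrt J)"
      unfolding tf quadratic_character_eq_jacobi[OF od t(1)] chi_minus4_eq_chi4[OF od] x_def[symmetric]
      by (simp add: mult_ac)
    also have "\<dots> = chi d * \<eta> * (J ^ K * csqrt J)" unfolding c4 x2 by (simp add: \<eta>_def \<epsilon>_def)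
    also have "J ^ K = J ^ k * J ^ (2 * w)" by (simp add: K_def power_add)
    finally show ?thesis unfolding K_def J_def by (simp add: mult_ac)
  qed
  moreover have "theta_bracket k f w r t = rankin_cohen (real k) (1/2) w F G"
    by (simp add: theta_bracket_def F_def[abs_def] G_def[abs_def])
  ultimately show ?thesis by (simp only:)
qed
subsection \<open>Hecke relations including the constant term\<close>

lemma has_q_expansion_tendsto:
  assumes "has_q_expansion F c"
  shows "(F \<longlongrightarrow> c 0) (filtercomap Im at_top)"
proof -
  define P where "P x = (\<Sum>n. c n * x ^ n)" for x
  have "isCont P 0"
    unfolding P_def
    by (rule isCont_powser[where K = "1 / 2"])
       (use has_q_expansion_summable[OF assms, of "1/2"] in \<open>auto intro: summable_norm_cancel\<close>)
  hence P: "(P \<longlongrightarrow> P 0) (nhds 0)" by (simp add: isCont_def tendsto_nhds_iff)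
  have "((\<lambda>y. exp (- (2 * pi * y))) \<longlongrightarrow> (0 :: real)) at_top" by real_asymp
  hence "((\<lambda>z. norm (qexp z)) \<longlongrightarrow> 0) (filtercomap Im at_top)"
    unfolding norm_qexp by (rule filterlim_compose[OF _ filterlim_filtercomap])
  hence "(qexp \<longlongrightarrow> 0) (filtercomap Im at_top)" by (rule tendsto_norm_zero_cancel)
  from filterlim_compose[OF P this] have "((\<lambda>z. P (qexp z)) \<longlongrightarrow> P 0) (filtercomap Im at_top)" .
  moreover have "eventually (\<lambda>z. P (qexp z) = F z) (filtercomap Im at_top)"
    unfolding eventually_filtercomap_at_top_linorder
    by (intro exI[of _ 1]) (use has_q_expansion_sums[OF assms] in \<open>auto simp: P_def sums_iff\<close>)
  moreover have "P 0 = c 0" by (simp add: P_def)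
  ultimately show ?thesis by (auto intro: Lim_transform_eventually)
qed

lemma sum_roots_of_unity:
  assumes "y > 0"
  shows "(\<Sum>b<y. qexp (of_nat (m * b) / of_nat y)) = (if y dvd m then of_nat y else 0)"
proof -
  define \<omega> where "\<omega> = qexp (of_nat m / of_nat y)"
  have pw: "qexp (of_nat (m * b) / of_nat y) = \<omega> ^ b" for b
    unfolding \<omega>_def qexp_power by (rule arg_cong[of _ _ qexp]) simp
  have wy: "\<omega> ^ y = 1" unfolding \<omega>_def qexp_power using assms qexp_of_int[of "int m"] by simp
  show ?thesis
  proof (cases "y dvd m")
    case True
    then obtain j where "m = y * j" by (auto elim: dvdE)
    hence "\<omega> = 1" unfolding \<omega>_def using assms qexp_of_int[of "int j"] by simp
    thus ?thesis using True by (simp only: pw) simp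
  next
    case False
    have "\<omega> \<noteq> 1"
    proof
      assume "\<omega> = 1"
      then obtain n where "complex_of_nat m / of_nat y = of_int n" unfolding \<omega>_def qexp_eq_1_iff by blast
      hence "complex_of_nat m = of_int n * of_nat y" using assms by (simp add: field_simps)
      hence "complex_of_int (int m) = complex_of_int (n * int y)" by simp
      hence "int m = n * int y" by (simp only: of_int_eq_iff)
      hence "int y dvd int m" by simp
      thus False using False by simp
    qed
    moreover have "(\<omega> - 1) * (\<Sum>b<y. \<omega> ^ b) = \<omega> ^ y - 1" by (rule power_diff_1_eq[symmetric])
    ultimately show ?thesis using False wy by (simp only: pw) simp
  qed
qed

text \<open>This is \<open>y\<close> times the operator \<open>U\<^sub>y\<close>; together with
  dilations it builds up the Hecke operators.\<close>

lemma has_q_expansion_trace: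
  assumes "has_q_expansion F c" "y > 0"
  shows "has_q_expansion (\<lambda>z. \<Sum>b<y. F ((z + of_nat b) / of_nat y)) (\<lambda>n. of_nat y * c (n * y))"
  unfolding has_q_expansion_def
proof (intro allI impI)
  fix z :: complex assume z: "Im z > 0"
  have "(\<lambda>m. c m * qexp ((z + of_nat b) / of_nat y) ^ m) sums F ((z + of_nat b) / of_nat y)" for b
  proof (rule has_q_expansion_sums[OF assms(1)])
    have "Im ((z + of_nat b) / of_nat y) = Im z / real y"
      using Im_divide_of_real[of "z + of_nat b" "real y"] by simp
    thus "Im ((z + of_nat b) / of_nat y) > 0" using z assms(2) by simp
  qed
  hence "(\<lambda>m. \<Sum>b<y. c m * qexp ((z + of_nat b) / of_nat y) ^ m) sums (\<Sum>b<y. F ((z + of_nat b) / of_nat y))"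
    by (intro sums_sum)
  also have "(\<lambda>m. \<Sum>b<y. c m * qexp ((z + of_nat b) / of_nat y) ^ m) =
      (\<lambda>m. if y dvd m then of_nat y * c m * qexp (z / of_nat y) ^ m else 0)"
  proof
    fix m
    have "qexp ((z + of_nat b) / of_nat y) ^ m = qexp (z / of_nat y) ^ m * qexp (of_nat (m * b) / of_nat y)" for b
      unfolding qexp_power qexp_add[symmetric] by (rule arg_cong[of _ _ qexp]) (simp add: add_divide_distrib distrib_left)
    hence "(\<Sum>b<y. c m * qexp ((z + of_nat b) / of_nat y) ^ m) =
        c m * qexp (z / of_nat y) ^ m * (\<Sum>b<y. qexp (of_nat (m * b) / of_nat y))"
      by (simp add: sum_distrib_left mult.assoc)
    thus "(\<Sum>b<y. c m * qexp ((z + of_nat b) / of_nat y) ^ m) =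
        (if y dvd m then of_nat y * c m * qexp (z / of_nat y) ^ m else 0)"
      unfolding sum_roots_of_unity[OF assms(2)] by simp
  qed
  finally have "(\<lambda>m. if y dvd m then of_nat y * c m * qexp (z / of_nat y) ^ m else 0) sums
      (\<Sum>b<y. F ((z + of_nat b) / of_nat y))" .
  moreover have "n \<in> range (\<lambda>n. n * y)" if "y dvd n" for n
    using that by (metis dvd_div_mult_self rangeI)
  ultimately have "(\<lambda>n. if y dvd n * y then of_nat y * c (n * y) * qexp (z / of_nat y) ^ (n * y) else 0) sums
      (\<Sum>b<y. F ((z + of_nat b) / of_nat y))"
    using assms(2)
    by (subst sums_mono_reindex[of "\<lambda>n. n * y" "\<lambda>m. if y dvd m then of_nat y * c m * qexp (z / of_nat y) ^ m else 0"])
       (auto simp: strict_mono_def)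
  moreover have "qexp (z / of_nat y) ^ (n * y) = qexp z ^ n" for n
    unfolding qexp_power using assms(2) by (intro arg_cong[of _ _ qexp]) simp
  ultimately show "(\<lambda>n. of_nat y * c (n * y) * qexp z ^ n) sums (\<Sum>b<y. F ((z + of_nat b) / of_nat y))"
    by simp
qed

lemma dirichlet_character_1:
  assumes "dirichlet_character N chi"
  shows "chi 1 = 1"
proof -
  have "chi (1 * 1) = chi 1 * chi 1" using assms unfolding dirichlet_character_def by blast
  moreover have "chi 1 \<noteq> 0" using assms unfolding dirichlet_character_def by simp
  ultimately show ?thesis by simp
qed

section \<open>Relations between the coefficients of a fixed eigenform\<close>

locale eigenform =
  fixes k N :: nat and chi :: "int \<Rightarrow> complex" and f :: "complex \<Rightarrow> complex" and a :: "nat \<Rightarrow> complex"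
  assumes k_pos: "0 < k" and N_pos: "0 < N"
    and char: "dirichlet_character N chi"
    and eigenform: "normalized_hecke_eigenform k N chi f a"
begin

lemma f_modular:
  "a' * d - b * c = 1 \<Longrightarrow> int N dvd c \<Longrightarrow> Im z > 0 \<Longrightarrow>
     f (int_moebius a' b c d z) = chi d * (of_int c * z + of_int d) ^ k * f z"
  using eigenform unfolding normalized_hecke_eigenform_def modular_form_def by blast

lemma f_q_expansion: "has_q_expansion f a"
  using eigenform unfolding normalized_hecke_eigenform_def by blast

lemma hecke_relation:
  "m \<ge> 1 \<Longrightarrow> n \<ge> 1 \<Longrightarrow>
     a m * a n = (\<Sum>d | d dvd gcd m n. chi (int d) * of_nat d ^ (k - 1) * a (m * n div d\<^sup>2))"
  using eigenform unfolding normalized_hecke_eigenform_def by blast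

lemma chi_mult: "chi (x * y) = chi x * chi y"
  using char unfolding dirichlet_character_def by blast

lemma chi_eq_0_iff: "chi x = 0 \<longleftrightarrow> \<not> coprime x (int N)"
  using char unfolding dirichlet_character_def by blast

lemma chi_eq_1: "[x = 1] (mod int N) \<Longrightarrow> chi x = 1"
  using char dirichlet_character_1 unfolding dirichlet_character_def by metis

text \<open>
  \<open>T\<^sub>l f - a(l) f\<close> is constant, and a nonzero constant has no weight \<open>k\<close> symmetry under
  \<open>z \<mapsto> z / (Nlz + 1)\<close>.
\<close>

lemma hecke_constant_term:
  assumes l: "l > 0"
  shows "a l * a 0 = (\<Sum>g | g dvd l. chi (int g) * of_nat g ^ (k - 1) * a 0)"
proof -
  define T where "T z = (\<Sum>g | g dvd l. chi (int g) * of_nat g ^ (k - 1) * inverse (of_nat (l div g)) *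
      (\<Sum>b<l div g. f ((of_nat g * z + of_nat b) / of_nat (l div g))))" for z
  define C where "C = (\<Sum>g | g dvd l. chi (int g) * of_nat g ^ (k - 1) * a 0) - a l * a 0"
  have pos: "g > 0" "l div g > 0" if "g dvd l" for g
    using that l by (auto intro: Nat.gr0I simp: dvd_div_eq_0_iff)
  have "has_q_expansion T (\<lambda>n. \<Sum>g | g dvd l. chi (int g) * of_nat g ^ (k - 1) * inverse (of_nat (l div g)) *
      (if g dvd n then of_nat (l div g) * a (n div g * (l div g)) else 0))"
    unfolding T_def
    by (intro has_q_expansion_sum has_q_expansion_cmult
          has_q_expansion_dilate[where F = "\<lambda>z. \<Sum>b<l div _. f ((z + of_nat b) / of_nat (l div _))"]
          has_q_expansion_trace f_q_expansion) (use pos in auto)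
  hence "has_q_expansion (\<lambda>z. T z + - a l * f z) (\<lambda>n. (\<Sum>g | g dvd l. chi (int g) * of_nat g ^ (k - 1) * inverse (of_nat (l div g)) *
      (if g dvd n then of_nat (l div g) * a (n div g * (l div g)) else 0)) + - a l * a n)"
    by (intro has_q_expansion_add has_q_expansion_cmult f_q_expansion)
  hence exp: "has_q_expansion (\<lambda>z. T z + - a l * f z) (\<lambda>n. if n = 0 then C else 0)"
  proof (rule has_q_expansion_cong)
    fix n
    have "(\<Sum>g | g dvd l. chi (int g) * of_nat g ^ (k - 1) * inverse (of_nat (l div g)) *
      (if g dvd n then of_nat (l div g) * a (n div g * (l div g)) else 0)) =
      (\<Sum>g | g dvd l. if g dvd n then chi (int g) * of_nat g ^ (k - 1) * a (n div g * (l div g)) else 0)"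
      using pos by (intro sum.cong refl) auto
    also have "\<dots> = (\<Sum>g\<in>{g\<in>{g. g dvd l}. g dvd n}. chi (int g) * of_nat g ^ (k - 1) * a (n div g * (l div g)))"
      using l by (subst sum.inter_filter) (auto intro: finite_divisors_nat)
    also have "\<dots> = (\<Sum>g | g dvd gcd l n. chi (int g) * of_nat g ^ (k - 1) * a (l * n div g\<^sup>2))"
    proof (intro sum.cong)
      fix g assume "g \<in> {g. g dvd gcd l n}"
      hence "g dvd l" "g dvd n" by auto
      hence "l * n div g\<^sup>2 = n div g * (l div g)"
        by (simp add: power2_eq_square div_mult_div_if_dvd mult.commute)
      thus "chi (int g) * of_nat g ^ (k - 1) * a (n div g * (l div g)) =
          chi (int g) * of_nat g ^ (k - 1) * a (l * n div g\<^sup>2)" by simp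
    qed auto
    finally have "(\<Sum>g | g dvd l. chi (int g) * of_nat g ^ (k - 1) * inverse (of_nat (l div g)) *
      (if g dvd n then of_nat (l div g) * a (n div g * (l div g)) else 0)) =
      (\<Sum>g | g dvd gcd l n. chi (int g) * of_nat g ^ (k - 1) * a (l * n div g\<^sup>2))" .
    thus "(\<Sum>g | g dvd l. chi (int g) * of_nat g ^ (k - 1) * inverse (of_nat (l div g)) *
      (if g dvd n then of_nat (l div g) * a (n div g * (l div g)) else 0)) + - a l * a n = (if n = 0 then C else 0)"
      using hecke_relation[of l n] l by (cases "n = 0") (simp_all add: C_def)
  qed simp
  have const: "T z - a l * f z = C" if "Im z > 0" for z
  proof -
    have "(\<lambda>n. (if n = 0 then C else 0) * qexp z ^ n) sums (T z + - a l * f z)"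
      by (rule has_q_expansion_sums[OF exp that])
    moreover have "(\<lambda>n. (if n = 0 then C else 0) * qexp z ^ n) sums (\<Sum>n\<in>{0}. (if n = 0 then C else 0) * qexp z ^ n)"
      by (rule sums_finite) auto
    ultimately show ?thesis using sums_unique2 by fastforce
  qed
  define c where "c = int (N * l)"
  define g where "g = int_moebius 1 0 c 1"
  have tr: "f ((of_nat x * g z + of_nat b) / of_nat y) = (of_int c * z + 1) ^ k * f ((of_nat x * z + of_nat b) / of_nat y)"
    if z: "Im z > 0" and xy: "x * y = l" for z x y b
  proof -
    have y0: "y > 0" "x > 0" using xy l by (auto intro!: Nat.gr0I)
    define u where "u = (of_nat x * z + of_nat b) / of_nat y"
    have "Im u = real x * Im z / real y"
      unfolding u_def using Im_divide_of_real[of "of_nat x * z + of_nat b" "real y"] by simp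
    hence u: "Im u > 0" using z y0 by simp
    \<comment> \<open>The matrix with rows (1, 0) and (N l, 1), conjugated by the coset
      representative with rows (x, b) and (0, y). Because \<open>x * y = l\<close> divides the lower
      left entry, the conjugate is integral and lies in \<open>\<Gamma>\<^sub>0(N)\<close>, with
      \<open>d'\<close> congruent to 1 modulo \<open>N\<close>. So each summand of \<open>T\<close>
      transforms by itself, without a permutation of the cosets.\<close>
    define a' b' c' d' where "a' = 1 + int (b * N * y)" and "b' = - int (b * b * N)" and
      "c' = int (y * y * N)" and "d' = 1 - int (b * N * y)"
    have det: "a' * d' - b' * c' = 1" by (simp add: a'_def b'_def c'_def d'_def algebra_simps)
    have nz: "of_int c * z + 1 \<noteq> 0"
    proof
      assume *: "of_int c * z + 1 = 0"
      have "Im (of_int c * z + 1) = real_of_int c * Im z" by simp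
      hence "c = 0" using * z by simp
      thus False using N_pos l by (simp add: c_def)
    qed
    have yu: "of_nat y * u = of_nat x * z + of_nat b" unfolding u_def using y0 by simp
    have den: "of_int c' * u + of_int d' = of_int c * z + 1"
    proof -
      have "of_int c' * u + of_int d' = of_nat (N * y) * (of_nat y * u) + 1 - of_nat (b * N * y)"
        by (simp add: c'_def d'_def algebra_simps)
      also have "\<dots> = of_nat (N * (x * y)) * z + 1" unfolding yu by (simp add: algebra_simps)
      finally show ?thesis unfolding xy by (simp add: c_def)
    qed
    have "of_nat y * (of_int a' * u + of_int b') = of_nat y * u + of_nat (b * N * y) * (of_nat y * u) - of_nat (b * b * N * y)"
      by (simp add: a'_def b'_def algebra_simps)
    also have "\<dots> = of_nat x * z + of_nat b + of_nat (b * N * (x * y)) * z"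
      unfolding yu by (simp add: algebra_simps)
    also have "\<dots> = of_nat x * z + of_nat b * (of_int c * z + 1)" unfolding xy by (simp add: c_def algebra_simps)
    finally have num: "of_int a' * u + of_int b' = (of_nat x * z + of_nat b * (of_int c * z + 1)) / of_nat y"
      using y0 by (simp add: field_simps)
    have "int_moebius a' b' c' d' u = (of_nat x * g z + of_nat b) / of_nat y"
    proof -
      have "of_nat x * g z + of_nat b = (of_nat x * z + of_nat b * (of_int c * z + 1)) / (of_int c * z + 1)"
        unfolding g_def moebius_def using nz by (simp add: add_divide_distrib)
      thus ?thesis unfolding moebius_def den num by (simp add: mult.commute)
    qed
    moreover have "f (int_moebius a' b' c' d' u) = chi d' * (of_int c' * u + of_int d') ^ k * f u"
      by (rule f_modular[OF det _ u]) (simp add: c'_def)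
    moreover have "chi d' = 1" by (rule chi_eq_1) (simp add: d'_def cong_iff_dvd_diff)
    ultimately show ?thesis using den u_def by simp
  qed
  have gi: "Im (g \<i>) > 0"
  proof -
    have "g \<i> = \<i> / (of_int c * \<i> + 1)" by (simp add: g_def moebius_def)
    also have "\<dots> = \<i> * cnj (of_int c * \<i> + 1) / of_real ((norm (of_int c * \<i> + 1))\<^sup>2)"
      by (subst complex_div_cnj) simp
    finally have "Im (g \<i>) = Im (\<i> * cnj (of_int c * \<i> + 1)) / (norm (of_int c * \<i> + 1))\<^sup>2"
      by (simp only: Im_divide_of_real)
    moreover have "of_int c * \<i> + 1 \<noteq> 0" by (auto simp: complex_eq_iff)
    ultimately show ?thesis by simp
  qed
  have "T (g \<i>) = (of_int c * \<i> + 1) ^ k * T \<i>"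
    unfolding T_def sum_distrib_left[of "(of_int c * \<i> + 1) ^ k" _ "{g. g dvd l}"]
  proof (intro sum.cong refl)
    fix x assume "x \<in> {g. g dvd l}"
    hence xl: "x * (l div x) = l" by simp
    have "(\<Sum>b<l div x. f ((of_nat x * g \<i> + of_nat b) / of_nat (l div x))) =
        (of_int c * \<i> + 1) ^ k * (\<Sum>b<l div x. f ((of_nat x * \<i> + of_nat b) / of_nat (l div x)))"
      unfolding sum_distrib_left by (intro sum.cong refl tr[OF _ xl]) simp
    thus "chi (int x) * of_nat x ^ (k - 1) * inverse (of_nat (l div x)) * (\<Sum>b<l div x. f ((of_nat x * g \<i> + of_nat b) / of_nat (l div x))) =
      (of_int c * \<i> + 1) ^ k * (chi (int x) * of_nat x ^ (k - 1) * inverse (of_nat (l div x)) *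
        (\<Sum>b<l div x. f ((of_nat x * \<i> + of_nat b) / of_nat (l div x))))"
      by (simp add: mult_ac)
  qed
  moreover have "f (g \<i>) = (of_int c * \<i> + 1) ^ k * f \<i>"
  proof -
    have "f (int_moebius 1 0 c 1 \<i>) = chi 1 * (of_int c * \<i> + of_int 1) ^ k * f \<i>"
      by (rule f_modular) (simp_all add: c_def)
    thus ?thesis using dirichlet_character_1[OF char] by (simp add: g_def)
  qed
  ultimately have "C = (of_int c * \<i> + 1) ^ k * C"
    using const[OF gi] const[of \<i>] by (simp add: algebra_simps)
  moreover have "(of_int c * \<i> + 1) ^ k \<noteq> (1 :: complex)"
  proof
    assume "(of_int c * \<i> + 1) ^ k = (1 :: complex)"
    hence "norm (of_int c * \<i> + 1 :: complex) ^ k = 1" by (metis norm_one norm_power)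
    moreover have "norm (of_int c * \<i> + 1 :: complex) > 1"
    proof -
      have "real_of_int c \<noteq> 0" using N_pos l by (simp add: c_def)
      hence "1 < sqrt (1 + (real_of_int c)\<^sup>2)" by simp
      thus ?thesis by (simp add: cmod_def)
    qed
    ultimately show False using one_less_power[of "norm (of_int c * \<i> + 1 :: complex)" k] k_pos by simp
  qed
  ultimately have "C = 0" by (metis mult_cancel_right1)
  thus ?thesis by (simp add: C_def)
qed

text \<open>The coefficient sums of the brackets contain pairs with one index 0, for which
  \<open>hecke_constant_term\<close> supplies the relation. For two zero indices the divisor sum
  would be infinite.\<close>

lemma hecke_relation_ext:
  assumes "x \<noteq> 0 \<or> y \<noteq> 0"
  shows "a x * a y = (\<Sum>g | g dvd gcd x y. chi (int g) * of_nat g ^ (k - 1) * a ((x div g) * (y div g)))"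
proof -
  have "a x * a y = (\<Sum>g | g dvd gcd x y. chi (int g) * of_nat g ^ (k - 1) * a (x * y div g\<^sup>2))"
  proof (cases "x = 0 \<or> y = 0")
    case True
    thus ?thesis using assms hecke_constant_term[of x] hecke_constant_term[of y] by (auto simp: mult.commute)
  next
    case False
    thus ?thesis using hecke_relation[of x y] by simp
  qed
  also have "\<dots> = (\<Sum>g | g dvd gcd x y. chi (int g) * of_nat g ^ (k - 1) * a ((x div g) * (y div g)))"
    by (intro sum.cong refl) (auto simp: power2_eq_square div_mult_div_if_dvd)
  finally show ?thesis .
qed

text \<open>Every divisor \<open>g > 1\<close> of \<open>t\<close> shares a factor with
  \<open>N\<close>, so \<open>chi\<close> leaves only the term \<open>g = 1\<close>.\<close>

lemma a_mult_level:
  assumes "t > 0" "t dvd N"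
  shows "a (t * x) = a t * a x"
proof -
  have chi0: "chi (int g) = 0" if "g dvd t" "g \<noteq> 1" for g
  proof -
    have "g dvd N" using that assms dvd_trans by blast
    hence "\<not> coprime (int g) (int N)" using that(2) by (metis coprime_absorb_left coprime_int_iff nat_dvd_1_iff_1)
    thus ?thesis by (simp add: chi_eq_0_iff)
  qed
  have "a t * a x = (\<Sum>g | g dvd gcd t x. chi (int g) * of_nat g ^ (k - 1) * a ((t div g) * (x div g)))"
    by (rule hecke_relation_ext) (use assms in auto)
  also have "\<dots> = (\<Sum>g\<in>{1}. chi (int g) * of_nat g ^ (k - 1) * a ((t div g) * (x div g)))"
    by (rule sum.mono_neutral_right) (use assms chi0 in auto)
  also have "\<dots> = a (t * x)" using dirichlet_character_1[OF char] by simp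
  finally show ?thesis ..
qed

end
subsection \<open>Comparison of coefficients\<close>

lemma coprime_iff_prime_factors:
  fixes g e :: nat
  assumes "e > 0"
  shows "coprime g e \<longleftrightarrow> (\<forall>q\<in>prime_factors e. \<not> q dvd g)"
proof
  assume c: "coprime g e"
  show "\<forall>q\<in>prime_factors e. \<not> q dvd g"
  proof
    fix q assume "q \<in> prime_factors e"
    hence "prime q" "q dvd e" by auto
    thus "\<not> q dvd g" using coprime_common_divisor_nat[OF c, of q] by auto
  qed
next
  assume *: "\<forall>q\<in>prime_factors e. \<not> q dvd g"
  show "coprime g e"
  proof (rule ccontr)
    assume "\<not> coprime g e"
    hence "gcd g e \<noteq> 1" using coprime_iff_gcd_eq_1 by blast
    then obtain q where q: "prime q" "q dvd gcd g e" using prime_factor_nat by blast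
    hence "q \<in> prime_factors e" using assms by (auto simp: in_prime_factors_iff)
    thus False using * q by auto
  qed
qed

text \<open>The doubled quotient need not be square-free, but \<open>euler_op\<close> sees only the
  set of its primes.\<close>

lemma prime_factors_rad:
  assumes "M > 0" "e dvd M"
  shows "prime_factors (rad M div rad e) = prime_factors M - prime_factors e"
    and "prime_factors (2 * rad M div rad e) = insert 2 (prime_factors M - prime_factors e)"
proof -
  define D where "D = prime_factors M - prime_factors e"
  have sub: "prime_factors e \<subseteq> prime_factors M" using assms by (intro dvd_prime_factors) auto
  have "rad M = \<Prod>D * rad e"
    unfolding rad_def D_def by (rule prod.subset_diff[OF sub]) simp
  moreover have "rad e > 0" unfolding rad_def
    by (rule prod_pos) (meson in_prime_factors_imp_prime prime_gt_0_nat)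
  ultimately have eq: "rad M div rad e = \<Prod>D" "2 * rad M div rad e = 2 * \<Prod>D" by simp_all
  have nz: "0 \<notin> (\<lambda>x. x) ` D" by (auto simp: D_def)
  have "prime_factors (\<Prod>D) = \<Union> ((prime_factors \<circ> (\<lambda>x. x)) ` D)"
    by (rule prime_factors_prod[OF _ nz]) (simp add: D_def)
  also have "\<dots> = (\<Union>p\<in>D. {p})"
  proof (intro SUP_cong refl)
    fix p assume "p \<in> D"
    hence "prime p" using in_prime_factors_imp_prime[of p M] by (simp add: D_def)
    thus "(prime_factors \<circ> (\<lambda>x. x)) p = {p}" using prime_prime_factors[of p] by simp
  qed
  finally have pf: "prime_factors (\<Prod>D) = D" by simp
  thus "prime_factors (rad M div rad e) = prime_factors M - prime_factors e"
    unfolding eq(1) by (simp add: D_def)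
  have "\<Prod>D \<noteq> 0" using nz by (simp add: D_def)
  hence "prime_factors (2 * \<Prod>D) = prime_factors 2 \<union> prime_factors (\<Prod>D)"
    by (intro prime_factors_product) auto
  also have "\<dots> = insert 2 D" unfolding pf using prime_prime_factors[OF two_is_prime_nat] by simp
  finally show "prime_factors (2 * rad M div rad e) = insert 2 (prime_factors M - prime_factors e)"
    unfolding eq(2) D_def .
qed

lemma finite_int_square_roots: "finite {s::int. s\<^sup>2 = x}"
proof (rule finite_subset)
  show "{s::int. s\<^sup>2 = x} \<subseteq> {- x..x}"
  proof
    fix s assume "s \<in> {s::int. s\<^sup>2 = x}"
    thus "s \<in> {- x..x}" using abs_le_square_int[of s] by auto
  qed
qed simp

text \<open>Since \<open>t\<close> is square-free, \<open>4 | t (n\<^sup>2 - s\<^sup>2)\<close> forces \<open>s \<equiv> n\<close> modulo \<open>2\<close>.\<close>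

lemma square_decomposition:
  fixes i n t r :: nat and s :: int
  assumes t: "t > 0" "squarefree t" "coprime t r"
    and r: "4 * r dvd i" and s: "int i = int t * ((int n)\<^sup>2 - s\<^sup>2)"
  obtains u where "u \<le> n" "s = int n - 2 * int u" "i = 4 * (t * (u * (n - u)))" "r dvd u * (n - u)"
proof -
  have "int t * ((int n)\<^sup>2 - s\<^sup>2) \<ge> 0" using s by (metis of_nat_0_le_iff)
  hence "s\<^sup>2 \<le> (int n)\<^sup>2" using t(1) by (simp add: zero_le_mult_iff)
  hence sn: "\<bar>s\<bar> \<le> int n" by (simp add: abs_le_square_iff[symmetric])
  have fac: "int i = int t * ((int n - s) * (int n + s))"
    unfolding s by (simp add: power2_eq_square algebra_simps)
  have "even (int n - s)"
  proof (rule ccontr)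
    assume o: "odd (int n - s)"
    hence "odd ((int n - s) * (int n + s))" by simp
    hence "coprime 2 ((int n - s) * (int n + s))" by (rule iffD2[OF coprime_left_2_iff_odd])
    hence "coprime (2 ^ 2) ((int n - s) * (int n + s))" by (simp only: coprime_power_left_iff simp_thms)
    moreover have "int 4 dvd int i" using r by (metis dvd_mult_left of_nat_dvd_iff)
    hence "2 ^ 2 dvd int t * ((int n - s) * (int n + s))" using fac by simp
    ultimately have "2 ^ 2 dvd int t" using coprime_dvd_mult_left_iff by blast
    hence "int (2 ^ 2) dvd int t" by simp
    hence "2 ^ 2 dvd t" by (simp only: of_nat_dvd_iff)
    thus False using t(2) unfolding squarefree_def by (metis nat_dvd_1_iff_1 numeral_eq_one_iff semiring_norm(85))
  qed
  then obtain x where x: "int n - s = 2 * x" by (rule evenE)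
  define u where "u = nat x"
  have xu: "x = int u" using x sn by (simp add: u_def)
  have un: "u \<le> n" using x xu sn by linarith
  have su: "s = int n - 2 * int u" using x xu by simp
  have "int n + s = 2 * int (n - u)" using su un by simp
  hence "int i = int t * ((2 * int u) * (2 * int (n - u)))" using fac x xu by simp
  hence "int i = int (4 * (t * (u * (n - u))))" by simp
  hence i: "i = 4 * (t * (u * (n - u)))" by (simp only: of_nat_eq_iff)
  hence "r dvd t * (u * (n - u))" using r by simp
  hence "r dvd u * (n - u)" using t(3) by (simp add: coprime_dvd_mult_right_iff coprime_commute)
  thus ?thesis using that un su i by blast
qed

text \<open>The origin of the sum over \<open>d dvd r\<close>: with \<open>d = gcd v r\<close>, the
  number \<open>v div d\<close> is prime to \<open>r div d\<close>, so divisibility of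
  \<open>u * v\<close> by \<open>r\<close> becomes a condition on \<open>u\<close> alone, and each
  pair belongs to exactly one \<open>d\<close>.\<close>

lemma dvd_mult_iff_gcd:
  fixes r u v :: nat
  assumes "r > 0"
  shows "r dvd u * v \<longleftrightarrow> r div gcd v r dvd u"
    and "r div gcd v r dvd u \<Longrightarrow> u * v div r = (u div (r div gcd v r)) * (v div gcd v r)"
proof -
  define d where "d = gcd v r"
  have d0: "d > 0" using assms by (simp add: d_def)
  have "gcd v r \<noteq> 0" using assms by simp
  from gcd_coprime_exists[OF this] obtain v1 e where ve: "v = v1 * d" "r = e * d" "coprime v1 e"
    unfolding d_def by blast
  have e: "r div d = e" "v div d = v1" using ve d0 by simp_all
  have "r dvd u * v \<longleftrightarrow> e * d dvd (u * v1) * d" unfolding ve by (simp add: mult_ac)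
  also have "\<dots> \<longleftrightarrow> e dvd u * v1" using d0 by simp
  also have "\<dots> \<longleftrightarrow> e dvd u" using ve(3) by (simp add: coprime_dvd_mult_left_iff coprime_commute)
  finally show "r dvd u * v \<longleftrightarrow> r div gcd v r dvd u" using e by (simp add: d_def)
  show "u * v div r = (u div (r div gcd v r)) * (v div gcd v r)" if "r div gcd v r dvd u"
  proof -
    have "e dvd u" using that e by (simp add: d_def)
    then obtain x where x: "u = e * x" by (rule dvdE)
    have e0: "e > 0" using assms ve by (auto intro: Nat.gr0I)
    have "u * v = (x * v1) * r" unfolding x ve by (simp add: mult_ac)
    hence "u * v div r = x * v1" using assms by simp
    thus ?thesis unfolding d_def[symmetric] e x using e0 by simp
  qed
qed

text \<open>For a pair \<open>(g * u, g * v)\<close> occurring in a divisor bracket with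
  \<open>g\<close> in its Hecke relation, the conditions separate: one on \<open>(u, v)\<close> that
  no longer involves \<open>g\<close>, and coprimality of \<open>g\<close> to \<open>e\<close>. The
  latter is the sieve.\<close>

lemma pair_condition_scale:
  fixes g u v d e :: nat
  assumes "g > 0" "d > 0" "e > 0"
  shows "(e dvd g * u \<and> d dvd g * v \<and> coprime (g * v div d) e \<and> g dvd g * u div e \<and> g dvd g * v div d) \<longleftrightarrow>
         (e dvd u \<and> gcd v (e * d) = d \<and> coprime g e)"
proof
  assume *: "e dvd g * u \<and> d dvd g * v \<and> coprime (g * v div d) e \<and> g dvd g * u div e \<and> g dvd g * v div d"
  obtain x where "g * u div e = g * x" using * by (auto elim: dvdE)
  hence "g * u = g * (x * e)" using * by (metis dvd_div_mult_self mult.assoc)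
  hence u: "u = x * e" using assms by simp
  obtain y where y: "g * v div d = g * y" using * by (auto elim: dvdE)
  hence "g * v = g * (y * d)" using * by (metis dvd_div_mult_self mult.assoc)
  hence v: "v = y * d" using assms by simp
  have "coprime (g * y) e" using * y by simp
  hence "coprime g e" "coprime y e" by simp_all
  moreover have "gcd v (e * d) = d * gcd y e" unfolding v by (metis gcd_mult_distrib_nat mult.commute)
  ultimately show "e dvd u \<and> gcd v (e * d) = d \<and> coprime g e" using u by (simp add: coprime_imp_gcd_eq_1)
next
  assume *: "e dvd u \<and> gcd v (e * d) = d \<and> coprime g e"
  obtain x where u: "u = e * x" using * by (auto elim: dvdE)
  have "d dvd v" using * by (metis gcd_dvd1)
  then obtain y where v: "v = d * y" by (auto elim: dvdE)
  have "d * gcd y e = d * 1" using * unfolding v by (metis gcd_mult_distrib_nat mult.commute mult.right_neutral)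
  hence "gcd y e = 1" using assms by simp
  hence "coprime y e" by (rule gcd_eq_1_imp_coprime)
  moreover have "g * u div e = g * x" "g * v div d = g * y"
    unfolding u v using assms by (simp_all add: mult.left_commute[of g])
  ultimately show "e dvd g * u \<and> d dvd g * v \<and> coprime (g * v div d) e \<and> g dvd g * u div e \<and> g dvd g * v div d"
    using * u v by simp
qed

section \<open>Sorting pairs by divisors; coefficients of brackets and lift\<close>

context eigenform
begin

text \<open>Up to the common constant, the contribution of \<open>gcd (m - u) r = d\<close> to the
  theta bracket coefficient at \<open>t * m\<^sup>2\<close>. The argument of \<open>a\<close> is
  \<open>u * (m - u) / r\<close>, written as a product of two exact quotients.\<close>

definition pair_sum :: "nat \<Rightarrow> nat \<Rightarrow> nat \<Rightarrow> nat \<Rightarrow> complex" where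
  "pair_sum w r d m = (\<Sum>u | u \<le> m \<and> r div d dvd u \<and> gcd (m - u) r = d.
     a ((u div (r div d)) * ((m - u) div d)) * rc_poly (real k) (real k) (2 * w) (of_nat u) (of_nat (m - u)))"

text \<open>The exponent is \<open>k - 1\<close> from the Hecke relations plus \<open>2 * w\<close>,
  the degree of the bracket polynomial, which scales when a pair is divided by \<open>g\<close>. It
  is also the exponent \<open>K - 1\<close> of the lift for \<open>K = k + 2 * w\<close>.\<close>

definition psi :: "nat \<Rightarrow> nat \<Rightarrow> complex" where
  "psi w g = chi (int g) * of_nat g ^ (k + 2 * w - 1)"

lemma psi_mult: "psi w (m * n) = psi w m * psi w n"
  by (simp add: psi_def chi_mult power_mult_distrib)

lemma twist_expansion:
  "has_q_expansion (twist (trivial_character m) f) (\<lambda>n. trivial_character m (int n) * a n)"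
  unfolding twist_def q_coeffs_eq[OF f_q_expansion]
  by (rule has_q_expansion_q_series[OF f_q_expansion]) (simp add: trivial_character_def)

lemma divisor_bracket_expansion:
  assumes "d dvd r" "r > 0"
  shows "has_q_expansion (divisor_bracket k f w r d)
    (\<lambda>n. \<Sum>u | u \<le> n \<and> r div d dvd u \<and> d dvd n - u \<and> coprime ((n - u) div d) (r div d).
        a (u div (r div d)) * a ((n - u) div d) * rc_poly (real k) (real k) w (of_nat u) (of_nat (n - u)))"
proof -
  define e where "e = r div d"
  have r: "r = e * d" using assms by (simp add: e_def)
  have pos: "d > 0" "e > 0" using assms r by (auto intro: Nat.gr0I)
  have fe: "(\<lambda>z. f (of_nat r * z / of_nat d)) = (\<lambda>z. f (of_nat e * z))"
    using pos unfolding r by (auto simp: fun_eq_iff)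
  have "has_q_expansion (divisor_bracket k f w r d)
     (\<lambda>n. \<Sum>i\<le>n. (if e dvd i then a (i div e) else 0) *
        (if d dvd n - i then trivial_character e (int ((n - i) div d)) * a ((n - i) div d) else 0) *
        rc_poly (real k) (real k) w (of_nat i) (of_nat (n - i)))"
    unfolding divisor_bracket_def fe e_def[symmetric]
    by (intro has_q_expansion_rankin_cohen has_q_expansion_dilate f_q_expansion pos
          has_q_expansion_dilate[where F = "twist (trivial_character e) f"] twist_expansion)
  thus ?thesis
  proof (rule has_q_expansion_cong)
    fix n
    have "(\<Sum>i\<le>n. (if e dvd i then a (i div e) else 0) *
        (if d dvd n - i then trivial_character e (int ((n - i) div d)) * a ((n - i) div d) else 0) *
        rc_poly (real k) (real k) w (of_nat i) (of_nat (n - i))) =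
      (\<Sum>i\<le>n. if e dvd i \<and> d dvd n - i \<and> coprime ((n - i) div d) e then
         a (i div e) * a ((n - i) div d) * rc_poly (real k) (real k) w (of_nat i) (of_nat (n - i)) else 0)"
      by (intro sum.cong refl) (auto simp: trivial_character_def)
    also have "\<dots> = (\<Sum>u\<in>{u\<in>{..n}. e dvd u \<and> d dvd n - u \<and> coprime ((n - u) div d) e}.
         a (u div e) * a ((n - u) div d) * rc_poly (real k) (real k) w (of_nat u) (of_nat (n - u)))"
      by (rule sum.inter_filter[symmetric]) simp
    finally show "(\<Sum>i\<le>n. (if e dvd i then a (i div e) else 0) *
        (if d dvd n - i then trivial_character e (int ((n - i) div d)) * a ((n - i) div d) else 0) *
        rc_poly (real k) (real k) w (of_nat i) (of_nat (n - i))) =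
      (\<Sum>u | u \<le> n \<and> r div d dvd u \<and> d dvd n - u \<and> coprime ((n - u) div d) (r div d).
        a (u div (r div d)) * a ((n - u) div d) * rc_poly (real k) (real k) w (of_nat u) (of_nat (n - u)))"
      unfolding e_def[symmetric] by (simp add: conj_ac)
  qed simp
qed

text \<open>After the Hecke relations, the pair is divided by \<open>g\<close> and the two sums are
  exchanged. The sieve at the primes of \<open>r div d\<close> is the trace left by the trivial
  character in the twisted factor.\<close>

lemma divisor_bracket_coeff_sieved:
  assumes "d dvd r" "r > 0" "n > 0"
  shows "(\<Sum>u | u \<le> n \<and> r div d dvd u \<and> d dvd n - u \<and> coprime ((n - u) div d) (r div d).
        a (u div (r div d)) * a ((n - u) div d) * rc_poly (real k) (real k) (2 * w) (of_nat u) (of_nat (n - u))) =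
    sieved (prime_factors (r div d)) (psi w) (pair_sum w r d) n"
proof -
  define e where "e = r div d"
  have r: "r = e * d" using assms by (simp add: e_def)
  have pos: "d > 0" "e > 0" using assms r by (auto intro: Nat.gr0I)
  define Q where "Q u v = rc_poly (real k) (real k) (2 * w) (of_nat u) (of_nat v)" for u v :: nat
  define U where "U = {u. u \<le> n \<and> e dvd u \<and> d dvd n - u \<and> coprime ((n - u) div d) e}"
  define G where "G u = {g. g dvd gcd (u div e) ((n - u) div d)}" for u
  define A where "A = {g. g dvd n \<and> coprime g e}"
  define V where "V g = {u. u \<le> n div g \<and> e dvd u \<and> gcd (n div g - u) r = d}" for g
  have finU: "finite U" by (rule finite_subset[of _ "{..n}"]) (auto simp: U_def)
  have nz: "u div e \<noteq> 0 \<or> (n - u) div d \<noteq> 0" if "u \<in> U" for u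
    using that assms(3) pos by (auto simp: U_def dvd_div_eq_0_iff)
  have finG: "finite (G u)" if "u \<in> U" for u
    unfolding G_def using nz[OF that] by (intro finite_divisors_nat) (auto intro!: Nat.gr0I)
  have finA: "finite A" by (rule finite_subset[OF _ finite_divisors_nat[OF assms(3)]]) (auto simp: A_def)
  have finV: "finite (V g)" for g by (rule finite_subset[of _ "{..n div g}"]) (auto simp: V_def)
  have "(\<Sum>u\<in>U. a (u div e) * a ((n - u) div d) * Q u (n - u)) =
      (\<Sum>u\<in>U. \<Sum>g\<in>G u. chi (int g) * of_nat g ^ (k - 1) * a ((u div e div g) * ((n - u) div d div g)) * Q u (n - u))"
    by (intro sum.cong refl, subst hecke_relation_ext[OF nz]) (simp_all add: G_def sum_distrib_right)
  also have "\<dots> = (\<Sum>(u, g)\<in>Sigma U G. chi (int g) * of_nat g ^ (k - 1) * a ((u div e div g) * ((n - u) div d div g)) * Q u (n - u))"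
    by (rule sum.Sigma) (use finU finG in auto)
  also have "\<dots> = (\<Sum>(g, u)\<in>Sigma A V. psi w g * (a ((u div e) * ((n div g - u) div d)) * Q u (n div g - u)))"
  proof (rule sum.reindex_bij_witness[of _ "\<lambda>(g, u). (g * u, g)" "\<lambda>(u, g). (g, u div g)"])
    fix p assume "p \<in> Sigma U G"
    then obtain u g where p: "p = (u, g)" "u \<in> U" "g \<in> G u" by auto
    have ud: "u \<le> n" "e dvd u" "d dvd n - u" "coprime ((n - u) div d) e" using p(2) by (auto simp: U_def)
    have gd: "g dvd u div e" "g dvd (n - u) div d" using p(3) by (auto simp: G_def)
    have g0: "g > 0" using nz[OF p(2)] gd by (auto intro: Nat.gr0I)
    have "g dvd u" using gd(1) ud(2) by (metis dvd_div_mult_self dvd_mult2)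
    then obtain u' where u': "u = g * u'" by (auto elim: dvdE)
    have "g dvd n - u" using gd(2) ud(3) by (metis dvd_div_mult_self dvd_mult2)
    then obtain v' where v': "n - u = g * v'" by (auto elim: dvdE)
    have n: "n = g * (u' + v')" using u' v' ud(1) by (simp add: distrib_left)
    have nu: "n div g - u' = v'" using n g0 by simp
    have cond: "e dvd u' \<and> gcd v' (e * d) = d \<and> coprime g e"
      using pair_condition_scale[OF g0 pos, of u' v'] ud gd unfolding u'[symmetric] v'[symmetric] by blast
    show "(case case p of (u, g) \<Rightarrow> (g, u div g) of (g, u) \<Rightarrow> (g * u, g)) = p"
      using u' g0 by (simp add: p)
    show "(case p of (u, g) \<Rightarrow> (g, u div g)) \<in> Sigma A V"
      using cond n nu g0 by (simp add: p u' A_def V_def r)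
    have gdiv: "g * x div y div g = x div y" for x y
      using g0 by (simp add: div_mult2_eq[symmetric] mult.commute[of _ g])
    have x: "u div e div g = u' div e" "(n - u) div d div g = v' div d"
      using gdiv[of u' e] gdiv[of v' d] by (simp_all only: u'[symmetric] v'[symmetric])
    have "Q u (n - u) = of_nat g ^ (2 * w) * Q u' v'"
      unfolding v' unfolding Q_def u' of_nat_mult by (rule rc_poly_homogeneous)
    moreover have "k + 2 * w - 1 = (k - 1) + 2 * w" using k_pos by simp
    ultimately have "chi (int g) * of_nat g ^ (k - 1) * a ((u div e div g) * ((n - u) div d div g)) * Q u (n - u) =
        psi w g * (a ((u' div e) * (v' div d)) * Q u' v')"
      unfolding x psi_def by (simp add: power_add mult_ac)
    thus "(case case p of (u, g) \<Rightarrow> (g, u div g) of (g, u) \<Rightarrow> psi w g * (a ((u div e) * ((n div g - u) div d)) * Q u (n div g - u))) =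
        (case p of (u, g) \<Rightarrow> chi (int g) * of_nat g ^ (k - 1) * a ((u div e div g) * ((n - u) div d div g)) * Q u (n - u))"
      using g0 by (simp add: p u' nu)
  next
    fix p assume "p \<in> Sigma A V"
    then obtain g u' where p: "p = (g, u')" "g \<in> A" "u' \<in> V g" by auto
    have gn: "g dvd n" "coprime g e" using p(2) by (auto simp: A_def)
    have g0: "g > 0" using gn(1) assms(3) by (auto intro: Nat.gr0I)
    have ud: "u' \<le> n div g" "e dvd u'" "gcd (n div g - u') r = d" using p(3) by (auto simp: V_def)
    define v' where "v' = n div g - u'"
    have n: "n = g * (u' + v')" using gn(1) ud(1) by (simp add: v'_def)
    have nv: "n - g * u' = g * v'" using n by (simp add: distrib_left)
    have cond: "e dvd g * u' \<and> d dvd g * v' \<and> coprime (g * v' div d) e \<and> g dvd g * u' div e \<and> g dvd g * v' div d"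
      using pair_condition_scale[OF g0 pos, of u' v'] ud gn unfolding v'_def r by blast
    show "(case case p of (g, u) \<Rightarrow> (g * u, g) of (u, g) \<Rightarrow> (g, u div g)) = p" using g0 by (simp add: p)
    show "(case p of (g, u) \<Rightarrow> (g * u, g)) \<in> Sigma U G"
    proof -
      have "g * u' \<le> n" using n by simp
      thus ?thesis using cond unfolding p U_def G_def by (simp add: nv)
    qed
  qed
  also have "\<dots> = (\<Sum>g\<in>A. \<Sum>u\<in>V g. psi w g * (a ((u div e) * ((n div g - u) div d)) * Q u (n div g - u)))"
    by (rule sum.Sigma[symmetric]) (use finA finV in auto)
  also have "\<dots> = (\<Sum>g\<in>A. psi w g * pair_sum w r d (n div g))"
    unfolding pair_sum_def sum_distrib_left e_def[symmetric] V_def Q_def ..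
  also have "\<dots> = sieved (prime_factors e) (psi w) (pair_sum w r d) n"
    unfolding sieved_def A_def coprime_iff_prime_factors[OF pos(2)] ..
  finally show ?thesis unfolding U_def Q_def e_def .
qed

lemma sum_pair_sum:
  assumes "r > 0"
  shows "(\<Sum>d | d dvd r. pair_sum w r d n) = (\<Sum>u | u \<le> n \<and> r dvd u * (n - u).
     a (u * (n - u) div r) * rc_poly (real k) (real k) (2 * w) (of_nat u) (of_nat (n - u)))"
proof -
  define V where "V d = {u. u \<le> n \<and> r div d dvd u \<and> gcd (n - u) r = d}" for d
  have "(\<Sum>d | d dvd r. pair_sum w r d n) =
      (\<Sum>(d, u)\<in>Sigma {d. d dvd r} V. a ((u div (r div d)) * ((n - u) div d)) *
         rc_poly (real k) (real k) (2 * w) (of_nat u) (of_nat (n - u)))"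
    unfolding pair_sum_def V_def[symmetric]
    by (rule sum.Sigma) (use assms in \<open>auto simp: V_def intro: finite_divisors_nat\<close>)
  also have "\<dots> = (\<Sum>u | u \<le> n \<and> r dvd u * (n - u).
     a (u * (n - u) div r) * rc_poly (real k) (real k) (2 * w) (of_nat u) (of_nat (n - u)))"
    by (rule sum.reindex_bij_witness[of _ "\<lambda>u. (gcd (n - u) r, u)" "\<lambda>(d, u). u"])
       (auto simp: V_def dvd_mult_iff_gcd[OF assms])
  finally show ?thesis .
qed

lemma theta_bracket_expansion:
  assumes "r > 0" "t > 0"
  shows "has_q_expansion (theta_bracket k f w r t)
    (\<lambda>m. \<Sum>i\<le>m. (if 4 * r dvd i then a (i div (4 * r)) else 0) *
       (if t dvd m - i then of_nat (card {s::int. s\<^sup>2 = int ((m - i) div t)}) else 0) *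
       rc_poly (real k) (1/2) w (of_nat i) (of_nat (m - i)))"
  unfolding theta_bracket_def
  by (intro has_q_expansion_rankin_cohen has_q_expansion_dilate[OF f_q_expansion]
        has_q_expansion_dilate[OF theta_q_expansion]) (use assms in auto)

text \<open>The number of square roots in the coefficient of theta is spread out as a sum over the
  roots \<open>s\<close> themselves, so that each \<open>(i, s)\<close> corresponds to a single
  \<open>u\<close> with \<open>s = n - 2 * u\<close>; opposite roots give the pairs
  \<open>(u, v)\<close> and \<open>(v, u)\<close>.\<close>

lemma theta_bracket_coeff_square:
  assumes r: "r > 0" and t: "t > 0" "squarefree t" "coprime t r" "t dvd N"
  shows "q_coeffs (theta_bracket k f w r t) (t * n\<^sup>2) =
    of_nat ((2 * w) choose w) * inverse (of_nat ((k + 2 * w - 1) choose (k + w - 1))) * a t * of_nat t ^ w *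
    (\<Sum>d | d dvd r. pair_sum w r d n)"
proof -
  define m where "m = t * n\<^sup>2"
  define R where "R x y = rc_poly (real k) (1/2) w x y" for x y
  define I where "I = {i. i \<le> m \<and> 4 * r dvd i \<and> t dvd m - i}"
  define B where "B i = {s::int. s\<^sup>2 = int ((m - i) div t)}" for i
  have "q_coeffs (theta_bracket k f w r t) m =
      (\<Sum>i\<le>m. (if 4 * r dvd i then a (i div (4 * r)) else 0) *
       (if t dvd m - i then of_nat (card (B i)) else 0) * R (of_nat i) (of_nat (m - i)))"
    unfolding q_coeffs_eq[OF theta_bracket_expansion[OF r t(1)]] B_def R_def ..
  also have "\<dots> = (\<Sum>i\<le>m. if 4 * r dvd i \<and> t dvd m - i then
      \<Sum>s\<in>B i. a (i div (4 * r)) * R (of_nat i) (of_nat (m - i)) else 0)"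
    by (intro sum.cong refl) (auto simp: mult_ac)
  also have "\<dots> = (\<Sum>i\<in>{i\<in>{..m}. 4 * r dvd i \<and> t dvd m - i}. \<Sum>s\<in>B i. a (i div (4 * r)) * R (of_nat i) (of_nat (m - i)))"
    by (rule sum.inter_filter[symmetric]) simp
  also have "{i\<in>{..m}. 4 * r dvd i \<and> t dvd m - i} = I" by (auto simp: I_def)
  also have "(\<Sum>i\<in>I. \<Sum>s\<in>B i. a (i div (4 * r)) * R (of_nat i) (of_nat (m - i))) =
      (\<Sum>(i, s)\<in>Sigma I B. a (i div (4 * r)) * R (of_nat i) (of_nat (m - i)))"
    by (rule sum.Sigma) (auto simp: I_def B_def finite_int_square_roots)
  also have "\<dots> = (\<Sum>u | u \<le> n \<and> r dvd u * (n - u).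
      a (t * (u * (n - u) div r)) * R (of_nat t * (4 * (of_nat u * of_nat (n - u)))) (of_nat t * (of_nat u - of_nat (n - u))\<^sup>2))"
  proof (rule sum.reindex_bij_witness[of _ "\<lambda>u. (4 * (t * (u * (n - u))), int n - 2 * int u)" "\<lambda>(i, s). nat ((int n - s) div 2)"])
    fix p assume "p \<in> Sigma I B"
    then obtain i s where p: "p = (i, s)" "i \<in> I" "s \<in> B i" by auto
    have i: "i \<le> m" "4 * r dvd i" "t dvd m - i" using p(2) by (auto simp: I_def)
    have "int (m - i) = int t * s\<^sup>2" using p(3) i(3) by (simp add: B_def flip: of_nat_mult)
    hence "int i = int t * ((int n)\<^sup>2 - s\<^sup>2)" using i(1) by (simp add: m_def of_nat_diff algebra_simps)
    then obtain u where u: "u \<le> n" "s = int n - 2 * int u" "i = 4 * (t * (u * (n - u)))" "r dvd u * (n - u)"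
      using square_decomposition[OF t(1-3) i(2)] by blast
    have j: "nat ((int n - s) div 2) = u" using u(2) by simp
    show "(case case p of (i, s) \<Rightarrow> nat ((int n - s) div 2) of u \<Rightarrow> (4 * (t * (u * (n - u))), int n - 2 * int u)) = p"
      using j u by (simp add: p)
    show "(case p of (i, s) \<Rightarrow> nat ((int n - s) div 2)) \<in> {u. u \<le> n \<and> r dvd u * (n - u)}"
      using j u by (simp add: p)
    obtain x where x: "u * (n - u) = r * x" using u(4) by (auto elim: dvdE)
    have ai: "i div (4 * r) = t * (u * (n - u) div r)"
    proof -
      have "i = (4 * r) * (t * x)" using u(3) x by simp
      thus ?thesis using x r by simp
    qed
    have mi: "complex_of_nat (m - i) = of_nat t * (of_nat u - of_nat (n - u))\<^sup>2"
    proof -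
      have "complex_of_nat (m - i) = of_int (int (m - i))" by simp
      also have "\<dots> = of_nat t * (of_int s)\<^sup>2" unfolding \<open>int (m - i) = int t * s\<^sup>2\<close> by simp
      also have "complex_of_int s = of_nat (n - u) - of_nat u" using u(1,2) by (simp add: of_nat_diff)
      finally show ?thesis by (simp add: power2_commute)
    qed
    show "a (t * ((case p of (i, s) \<Rightarrow> nat ((int n - s) div 2)) * (n - (case p of (i, s) \<Rightarrow> nat ((int n - s) div 2))) div r)) *
        R (of_nat t * (4 * (of_nat (case p of (i, s) \<Rightarrow> nat ((int n - s) div 2)) * of_nat (n - (case p of (i, s) \<Rightarrow> nat ((int n - s) div 2))))))
          (of_nat t * (of_nat (case p of (i, s) \<Rightarrow> nat ((int n - s) div 2)) - of_nat (n - (case p of (i, s) \<Rightarrow> nat ((int n - s) div 2))))\<^sup>2) =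
        (case p of (i, s) \<Rightarrow> a (i div (4 * r)) * R (of_nat i) (of_nat (m - i)))"
      unfolding p prod.case j ai mi unfolding u(3) by (simp add: mult_ac)
  next
    fix u assume "u \<in> {u. u \<le> n \<and> r dvd u * (n - u)}"
    hence u: "u \<le> n" "r dvd u * (n - u)" by auto
    show "(case (4 * (t * (u * (n - u))), int n - 2 * int u) of (i, s) \<Rightarrow> nat ((int n - s) div 2)) = u" by simp
    define v where "v = n - u"
    have n: "n = u + v" using u by (simp add: v_def)
    have sq: "int (n\<^sup>2) = int (4 * (u * v)) + (int n - 2 * int u)\<^sup>2" unfolding n by (simp add: power2_eq_square algebra_simps)
    have "int (4 * (u * v)) \<le> int (n\<^sup>2)" using sq by (metis add_increasing2 order_refl zero_le_power2)
    hence le: "4 * (u * v) \<le> n\<^sup>2" by (simp only: of_nat_le_iff)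
    have mi: "m - 4 * (t * (u * v)) = t * (n\<^sup>2 - 4 * (u * v))" by (simp add: m_def diff_mult_distrib2 mult_ac)
    have "int (n\<^sup>2 - 4 * (u * v)) = (int n - 2 * int u)\<^sup>2" using sq le by (simp only: of_nat_diff)
    moreover have "4 * (t * (u * v)) \<le> m" unfolding m_def using le by (simp add: mult.left_commute[of 4])
    moreover have "4 * r dvd 4 * (t * (u * v))" using u(2) unfolding v_def by (intro mult_dvd_mono) auto
    ultimately show "(4 * (t * (u * (n - u))), int n - 2 * int u) \<in> Sigma I B"
      unfolding v_def[symmetric] I_def B_def using t(1) by (simp add: mi)
  qed
  also have "\<dots> = (\<Sum>u | u \<le> n \<and> r dvd u * (n - u). of_nat ((2 * w) choose w) *
      inverse (of_nat ((k + 2 * w - 1) choose (k + w - 1))) * a t * of_nat t ^ w *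
      (a (u * (n - u) div r) * rc_poly (real k) (real k) (2 * w) (of_nat u) (of_nat (n - u))))"
  proof (intro sum.cong refl)
    fix u
    have "w \<le> k + 2 * w - 1" using k_pos by simp
    from binomial_symmetric[OF this]
    have "(k + 2 * w - 1) choose w = (k + 2 * w - 1) choose (k + 2 * w - 1 - w)" .
    moreover have "k + 2 * w - 1 - w = k + w - 1" by simp
    ultimately have sym: "(k + 2 * w - 1) choose (k + w - 1) = (k + 2 * w - 1) choose w" by (simp only:)
    have "(k + 2 * w - 1) choose w \<noteq> 0" using k_pos by (simp add: binomial_eq_0_iff)
    hence nz: "of_nat ((k + 2 * w - 1) choose w) \<noteq> (0 :: complex)" by simp
    have "R (4 * (of_nat u * of_nat (n - u))) ((of_nat u - of_nat (n - u))\<^sup>2) =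
        of_nat ((2 * w) choose w) * inverse (of_nat ((k + 2 * w - 1) choose w)) *
          rc_poly (real k) (real k) (2 * w) (of_nat u) (of_nat (n - u))"
      using rc_poly_identity[OF k_pos, of w "of_nat u" "of_nat (n - u)"] nz
      unfolding R_def by (simp add: field_simps)
    thus "a (t * (u * (n - u) div r)) * R (of_nat t * (4 * (of_nat u * of_nat (n - u)))) (of_nat t * (of_nat u - of_nat (n - u))\<^sup>2) =
      of_nat ((2 * w) choose w) * inverse (of_nat ((k + 2 * w - 1) choose (k + w - 1))) * a t * of_nat t ^ w *
      (a (u * (n - u) div r) * rc_poly (real k) (real k) (2 * w) (of_nat u) (of_nat (n - u)))"
      unfolding sym a_mult_level[OF t(1,4)] R_def rc_poly_homogeneous by (simp add: mult_ac)
  qed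
  finally show ?thesis unfolding m_def sum_pair_sum[OF r] sum_distrib_left .
qed

text \<open>The character of the lift multiplies that of the bracket by the same quadratic factors
  again, up to an even power. On \<open>d\<close> prime to \<open>M\<close>, hence odd and prime to
  \<open>t\<close>, they square to 1 and only \<open>chi\<close> remains;
  \<open>trivial_character M\<close> is the sieve.\<close>

lemma shimura_coeff_eq_sieved:
  assumes M: "M > 0" "4 * t dvd M" and t: "t > 0" and n: "n > 0"
  shows "shimura_coeff (k + 2 * w) M (\<lambda>n. chi n * quadratic_character (int t) n * chi_minus4 n ^ k) t b n =
    sieved (prime_factors M) (psi w) (\<lambda>m. b (t * m\<^sup>2)) n"
proof -
  have "shimura_coeff (k + 2 * w) M (\<lambda>n. chi n * quadratic_character (int t) n * chi_minus4 n ^ k) t b n =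
      (\<Sum>d | d dvd n. if coprime d M then psi w d * b (t * (n div d)\<^sup>2) else 0)"
    unfolding shimura_coeff_def if_not_P[OF n[THEN less_imp_neq, symmetric]]
  proof (intro sum.cong refl)
    fix d
    show "trivial_character M (int d) * (chi (int d) * quadratic_character (int t) (int d) * chi_minus4 (int d) ^ k) *
        chi_minus4 (int d) ^ (k + 2 * w) * quadratic_character (int t) (int d) * of_nat d ^ (k + 2 * w - 1) * b (t * (n div d)\<^sup>2) =
      (if coprime d M then psi w d * b (t * (n div d)\<^sup>2) else 0)"
    proof (cases "coprime d M")
      case True
      have "coprime d (4 * t)" using True M(2) by (meson coprime_divisors dvd_refl)
      hence od: "odd d" and ct: "coprime t d" by (auto simp: coprime_commute)
      have odi: "odd (int d)" using od by simp
      have q: "quadratic_character (int t) (int d) * quadratic_character (int t) (int d) = 1"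
      proof -
        have "(jacobi (int t) d)\<^sup>2 = 1" using jacobi_square[OF od] ct by simp
        hence "of_int (jacobi (int t) d * jacobi (int t) d) = (1 :: complex)" by (simp only: power2_eq_square of_int_1)
        thus ?thesis unfolding quadratic_character_eq_jacobi[OF odi t] by simp
      qed
      have c: "chi_minus4 (int d) ^ k * chi_minus4 (int d) ^ (k + 2 * w) = 1"
      proof -
        have "chi_minus4 (int d) ^ 2 = 1" unfolding chi_minus4_eq_chi4[OF odi] by (simp add: chi4_def)
        hence "(chi_minus4 (int d) ^ 2) ^ (k + w) = 1" by simp
        thus ?thesis by (simp flip: power_add power_mult)
      qed
      have "trivial_character M (int d) * (chi (int d) * quadratic_character (int t) (int d) * chi_minus4 (int d) ^ k) *
        chi_minus4 (int d) ^ (k + 2 * w) * quadratic_character (int t) (int d) * of_nat d ^ (k + 2 * w - 1) * b (t * (n div d)\<^sup>2) =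
        trivial_character M (int d) * (quadratic_character (int t) (int d) * quadratic_character (int t) (int d)) *
        (chi_minus4 (int d) ^ k * chi_minus4 (int d) ^ (k + 2 * w)) * (psi w d * b (t * (n div d)\<^sup>2))"
        by (simp only: psi_def mult_ac)
      thus ?thesis unfolding q c using True by (simp add: trivial_character_def)
    qed (simp add: trivial_character_def)
  qed
  also have "\<dots> = (\<Sum>d\<in>{d\<in>{d. d dvd n}. coprime d M}. psi w d * b (t * (n div d)\<^sup>2))"
    using n by (intro sum.inter_filter[symmetric] finite_divisors_nat)
  also have "\<dots> = sieved (prime_factors M) (psi w) (\<lambda>m. b (t * m\<^sup>2)) n"
    unfolding sieved_def coprime_iff_prime_factors[OF M(1)] by simp
  finally show ?thesis .
qed

text \<open>The index \<open>m\<close> is left open so that both forms of the Euler operator are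
  instances: its primes must complete those of \<open>r div d\<close> to the primes of
  \<open>M\<close>, and may overlap with them only where \<open>chi\<close> vanishes.\<close>

lemma euler_op_divisor_bracket_expansion:
  assumes d: "d dvd r" and r: "r > 0" and M: "M > 0" "r dvd M"
    and S: "prime_factors (r div d) \<union> prime_factors m = prime_factors M"
      "\<And>p. p \<in> prime_factors m \<Longrightarrow> p \<notin> prime_factors (r div d) \<or> chi (int p) = 0"
    and w: "w > 0 \<or> a 0 = 0"
  shows "has_q_expansion (euler_op chi (k + 2 * w - 1) m (divisor_bracket k f (2 * w) r d))
    (\<lambda>n. if n = 0 then 0 else sieved (prime_factors M) (psi w) (pair_sum w r d) n)"
proof -
  define c where "c n = (\<Sum>u | u \<le> n \<and> r div d dvd u \<and> d dvd n - u \<and> coprime ((n - u) div d) (r div d).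
        a (u div (r div d)) * a ((n - u) div d) * rc_poly (real k) (real k) (2 * w) (of_nat u) (of_nat (n - u)))" for n
  \<comment> \<open>Only \<open>u = 0\<close> can contribute, with \<open>a 0 * a 0\<close> times
    the polynomial at (0, 0); the latter vanishes for \<open>w > 0\<close> by homogeneity.\<close>
  have "c 0 = 0" unfolding c_def
  proof (intro sum.neutral ballI)
    fix u assume "u \<in> {u. u \<le> 0 \<and> r div d dvd u \<and> d dvd 0 - u \<and> coprime ((0 - u) div d) (r div d)}"
    hence "u = 0" by simp
    thus "a (u div (r div d)) * a ((0 - u) div d) * rc_poly (real k) (real k) (2 * w) (of_nat u) (of_nat (0 - u)) = 0"
      using w rc_poly_0_0[of "2 * w" "real k" "real k"] by auto
  qed
  moreover have "has_q_expansion (divisor_bracket k f (2 * w) r d) c"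
    unfolding c_def by (rule divisor_bracket_expansion[OF d r])
  moreover have "c n = sieved (prime_factors (r div d)) (psi w) (pair_sum w r d) n" if "n > 0" for n
    unfolding c_def by (rule divisor_bracket_coeff_sieved[OF d r that])
  moreover have "prime p \<and> (p \<notin> prime_factors (r div d) \<or> psi w p = 0)"
    if "p \<in> set (sorted_list_of_set (prime_factors m))" for p
    using that S(2)[of p] by (auto simp: psi_def)
  ultimately have "has_q_expansion (fold (\<lambda>p. op_IB 1 (- psi w p) p) (sorted_list_of_set (prime_factors m)) (divisor_bracket k f (2 * w) r d))
     (\<lambda>n. if n = 0 then 0 else sieved (prime_factors (r div d) \<union> set (sorted_list_of_set (prime_factors m))) (psi w) (pair_sum w r d) n)"
    by (intro euler_op_list_expansion[where c = c] psi_mult) (auto intro: in_prime_factors_imp_prime)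
  moreover have "prime_factors (r div d) \<union> set (sorted_list_of_set (prime_factors m)) = prime_factors M"
    using S(1) by simp
  ultimately show ?thesis unfolding euler_op_def psi_def by (simp only:)
qed

end

section \<open>Assembly of the lift formula\<close>

lemma sieved_linear:
  "sieved S \<psi> (\<lambda>m. c * (\<Sum>d\<in>D. E d m)) n = c * (\<Sum>d\<in>D. sieved S \<psi> (E d) n)"
proof -
  have "sieved S \<psi> (\<lambda>m. c * (\<Sum>d\<in>D. E d m)) n =
      (\<Sum>g | g dvd n \<and> (\<forall>q\<in>S. \<not> q dvd g). \<Sum>d\<in>D. c * (\<psi> g * E d (n div g)))"
    unfolding sieved_def by (intro sum.cong refl) (simp add: sum_distrib_left mult_ac)
  also have "\<dots> = c * (\<Sum>d\<in>D. sieved S \<psi> (E d) n)"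
    unfolding sieved_def by (subst sum.swap) (simp add: sum_distrib_left)
  finally show ?thesis .
qed

context eigenform
begin

text \<open>For \<open>w = 0\<close> the bracket is the product of \<open>f (4 * r * z)\<close> and
  \<open>theta (t * z)\<close>. As theta has constant term 1, its own constant term is
  \<open>a 0\<close>.\<close>

lemma constant_term_eq_0:
  assumes "half_integral_cusp_form K M chi' (theta_bracket k f 0 r t)" "r > 0" "t > 0"
  shows "a 0 = 0"
proof -
  define h where "h = theta_bracket k f 0 r t"
  have "\<forall>a b c d. a * d - b * c = 1 \<longrightarrow>
        ((\<lambda>z. h (int_moebius a b c d z) / csqrt (of_int c * z + of_int d) ^ (2 * K + 1)) \<longlongrightarrow> 0)
          (filtercomap Im at_top)"
    using assms(1) unfolding half_integral_cusp_form_def h_def by blast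
  \<comment> \<open>The identity matrix, that is, the cusp at infinity.\<close>
  from this[rule_format, of 1 1 0 0] have "(h \<longlongrightarrow> 0) (filtercomap Im at_top)"
    by (simp add: moebius_def)
  moreover have "filtercomap Im at_top \<noteq> bot"
  proof (rule filtercomap_neq_bot)
    fix P :: "real \<Rightarrow> bool" assume "eventually P at_top"
    then obtain y where "\<And>x. x \<ge> y \<Longrightarrow> P x" by (auto simp: eventually_at_top_linorder)
    thus "\<exists>z. P (Im z)" by (intro exI[of _ "\<i> * of_real y"]) simp
  qed
  ultimately have "q_coeffs h 0 = 0"
    using has_q_expansion_tendsto[OF theta_bracket_expansion[OF assms(2,3), where w = 0]]
      q_coeffs_eq[OF theta_bracket_expansion[OF assms(2,3), where w = 0]] tendsto_unique
    unfolding h_def by metis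
  thus ?thesis unfolding h_def q_coeffs_eq[OF theta_bracket_expansion[OF assms(2,3)]]
    by (simp add: rc_poly_0)
qed

lemma shimura_lift_formula:
  assumes r: "0 < r" and t: "0 < t" "squarefree t" "t dvd N" "coprime t r"
    and M: "0 < M" "4 * N * r dvd M"
    and hc: "half_integral_cusp_form (k + 2 * w) M (\<lambda>n. chi n * quadratic_character (int t) n * chi_minus4 n ^ k)
       (theta_bracket k f w r t)"
    and m: "\<And>d. d dvd r \<Longrightarrow> prime_factors (r div d) \<union> prime_factors (m d) = prime_factors M"
      "\<And>d p. d dvd r \<Longrightarrow> p \<in> prime_factors (m d) \<Longrightarrow> p \<notin> prime_factors (r div d) \<or> chi (int p) = 0"
    and z: "Im z > 0"
  shows "shimura_lift (k + 2 * w) M (\<lambda>n. chi n * quadratic_character (int t) n * chi_minus4 n ^ k) t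
      (theta_bracket k f w r t) z =
    of_nat ((2 * w) choose w) * inverse (of_nat ((k + 2 * w - 1) choose (k + w - 1))) * a t * of_nat t ^ w *
      (\<Sum>d | d dvd r. euler_op chi (k + 2 * w - 1) (m d) (divisor_bracket k f (2 * w) r d) z)"
proof -
  define chi' where "chi' = (\<lambda>n. chi n * quadratic_character (int t) n * chi_minus4 n ^ k)"
  define C where "C = of_nat ((2 * w) choose w) * inverse (of_nat ((k + 2 * w - 1) choose (k + w - 1))) * a t * of_nat t ^ w"
  have w: "w > 0 \<or> a 0 = 0"
    using constant_term_eq_0[of "k + 2 * w" M chi' r t] hc r t(1) by (cases "w = 0") (auto simp: chi'_def)
  have rM: "r dvd M" using M(2) by (metis dvd_mult_right)
  have tM: "4 * t dvd M"
  proof -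
    have "4 * t dvd 4 * N * r" using t(3) by (simp add: mult_dvd_mono)
    thus ?thesis using M(2) dvd_trans by blast
  qed
  have "has_q_expansion (\<lambda>z. C * (\<Sum>d | d dvd r. euler_op chi (k + 2 * w - 1) (m d) (divisor_bracket k f (2 * w) r d) z))
     (\<lambda>n. C * (\<Sum>d | d dvd r. if n = 0 then 0 else sieved (prime_factors M) (psi w) (pair_sum w r d) n))"
    by (intro has_q_expansion_cmult has_q_expansion_sum euler_op_divisor_bracket_expansion r M(1) rM w)
       (use m in auto)
  moreover have "C * (\<Sum>d | d dvd r. if n = 0 then 0 else sieved (prime_factors M) (psi w) (pair_sum w r d) n) =
      shimura_coeff (k + 2 * w) M chi' t (q_coeffs (theta_bracket k f w r t)) n" for n
  proof (cases "n = 0")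
    case False
    hence n: "n > 0" by simp
    show ?thesis
      unfolding chi'_def shimura_coeff_eq_sieved[OF M(1) tM t(1) n]
        theta_bracket_coeff_square[OF r t(1,2,4,3)] C_def[symmetric] sieved_linear using False by simp
  qed (simp add: shimura_coeff_def)
  ultimately have "has_q_expansion (\<lambda>z. C * (\<Sum>d | d dvd r. euler_op chi (k + 2 * w - 1) (m d) (divisor_bracket k f (2 * w) r d) z))
      (shimura_coeff (k + 2 * w) M chi' t (q_coeffs (theta_bracket k f w r t)))"
    by (simp only:)
  from q_series_eq[OF this z] show ?thesis unfolding shimura_lift_def chi'_def C_def .
qed

lemma theta_bracket_half_integral:
  assumes r: "0 < r" and t: "0 < t" "t dvd N" and M: "4 * N * r dvd M"
    and w: "0 < w \<or> cusp_form k N chi f"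
  shows "half_integral_cusp_form (k + 2 * w) M (\<lambda>n. chi n * quadratic_character (int t) n * chi_minus4 n ^ k)
       (theta_bracket k f w r t)"
  unfolding half_integral_cusp_form_def
proof (intro conjI allI impI)
  have f: "f holomorphic_on uhp" by (rule has_q_expansion_holomorphic[OF f_q_expansion])
  show "theta_bracket k f w r t holomorphic_on uhp"
    by (rule has_q_expansion_holomorphic[OF theta_bracket_expansion[OF r t(1)]])
  show "theta_bracket k f w r t (int_moebius x b c d z) =
      chi d * quadratic_character (int t) d * chi_minus4 d ^ k * theta_factor c d z ^ (2 * (k + 2 * w) + 1) *
      theta_bracket k f w r t z"
    if "x * d - b * c = 1" "int M dvd c" "Im z > 0" for x b c d z
    by (rule theta_bracket_transformation[OF k_pos r t M f f_modular that])
  show "((\<lambda>z. theta_bracket k f w r t (int_moebius x b c d z) / csqrt (of_int c * z + of_int d) ^ (2 * (k + 2 * w) + 1))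
      \<longlongrightarrow> 0) (filtercomap Im at_top)" if det: "x * d - b * c = 1" for x b c d
    unfolding theta_bracket_def
  proof (rule theta_bracket_cusp_vanishing[OF k_pos _ t(1) f _ _ det])
    show "0 < 4 * r" using r by simp
    show "Bfun (\<lambda>z. f (int_moebius a b c d z) / (of_int c * z + of_int d) ^ k) (filtercomap Im at_top)"
      if "a * d - b * c = 1" for a b c d
      using eigenform that unfolding normalized_hecke_eigenform_def modular_form_def by blast
    show "0 < w \<or> (\<forall>a b c d. a * d - b * c = 1 \<longrightarrow>
        ((\<lambda>z. f (int_moebius a b c d z) / (of_int c * z + of_int d) ^ k) \<longlongrightarrow> 0) (filtercomap Im at_top))"
      using w unfolding cusp_form_def by blast
  qed
qed

end

theorem theorem1p4:
  fixes k N w r t M :: nat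
    and chi :: "int \<Rightarrow> complex"
    and f :: "complex \<Rightarrow> complex"
    and a :: "nat \<Rightarrow> complex"
  assumes "0 < k" and "0 < N"
    and "dirichlet_character N chi"
    and "normalized_hecke_eigenform k N chi f a"
    and "0 < r"
    and "0 < t" and "squarefree t" and "t dvd N" and "coprime t r"
    and "0 < M" and "4 * N * r dvd M"
  shows
    "let K = k + 2 * w;
         chi' = (\<lambda>n. chi n * quadratic_character (int t) n * chi_minus4 n ^ k);
         h = theta_bracket k f w r t;
         rhs = (\<lambda>(m :: nat \<Rightarrow> nat) z.
           of_nat ((2 * w) choose w) * inverse (of_nat ((k + 2 * w - 1) choose (k + w - 1))) *
           a t * of_nat t ^ w *
           (\<Sum>d | d dvd r. euler_op chi (k + 2 * w - 1) (m d) (divisor_bracket k f (2 * w) r d) z))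
     in (0 < w \<or> cusp_form k N chi f \<longrightarrow> half_integral_cusp_form K M chi' h) \<and>
        (half_integral_cusp_form K M chi' h \<longrightarrow>
          (even N \<or> odd r \<longrightarrow> (\<forall>z. Im z > 0 \<longrightarrow>
             shimura_lift K M chi' t h z = rhs (\<lambda>d. 2 * rad M div rad (r div d)) z)) \<and>
          (\<forall>z. Im z > 0 \<longrightarrow>
             shimura_lift K M chi' t h z = rhs (\<lambda>d. rad M div rad (r div d)) z))"
proof -
  interpret eigenform k N chi f a by unfold_locales (rule assms)+
  have rM: "r dvd M" using assms(11) by (metis dvd_mult_right)
  have pf: "prime_factors (rad M div rad (r div d)) = prime_factors M - prime_factors (r div d)"
    "prime_factors (2 * rad M div rad (r div d)) = insert 2 (prime_factors M - prime_factors (r div d))"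
    "prime_factors (r div d) \<subseteq> prime_factors M" if "d dvd r" for d
  proof -
    have "r div d dvd r" using that by (metis dvd_div_mult_self dvd_triv_left)
    hence e: "r div d dvd M" using rM by (rule dvd_trans)
    show "prime_factors (rad M div rad (r div d)) = prime_factors M - prime_factors (r div d)"
      "prime_factors (2 * rad M div rad (r div d)) = insert 2 (prime_factors M - prime_factors (r div d))"
      using prime_factors_rad[OF assms(10) e] by auto
    show "prime_factors (r div d) \<subseteq> prime_factors M" using e assms(10) by (intro dvd_prime_factors) auto
  qed
  have "even M"
  proof -
    have "2 dvd 4 * N * r" by simp
    thus ?thesis using assms(11) dvd_trans by blast
  qed
  hence two: "2 \<in> prime_factors M" using assms(10) by (simp add: in_prime_factors_iff)
  \<comment> \<open>The only prime at which the doubled level can meet the primes of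
    \<open>r / d\<close> is 2. Then \<open>r\<close> is even, so the parity hypothesis makes
    \<open>N\<close> even and \<open>chi\<close> vanishes at 2.\<close>
  have chi2: "chi 2 = 0" if "even N \<or> odd r" "d dvd r" "2 \<in> prime_factors (r div d)" for d
  proof -
    have "2 dvd r div d" using that(3) by auto
    hence "even r" using that(2) by (metis dvd_div_mult_self dvd_mult2)
    hence "even N" using that(1) by simp
    hence "\<not> coprime 2 (int N)" by simp
    thus ?thesis by (simp add: chi_eq_0_iff)
  qed
  show ?thesis unfolding Let_def
  proof (intro conjI impI allI)
    show "half_integral_cusp_form (k + 2 * w) M (\<lambda>n. chi n * quadratic_character (int t) n * chi_minus4 n ^ k)
       (theta_bracket k f w r t)" if "0 < w \<or> cusp_form k N chi f"
      by (rule theta_bracket_half_integral[OF assms(5,6,8,11) that])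
  next
    fix z :: complex
    assume hc: "half_integral_cusp_form (k + 2 * w) M (\<lambda>n. chi n * quadratic_character (int t) n * chi_minus4 n ^ k)
       (theta_bracket k f w r t)" and eo: "even N \<or> odd r" and z: "Im z > 0"
    note F = shimura_lift_formula[OF assms(5-11) hc _ _ z]
    show "shimura_lift (k + 2 * w) M (\<lambda>n. chi n * quadratic_character (int t) n * chi_minus4 n ^ k) t
        (theta_bracket k f w r t) z =
      of_nat ((2 * w) choose w) * inverse (of_nat ((k + 2 * w - 1) choose (k + w - 1))) * a t * of_nat t ^ w *
        (\<Sum>d | d dvd r. euler_op chi (k + 2 * w - 1) (2 * rad M div rad (r div d)) (divisor_bracket k f (2 * w) r d) z)"
    proof (rule F)
      fix d assume d: "d dvd r"
      show "prime_factors (r div d) \<union> prime_factors (2 * rad M div rad (r div d)) = prime_factors M"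
        unfolding pf(2)[OF d] using pf(3)[OF d] two by blast
      show "p \<notin> prime_factors (r div d) \<or> chi (int p) = 0" if "p \<in> prime_factors (2 * rad M div rad (r div d))" for p
      proof (cases "p = 2")
        case True
        thus ?thesis using chi2[OF eo d] by auto
      qed (use that in \<open>simp only: pf(2)[OF d], blast\<close>)
    qed
  next
    fix z :: complex
    assume hc: "half_integral_cusp_form (k + 2 * w) M (\<lambda>n. chi n * quadratic_character (int t) n * chi_minus4 n ^ k)
       (theta_bracket k f w r t)" and z: "Im z > 0"
    note F = shimura_lift_formula[OF assms(5-11) hc _ _ z]
    show "shimura_lift (k + 2 * w) M (\<lambda>n. chi n * quadratic_character (int t) n * chi_minus4 n ^ k) t
        (theta_bracket k f w r t) z =
      of_nat ((2 * w) choose w) * inverse (of_nat ((k + 2 * w - 1) choose (k + w - 1))) * a t * of_nat t ^ w *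
        (\<Sum>d | d dvd r. euler_op chi (k + 2 * w - 1) (rad M div rad (r div d)) (divisor_bracket k f (2 * w) r d) z)"
    proof (rule F)
      fix d assume d: "d dvd r"
      show "prime_factors (r div d) \<union> prime_factors (rad M div rad (r div d)) = prime_factors M"
        unfolding pf(1)[OF d] using pf(3)[OF d] by blast
      show "p \<notin> prime_factors (r div d) \<or> chi (int p) = 0" if "p \<in> prime_factors (rad M div rad (r div d))" for p
        using that unfolding pf(1)[OF d] by blast
    qed
  qed
qed

end
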